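(* Let $Z$ be a (positive-definite) conic Zermelo metric on $M$ with navigation data $(F,W)$ and let $\nu$ be a volume form on $M$. If $f:\mathcal U\subset M\to\mathbb R$ is a $Z$-admissible function, then the following are equivalent: (1) $W$ and $\operatorname{div}W$ are $f$-projectable; (2) $f$ is $(F,\nu)$-isoparametric if and only if it is $(Z,\nu)$-isoparametric.
   Context: $M$ is a smooth connected $n$-dimensional manifold, $\pi:TM\to M$ its tangent bundle. A conic Finsler metric on $M$ is a continuous function $F:A\to[0,\infty)$, where $A\subset TM$ is open, conic ($rv\in A$ for $v\in A$, $r>0$), $\pi(A)=M$, each $A_p=A\cap T_pM$ is connected, $F$ is smooth on $A\setminus 0$, $F(rv)=rF(v)$ for $r>0$, and for each $v\in A\setminus 0$ the fundamental tensor $g_v(u_1,u_2)=\frac12\frac{\partial^2}{\partial t_2\partial t_1}F^2(v+t_1u_1+t_2u_2)|_{t_1=t_2=0}$ is positive-definite on $T_{\pi(v)}M$. It is a (regular) Finsler metric if $A=TM$. Conic Zermelo metric. Let $F:TM\to[0,\infty)$ be a Finsler metric with indicatrix $\Sigma^F=F^{-1}(1)$ and fundamental tensor $g^F$, and $W$ a smooth vector field on $M$. Let $\Sigma=\{u+W: u\in\Sigma^F,\ g^F_u(u,-W)<1\}$, $A\setminus0=\{rv: v\in\Sigma, r>0\}$, and define $Z:A\to[0,\infty)$ by $Z(v)=r>0$ iff $r^{-1}v\in\Sigma$, $Z(v)=0$ iff $v=0$. Then $F(v/Z(v)-W)=1$ for $v\in A\setminus0$, and $Z$ is a conic Finsler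 metric, called the conic Zermelo metric with navigation data $(F,W)$. For a conic Finsler metric (written $F$, with domain $A$): a smooth function $f:\mathcal U\to\mathbb R$ on an open set is admissible if on $\{df\ne0\}$ there is a vector field $\nabla f$ with values in $A\setminus0$ (the gradient) with $g_{\nabla f_p}(\nabla f_p,u)=df_p(u)$ for all $u\in T_pM$; set $\nabla f(p)=0$ where $df_p=0$. A volume form $\nu$ is a smooth nowhere-vanishing family of local top-degree forms transforming with the absolute value of the Jacobian (a positive smooth density); $(\operatorname{div}X)\nu=\mathcal L_X\nu$; $\triangle f=\operatorname{div}(\nabla f)$ on $\{df\ne0\}$. A nonconstant admissible $f$ is $(F,\nu)$-isoparametric if there are continuous real functions $a,b$ on $f(\{df\ne0\})$, with $b$ smooth on the interior, such that $F^2(\nabla f)=b\circ f$ and $\triangle f=a\circ f$ on $\{df\neq 0\}$; in the paper's terms, if and only if $F(\nabla f)$ and $\triangle f$ are $f$-projectable. A function on $\mathcal U$ is $f$-projectable if it is constant on the fibers (level sets) of $f$. A smooth vector field $X$ on $\mathcal U$ is $f$-projectable if its flow takes any fiber of $f$ into a fiber of $f$; for differentiable $f$, the paper takes this as equivalent to $df(X)$ being an $f$-projectable function.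
   Formalization: (2)⇒(1) is stated only when f is isoparametric for F or for Z (otherwise (2) is vacuous and the claim fails, e.g. f constant with div W nonconstant), and f-projectability of W and div W is required only on {df≠0}, since it can fail where df=0. *)

theory Defs
  imports "HOL-Analysis.Analysis"
begin

section \<open>Smooth maps between open subsets of Euclidean spaces\<close>

fun times_differentiable_on ::
  "nat \<Rightarrow> 'a::euclidean_space set \<Rightarrow> ('a \<Rightarrow> 'b::euclidean_space) \<Rightarrow> bool" where
  "times_differentiable_on 0 S f \<longleftrightarrow> continuous_on S f"
| "times_differentiable_on (Suc k) S f \<longleftrightarrow>
     (\<forall>x\<in>S. f differentiable (at x)) \<and>
     (\<forall>v. times_differentiable_on k S (\<lambda>x. frechet_derivative f (at x) v))"

text \<open>Meant for open \<open>S\<close>: derivatives are taken in the ambient space.\<close>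

definition smooth_on :: "'a::euclidean_space set \<Rightarrow> ('a \<Rightarrow> 'b::euclidean_space) \<Rightarrow> bool" where
  "smooth_on S f \<longleftrightarrow> (\<forall>k. times_differentiable_on k S f)"

section \<open>Manifolds\<close>

text \<open>
  The manifold is the whole type \<open>'m\<close>, of dimension \<open>CARD('n)\<close>; its smooth structure is given
  by an atlas (not necessarily maximal). A chart is a pair of its domain and its coordinate map.
\<close>

type_synonym ('m, 'n) chart = "'m set \<times> ('m \<Rightarrow> real ^ 'n)"

abbreviation cdom :: "('m, 'n) chart \<Rightarrow> 'm set" where "cdom \<equiv> fst"
abbreviation cmap :: "('m, 'n) chart \<Rightarrow> 'm \<Rightarrow> real ^ 'n" where "cmap \<equiv> snd"

definition cinv :: "('m, 'n) chart \<Rightarrow> real ^ 'n \<Rightarrow> 'm" where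
  "cinv c = inv_into (cdom c) (cmap c)"

definition is_chart :: "('m::topological_space, 'n::finite) chart \<Rightarrow> bool" where
  "is_chart c \<longleftrightarrow> open (cdom c) \<and> open (cmap c ` cdom c) \<and>
     homeomorphism (cdom c) (cmap c ` cdom c) (cmap c) (cinv c)"

definition smooth_manifold ::
  "('m::{t2_space,second_countable_topology}, 'n::finite) chart set \<Rightarrow> bool" where
  "smooth_manifold \<A> \<longleftrightarrow>
     (\<forall>c\<in>\<A>. is_chart c) \<and> (\<Union>c\<in>\<A>. cdom c) = UNIV \<and>
     (\<forall>c\<in>\<A>. \<forall>d\<in>\<A>. smooth_on (cmap c ` (cdom c \<inter> cdom d)) (cmap d \<circ> cinv c))"

definition charts_at :: "('m, 'n) chart set \<Rightarrow> 'm \<Rightarrow> ('m, 'n) chart set" where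
  "charts_at \<A> p = {c \<in> \<A>. p \<in> cdom c}"

definition chart_at :: "('m, 'n) chart set \<Rightarrow> 'm \<Rightarrow> ('m, 'n) chart" where
  "chart_at \<A> p = (SOME c. c \<in> charts_at \<A> p)"

definition transition_deriv ::
  "('m, 'n::finite) chart \<Rightarrow> ('m, 'n) chart \<Rightarrow> 'm \<Rightarrow> real ^ 'n \<Rightarrow> real ^ 'n" where
  "transition_deriv c d p = frechet_derivative (cmap d \<circ> cinv c) (at (cmap c p))"

definition smooth_fun ::
  "('m, 'n::finite) chart set \<Rightarrow> 'm set \<Rightarrow> ('m \<Rightarrow> real) \<Rightarrow> bool" where
  "smooth_fun \<A> U f \<longleftrightarrow> (\<forall>c\<in>\<A>. smooth_on (cmap c ` (cdom c \<inter> U)) (f \<circ> cinv c))"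

section \<open>The tangent bundle\<close>

text \<open>
  A tangent vector at \<open>p\<close> is the family of its coordinate vectors in the charts around \<open>p\<close>,
  related by the derivatives of the transition maps. For charts of the atlas not containing \<open>p\<close>
  (and for non-charts) the entry is \<open>0\<close>, so that equality of tangent vectors is equality of families.
\<close>

type_synonym ('m, 'n) tvec = "('m, 'n) chart \<Rightarrow> real ^ 'n"

definition tangent_space :: "('m, 'n::finite) chart set \<Rightarrow> 'm \<Rightarrow> ('m, 'n) tvec set" where
  "tangent_space \<A> p = {v.
     (\<forall>c\<in>charts_at \<A> p. \<forall>d\<in>charts_at \<A> p. v d = transition_deriv c d p (v c)) \<and>
     (\<forall>c. c \<notin> charts_at \<A> p \<longrightarrow> v c = 0)}"

definition tzero :: "('m, 'n::finite) tvec" where "tzero = (\<lambda>c. 0)"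

definition tadd :: "('m, 'n::finite) tvec \<Rightarrow> ('m, 'n) tvec \<Rightarrow> ('m, 'n) tvec" where
  "tadd u v = (\<lambda>c. u c + v c)"

definition tscale :: "real \<Rightarrow> ('m, 'n::finite) tvec \<Rightarrow> ('m, 'n) tvec" where
  "tscale r v = (\<lambda>c. r *\<^sub>R v c)"

definition tangent_bundle :: "('m, 'n::finite) chart set \<Rightarrow> ('m \<times> ('m, 'n) tvec) set" where
  "tangent_bundle \<A> = {(p, v). v \<in> tangent_space \<A> p}"

definition off_zero :: "('m \<times> ('m, 'n::finite) tvec) set \<Rightarrow> ('m \<times> ('m, 'n) tvec) set" where
  "off_zero A = {(p, v) \<in> A. v \<noteq> tzero}"

definition fibre :: "('m \<times> ('m, 'n) tvec) set \<Rightarrow> 'm \<Rightarrow> ('m, 'n) tvec set" where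
  "fibre A p = {v. (p, v) \<in> A}"

text \<open>\<open>tm_image c A\<close> is the image of \<open>A\<close> under the bundle chart of \<open>TM\<close> induced by \<open>c\<close>, and
  \<open>tm_inv \<A> c\<close> is the inverse of that bundle chart.\<close>

definition tm_image ::
  "('m, 'n) chart \<Rightarrow> ('m \<times> ('m, 'n::finite) tvec) set \<Rightarrow> ((real ^ 'n) \<times> (real ^ 'n)) set" where
  "tm_image c A = {(cmap c p, v c) | p v. (p, v) \<in> A \<and> p \<in> cdom c}"

definition tvec_of ::
  "('m, 'n::finite) chart set \<Rightarrow> ('m, 'n) chart \<Rightarrow> 'm \<Rightarrow> real ^ 'n \<Rightarrow> ('m, 'n) tvec" where
  "tvec_of \<A> c p y = (\<lambda>d. if d \<in> charts_at \<A> p then transition_deriv c d p y else 0)"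

definition tm_inv ::
  "('m, 'n::finite) chart set \<Rightarrow> ('m, 'n) chart \<Rightarrow> (real ^ 'n) \<times> (real ^ 'n)
     \<Rightarrow> 'm \<times> ('m, 'n) tvec" where
  "tm_inv \<A> c = (\<lambda>(x, y). (cinv c x, tvec_of \<A> c (cinv c x) y))"

definition tm_open :: "('m, 'n::finite) chart set \<Rightarrow> ('m \<times> ('m, 'n) tvec) set \<Rightarrow> bool" where
  "tm_open \<A> A \<longleftrightarrow> A \<subseteq> tangent_bundle \<A> \<and> (\<forall>c\<in>\<A>. open (tm_image c A))"

definition tm_continuous_on ::
  "('m, 'n::finite) chart set \<Rightarrow> ('m \<times> ('m, 'n) tvec) set \<Rightarrow> ('m \<times> ('m, 'n) tvec \<Rightarrow> real) \<Rightarrow> bool"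
  where
  "tm_continuous_on \<A> A F \<longleftrightarrow> (\<forall>c\<in>\<A>. continuous_on (tm_image c A) (F \<circ> tm_inv \<A> c))"

definition tm_smooth_on ::
  "('m, 'n::finite) chart set \<Rightarrow> ('m \<times> ('m, 'n) tvec) set \<Rightarrow> ('m \<times> ('m, 'n) tvec \<Rightarrow> real) \<Rightarrow> bool"
  where
  "tm_smooth_on \<A> A F \<longleftrightarrow> (\<forall>c\<in>\<A>. smooth_on (tm_image c A) (F \<circ> tm_inv \<A> c))"

definition smooth_vector_field ::
  "('m, 'n::finite) chart set \<Rightarrow> 'm set \<Rightarrow> ('m \<Rightarrow> ('m, 'n) tvec) \<Rightarrow> bool" where
  "smooth_vector_field \<A> U X \<longleftrightarrow> (\<forall>p\<in>U. X p \<in> tangent_space \<A> p) \<and>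
     (\<forall>c\<in>\<A>. smooth_on (cmap c ` (cdom c \<inter> U)) (\<lambda>x. X (cinv c x) c))"

definition differential ::
  "('m, 'n::finite) chart set \<Rightarrow> ('m \<Rightarrow> real) \<Rightarrow> 'm \<Rightarrow> ('m, 'n) tvec \<Rightarrow> real" where
  "differential \<A> f p u =
     (let c = chart_at \<A> p in frechet_derivative (f \<circ> cinv c) (at (cmap c p)) (u c))"

text \<open>\<open>regular_set \<A> U f\<close> is the set written \<open>{df \<noteq> 0}\<close>.\<close>

definition regular_set :: "('m, 'n::finite) chart set \<Rightarrow> 'm set \<Rightarrow> ('m \<Rightarrow> real) \<Rightarrow> 'm set" where
  "regular_set \<A> U f = {p \<in> U. \<exists>u\<in>tangent_space \<A> p. differential \<A> f p u \<noteq> 0}"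

section \<open>Conic Finsler metrics\<close>

definition fundamental_tensor ::
  "('m \<times> ('m, 'n::finite) tvec \<Rightarrow> real) \<Rightarrow> 'm \<Rightarrow> ('m, 'n) tvec
     \<Rightarrow> ('m, 'n) tvec \<Rightarrow> ('m, 'n) tvec \<Rightarrow> real" where
  "fundamental_tensor F p v u\<^sub>1 u\<^sub>2 =
     1/2 * deriv (\<lambda>t\<^sub>2. deriv (\<lambda>t\<^sub>1. (F (p, tadd v (tadd (tscale t\<^sub>1 u\<^sub>1) (tscale t\<^sub>2 u\<^sub>2))))\<^sup>2) 0) 0"

text \<open>Only the values of \<open>F\<close> on \<open>A\<close> matter. Connectedness of \<open>A\<^sub>p\<close> is tested in linear
  coordinates of the tangent space at \<open>p\<close>.\<close>

definition conic_finsler_metric ::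
  "('m, 'n::finite) chart set \<Rightarrow> ('m \<times> ('m, 'n) tvec) set \<Rightarrow> ('m \<times> ('m, 'n) tvec \<Rightarrow> real) \<Rightarrow> bool"
  where
  "conic_finsler_metric \<A> A F \<longleftrightarrow>
     tm_open \<A> A \<and>
     (\<forall>(p, v)\<in>A. \<forall>r>0. (p, tscale r v) \<in> A) \<and>
     fst ` A = UNIV \<and>
     (\<forall>p. \<forall>c\<in>charts_at \<A> p. connected ((\<lambda>v. v c) ` fibre A p)) \<and>
     (\<forall>\<xi>\<in>A. F \<xi> \<ge> 0) \<and>
     tm_continuous_on \<A> A F \<and>
     tm_smooth_on \<A> (off_zero A) F \<and>
     (\<forall>(p, v)\<in>A. \<forall>r>0. F (p, tscale r v) = r * F (p, v)) \<and>
     (\<forall>(p, v)\<in>off_zero A. \<forall>u\<in>tangent_space \<A> p.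
        u \<noteq> tzero \<longrightarrow> fundamental_tensor F p v u u > 0)"

definition finsler_metric ::
  "('m, 'n::finite) chart set \<Rightarrow> ('m \<times> ('m, 'n) tvec \<Rightarrow> real) \<Rightarrow> bool" where
  "finsler_metric \<A> F \<longleftrightarrow> conic_finsler_metric \<A> (tangent_bundle \<A>) F"

definition zermelo_indicatrix ::
  "('m, 'n::finite) chart set \<Rightarrow> ('m \<times> ('m, 'n) tvec \<Rightarrow> real) \<Rightarrow> ('m \<Rightarrow> ('m, 'n) tvec)
     \<Rightarrow> ('m \<times> ('m, 'n) tvec) set" where
  "zermelo_indicatrix \<A> F W = {(p, tadd u (W p)) | p u. u \<in> tangent_space \<A> p \<and> F (p, u) = 1 \<and>
     fundamental_tensor F p u u (tscale (-1) (W p)) < 1}"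

text \<open>The construction fixes \<open>A\<close> only off the zero section, so \<open>A\<close> is a parameter. That the
  resulting \<open>Z\<close> is a conic Finsler metric on \<open>A\<close> is recorded as part of the notion; this also
  determines at which points the zero vector may or must belong to \<open>A\<close>.\<close>

definition conic_zermelo_metric ::
  "('m, 'n::finite) chart set \<Rightarrow> ('m \<times> ('m, 'n) tvec \<Rightarrow> real) \<Rightarrow> ('m \<Rightarrow> ('m, 'n) tvec)
     \<Rightarrow> ('m \<times> ('m, 'n) tvec) set \<Rightarrow> ('m \<times> ('m, 'n) tvec \<Rightarrow> real) \<Rightarrow> bool" where
  "conic_zermelo_metric \<A> F W A Z \<longleftrightarrow>
     off_zero A = {(p, tscale r v) | p v r. (p, v) \<in> zermelo_indicatrix \<A> F W \<and> r > 0} \<and>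
     (\<forall>(p, v)\<in>A.
        (\<forall>r>0. Z (p, v) = r \<longleftrightarrow> (p, tscale (inverse r) v) \<in> zermelo_indicatrix \<A> F W) \<and>
        (Z (p, v) = 0 \<longleftrightarrow> v = tzero)) \<and>
     conic_finsler_metric \<A> A Z"

section \<open>Volume forms and divergence\<close>

text \<open>\<open>\<nu> c p\<close> is the coefficient at \<open>p\<close> of the density with respect to the coordinates of \<open>c\<close>.\<close>

definition volume_form ::
  "('m, 'n::finite) chart set \<Rightarrow> (('m, 'n) chart \<Rightarrow> 'm \<Rightarrow> real) \<Rightarrow> bool" where
  "volume_form \<A> \<nu> \<longleftrightarrow>
     (\<forall>c\<in>\<A>. smooth_on (cmap c ` cdom c) (\<nu> c \<circ> cinv c) \<and> (\<forall>p\<in>cdom c. \<nu> c p > 0)) \<and>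
     (\<forall>c\<in>\<A>. \<forall>d\<in>\<A>. \<forall>p\<in>cdom c \<inter> cdom d.
        \<nu> c p = \<bar>det (matrix (transition_deriv c d p))\<bar> * \<nu> d p)"

text \<open>Coefficient of the Lie derivative of \<open>\<nu>\<close> along \<open>X\<close>, by Cartan's formula for the
  (closed) local top-degree form: \<open>L\<^sub>X \<nu> = d (\<iota>\<^sub>X \<nu>)\<close>.\<close>

definition lie_derivative ::
  "('m \<Rightarrow> ('m, 'n::finite) tvec) \<Rightarrow> (('m, 'n) chart \<Rightarrow> 'm \<Rightarrow> real) \<Rightarrow> ('m, 'n) chart \<Rightarrow> 'm \<Rightarrow> real"
  where
  "lie_derivative X \<nu> c p =
     (\<Sum>i\<in>UNIV. frechet_derivative (\<lambda>x. \<nu> c (cinv c x) * X (cinv c x) c $ i) (at (cmap c p)) (axis i 1))"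

definition divergence ::
  "('m, 'n::finite) chart set \<Rightarrow> (('m, 'n) chart \<Rightarrow> 'm \<Rightarrow> real) \<Rightarrow> ('m \<Rightarrow> ('m, 'n) tvec) \<Rightarrow> 'm \<Rightarrow> real"
  where
  "divergence \<A> \<nu> X p = (let c = chart_at \<A> p in lie_derivative X \<nu> c p / \<nu> c p)"

section \<open>Admissible and isoparametric functions\<close>

definition gradient_field ::
  "('m, 'n::finite) chart set \<Rightarrow> ('m \<times> ('m, 'n) tvec) set \<Rightarrow> ('m \<times> ('m, 'n) tvec \<Rightarrow> real)
     \<Rightarrow> 'm set \<Rightarrow> ('m \<Rightarrow> real) \<Rightarrow> ('m \<Rightarrow> ('m, 'n) tvec) \<Rightarrow> bool" where
  "gradient_field \<A> A F U f X \<longleftrightarrow>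
     smooth_vector_field \<A> (regular_set \<A> U f) X \<and>
     (\<forall>p\<in>regular_set \<A> U f. (p, X p) \<in> off_zero A \<and>
        (\<forall>u\<in>tangent_space \<A> p. fundamental_tensor F p (X p) (X p) u = differential \<A> f p u)) \<and>
     (\<forall>p\<in>U - regular_set \<A> U f. X p = tzero)"

definition admissible ::
  "('m::topological_space, 'n::finite) chart set \<Rightarrow> ('m \<times> ('m, 'n) tvec) set
     \<Rightarrow> ('m \<times> ('m, 'n) tvec \<Rightarrow> real) \<Rightarrow> 'm set \<Rightarrow> ('m \<Rightarrow> real) \<Rightarrow> bool" where
  "admissible \<A> A F U f \<longleftrightarrow> open U \<and> smooth_fun \<A> U f \<and> (\<exists>X. gradient_field \<A> A F U f X)"

definition isoparametric ::
  "('m::topological_space, 'n::finite) chart set \<Rightarrow> ('m \<times> ('m, 'n) tvec) set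
     \<Rightarrow> ('m \<times> ('m, 'n) tvec \<Rightarrow> real) \<Rightarrow> (('m, 'n) chart \<Rightarrow> 'm \<Rightarrow> real)
     \<Rightarrow> 'm set \<Rightarrow> ('m \<Rightarrow> real) \<Rightarrow> bool" where
  "isoparametric \<A> A F \<nu> U f \<longleftrightarrow>
     admissible \<A> A F U f \<and> \<not> f constant_on U \<and>
     (\<exists>X. gradient_field \<A> A F U f X \<and>
        (\<exists>a b :: real \<Rightarrow> real.
           continuous_on (f ` regular_set \<A> U f) a \<and>
           continuous_on (f ` regular_set \<A> U f) b \<and>
           smooth_on (interior (f ` regular_set \<A> U f)) b \<and>
           (\<forall>p\<in>regular_set \<A> U f.
              (F (p, X p))\<^sup>2 = b (f p) \<and> divergence \<A> \<nu> X p = a (f p))))"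

section \<open>Projectability\<close>

definition projectable_fun :: "'m set \<Rightarrow> ('m \<Rightarrow> real) \<Rightarrow> ('m \<Rightarrow> real) \<Rightarrow> bool" where
  "projectable_fun V f h \<longleftrightarrow> (\<forall>p\<in>V. \<forall>q\<in>V. f p = f q \<longrightarrow> h p = h q)"

text \<open>\<open>\<gamma>\<close> is an integral curve of \<open>X\<close> inside \<open>V\<close> from time \<open>0\<close> to time \<open>t\<close>, where \<open>t\<close> may be
  negative.\<close>

definition integral_curve ::
  "('m::topological_space, 'n::finite) chart set \<Rightarrow> 'm set \<Rightarrow> ('m \<Rightarrow> ('m, 'n) tvec)
     \<Rightarrow> (real \<Rightarrow> 'm) \<Rightarrow> real \<Rightarrow> bool" where
  "integral_curve \<A> V X \<gamma> t \<longleftrightarrow>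
     continuous_on (closed_segment 0 t) \<gamma> \<and> \<gamma> ` closed_segment 0 t \<subseteq> V \<and>
     (\<forall>s\<in>closed_segment 0 t. \<forall>c\<in>charts_at \<A> (\<gamma> s).
        ((cmap c \<circ> \<gamma>) has_vector_derivative X (\<gamma> s) c) (at s within closed_segment 0 t))"

text \<open>The time-\<open>t\<close> local flow of \<open>X\<close> on \<open>V\<close> sends \<open>\<gamma> 0\<close> to \<open>\<gamma> t\<close>, for each integral curve
  \<open>\<gamma>\<close> in \<open>V\<close> reaching time \<open>t\<close>; so this says that the flow takes fibres of \<open>f\<close> in \<open>V\<close> into fibres.\<close>

definition projectable_vf ::
  "('m::topological_space, 'n::finite) chart set \<Rightarrow> 'm set \<Rightarrow> ('m \<Rightarrow> real)
     \<Rightarrow> ('m \<Rightarrow> ('m, 'n) tvec) \<Rightarrow> bool" where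
  "projectable_vf \<A> V f X \<longleftrightarrow>
     (\<forall>t \<gamma> \<delta>. integral_curve \<A> V X \<gamma> t \<and> integral_curve \<A> V X \<delta> t \<and> f (\<gamma> 0) = f (\<delta> 0)
        \<longrightarrow> f (\<gamma> t) = f (\<delta> t))"

end

theory Submission
  imports Defs
begin

text \<open>
  Let \<open>R = {df \<noteq> 0}\<close>, let \<open>X\<close> and \<open>Y\<close> be the gradients of \<open>f\<close> for \<open>Z\<close> and \<open>F\<close>, and put \<open>\<zeta> = Z(X)\<close>, \<open>\<eta> = F(Y)\<close>
  and \<open>\<omega> = df(W)\<close> on \<open>R\<close>. Differentiating \<open>F(v / Z(v) - W) = 1\<close> in \<open>v\<close> shows that \<open>dZ\<close> at \<open>X\<close> and \<open>dF\<close> at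
  \<open>X / \<zeta> - W\<close> are proportional, the factor being positive by the inequality in the definition of the
  indicatrix of \<open>Z\<close>. Since \<open>g\<^sub>v(v, \<cdot>)\<close> is \<open>F(v) dF(v)\<close>, and likewise for \<open>Z\<close>, the gradients satisfy
  \<open>\<zeta> = \<eta> + \<omega>\<close> and \<open>X = (\<zeta>/\<eta>) Y + \<zeta> W\<close> (\<open>navigation_derivative\<close>, \<open>zermelo_legendre_dual\<close>,
  \<open>navigation_gradients\<close>). This produces a gradient for \<open>F\<close> from one for \<open>Z\<close>, and strict convexity of
  \<open>F\<^sup>2\<close> makes it the only one (\<open>finsler_gradient_unique\<close>). Taking divergences,

    \<open>div X = (\<zeta>/\<eta>) div Y + d(\<zeta>/\<eta>)(Y) + \<zeta> div W + d\<zeta>(W)\<close>.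

  If \<open>\<zeta>\<close>, \<open>\<eta>\<close> and \<open>\<omega>\<close> are constant on the level sets of \<open>f\<close>, then so are the two derivatives on the right,
  because \<open>df(Y) = \<eta>\<^sup>2\<close> and \<open>df(W) = \<omega>\<close>. So among \<open>\<zeta>, \<eta>, \<omega>\<close> two projectable functions force the third to be
  projectable, and then the same is true of the three divergences. If \<open>W\<close> and \<open>div W\<close> are projectable,
  this transfers projectability of length and divergence between the two gradients; if both gradients
  have these properties, it gives them to \<open>\<omega>\<close> and \<open>div W\<close>.

  Three links connect this computation with the notions in the theorem. First, isoparametricity asks
  for \<open>\<zeta>\<^sup>2 = b \<circ> f\<close> and \<open>div X = a \<circ> f\<close> with regular \<open>a\<close> and \<open>b\<close>. They inherit regularity from \<open>\<zeta>\<close> and \<open>div X\<close>: on \<open>R\<close> the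
  function \<open>f\<close> is a submersion, and a smooth function of the form \<open>\<phi> \<circ> f\<close> has smooth \<open>\<phi>\<close>
  (\<open>descent_smooth\<close>). Secondly, this needs the divergence of a smooth field to be smooth, hence to be
  independent of the chart, which rests on Jacobi's formula and on the symmetry of second derivatives
  (\<open>coord_divergence_change_of_variables\<close>). Thirdly, projectability of \<open>W\<close> is a statement about its flow.
  It yields projectability of \<open>\<omega>\<close> by differentiating \<open>f\<close> along integral curves, which exist by Picard's
  theorem; conversely \<open>\<omega> = w \<circ> f\<close> makes \<open>f\<close> along an integral curve a solution of the scalar equation
  \<open>y' = w(y)\<close>, and solutions are unique (\<open>projectable_differential\<close>, \<open>projectable_vf_if_differential\<close>).
\<close>

section \<open>Calculus of smooth functions\<close>

lemma frechet_derivative_eqI: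
  assumes "(f has_derivative f') (at x)"
  shows "frechet_derivative f (at x) = f'"
  using frechet_derivative_at[OF assms] by simp

lemma has_derivative_cong_open:
  assumes "open S" "x \<in> S" "\<And>y. y \<in> S \<Longrightarrow> f y = g y"
  shows "(f has_derivative f') (at x) \<longleftrightarrow> (g has_derivative f') (at x)"
  using assms has_derivative_transform_within_open[of f f' x UNIV S g]
    has_derivative_transform_within_open[of g f' x UNIV S f] by auto

lemma frechet_derivative_cong_open:
  assumes "open S" "x \<in> S" "\<And>y. y \<in> S \<Longrightarrow> f y = g y"
  shows "frechet_derivative f (at x) = frechet_derivative g (at x)"
  unfolding frechet_derivative_def using has_derivative_cong_open[OF assms] by simp

lemma times_differentiable_on_cong:
  assumes "open S" "\<And>x. x \<in> S \<Longrightarrow> f x = g x"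
  shows "times_differentiable_on k S f \<longleftrightarrow> times_differentiable_on k S g"
  using assms(2)
proof (induction k arbitrary: f g)
  case 0
  then show ?case by (simp cong: continuous_on_cong)
next
  case (Suc k)
  have "f differentiable (at x) \<longleftrightarrow> g differentiable (at x)" if "x \<in> S" for x
    unfolding differentiable_def using has_derivative_cong_open[OF assms(1) that] Suc.prems by metis
  moreover have "frechet_derivative f (at x) = frechet_derivative g (at x)" if "x \<in> S" for x
    using frechet_derivative_cong_open[OF assms(1) that] Suc.prems by metis
  hence "times_differentiable_on k S (\<lambda>x. frechet_derivative f (at x) v) \<longleftrightarrow>
         times_differentiable_on k S (\<lambda>x. frechet_derivative g (at x) v)" for v
    by (intro Suc.IH) auto
  ultimately show ?case by auto
qed

text \<open>On an open set any pointwise formula for the derivative may replace the chosen one. All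
  closure properties below follow by induction on the order from the product, quotient and square
  root rules, whose right-hand sides involve only the functions and their first derivatives.\<close>

lemma times_differentiable_on_SucI:
  assumes "open S" "\<And>x. x \<in> S \<Longrightarrow> (f has_derivative f' x) (at x)"
    and "\<And>v. times_differentiable_on k S (\<lambda>x. f' x v)"
  shows "times_differentiable_on (Suc k) S f"
proof -
  have "times_differentiable_on k S (\<lambda>x. frechet_derivative f (at x) v)" for v
    using assms(3)[of v] times_differentiable_on_cong[OF assms(1), of "\<lambda>x. frechet_derivative f (at x) v" "\<lambda>x. f' x v"]
      frechet_derivative_eqI[OF assms(2)] by auto
  then show ?thesis using assms(2) by (auto simp: differentiable_def)
qed

lemma times_differentiable_on_SucD:
  assumes "times_differentiable_on (Suc k) S f"
  shows "x \<in> S \<Longrightarrow> (f has_derivative frechet_derivative f (at x)) (at x)"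
    and "times_differentiable_on k S (\<lambda>x. frechet_derivative f (at x) v)"
  using assms by (auto simp: frechet_derivative_works[symmetric])

lemma times_differentiable_on_continuous:
  "times_differentiable_on k S f \<Longrightarrow> continuous_on S f"
  by (cases k) (auto intro!: continuous_at_imp_continuous_on differentiable_imp_continuous_within)

lemma times_differentiable_on_pred:
  "times_differentiable_on (Suc k) S f \<Longrightarrow> times_differentiable_on k S f"
proof (induction k arbitrary: f)
  case 0
  then show ?case by (metis times_differentiable_on_continuous times_differentiable_on.simps(1))
next
  case (Suc k)
  then show ?case by (metis times_differentiable_on.simps(2))
qed

lemma times_differentiable_on_subset:
  "times_differentiable_on k S f \<Longrightarrow> T \<subseteq> S \<Longrightarrow> times_differentiable_on k T f"
proof (induction k arbitrary: f)
  case 0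
  then show ?case using continuous_on_subset by auto
next
  case (Suc k)
  then show ?case by auto
qed

lemma times_differentiable_on_const: 
  assumes "open S" shows "times_differentiable_on k S (\<lambda>x. c)"
proof (induction k arbitrary: c)
  case (Suc k)
  show ?case by (rule times_differentiable_on_SucI[OF assms has_derivative_const]) (auto intro: Suc.IH)
qed auto

lemma times_differentiable_on_linear:
  assumes "open S" "bounded_linear L" "times_differentiable_on k S f"
  shows "times_differentiable_on k S (\<lambda>x. L (f x))"
  using assms(3)
proof (induction k arbitrary: f)
  case 0
  then show ?case using bounded_linear.continuous_on[OF assms(2)] by auto
next
  case (Suc k)
  show ?case
    by (rule times_differentiable_on_SucI[OF assms(1)
          bounded_linear.has_derivative[OF assms(2) times_differentiable_on_SucD(1)[OF Suc.prems]]])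
      (auto intro!: Suc.IH times_differentiable_on_SucD(2)[OF Suc.prems])
qed

lemma times_differentiable_on_add:
  assumes "open S" "times_differentiable_on k S f" "times_differentiable_on k S g"
  shows "times_differentiable_on k S (\<lambda>x. f x + g x)"
  using assms(2,3)
proof (induction k arbitrary: f g)
  case 0
  then show ?case by (auto intro: continuous_on_add)
next
  case (Suc k)
  show ?case
    by (rule times_differentiable_on_SucI[OF assms(1)
          has_derivative_add[OF times_differentiable_on_SucD(1)[OF Suc.prems(1)] times_differentiable_on_SucD(1)[OF Suc.prems(2)]]])
      (auto intro!: Suc.IH times_differentiable_on_SucD(2)[OF Suc.prems(1)] times_differentiable_on_SucD(2)[OF Suc.prems(2)])
qed

lemma times_differentiable_on_bilinear:
  assumes "open S" "bounded_bilinear B" "times_differentiable_on k S f" "times_differentiable_on k S g"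
  shows "times_differentiable_on k S (\<lambda>x. B (f x) (g x))"
  using assms(3,4)
proof (induction k arbitrary: f g)
  case 0
  then show ?case using bounded_bilinear.continuous_on[OF assms(2)] by auto
next
  case (Suc k)
  show ?case
    by (rule times_differentiable_on_SucI[OF assms(1)
          bounded_bilinear.FDERIV[OF assms(2) times_differentiable_on_SucD(1)[OF Suc.prems(1)] times_differentiable_on_SucD(1)[OF Suc.prems(2)]]])
      (auto intro!: Suc.IH times_differentiable_on_add[OF assms(1)] times_differentiable_on_pred[OF Suc.prems(1)] times_differentiable_on_pred[OF Suc.prems(2)] 
        times_differentiable_on_SucD(2)[OF Suc.prems(1)] times_differentiable_on_SucD(2)[OF Suc.prems(2)])
qed

lemma times_differentiable_on_inverse:
  fixes f :: "'a::euclidean_space \<Rightarrow> real"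
  assumes "open S" "times_differentiable_on k S f" "\<And>x. x \<in> S \<Longrightarrow> f x \<noteq> 0"
  shows "times_differentiable_on k S (\<lambda>x. inverse (f x))"
  using assms(2)
proof (induction k)
  case 0
  then show ?case using assms(3) by (auto intro!: continuous_on_inverse)
next
  case (Suc k)
  let ?D = "\<lambda>x. frechet_derivative f (at x)"
  have IH: "times_differentiable_on k S (\<lambda>x. inverse (f x))"
    using Suc times_differentiable_on_pred by blast
  show ?case
  proof (rule times_differentiable_on_SucI[OF assms(1)])
    show "((\<lambda>x. inverse (f x)) has_derivative (\<lambda>v. - (?D x v * (inverse (f x) * inverse (f x))))) (at x)"
      if "x \<in> S" for x
      using Deriv.has_derivative_inverse[OF assms(3)[OF that] times_differentiable_on_SucD(1)[OF Suc.prems that]]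
      by (simp add: mult_ac)
    show "times_differentiable_on k S (\<lambda>x. - (?D x v * (inverse (f x) * inverse (f x))))" for v
      by (intro times_differentiable_on_linear[OF assms(1) bounded_linear_minus[OF bounded_linear_ident]]
          times_differentiable_on_bilinear[OF assms(1) bounded_bilinear_mult] IH times_differentiable_on_SucD(2)[OF Suc.prems])
  qed
qed

lemma times_differentiable_on_sqrt:
  fixes f :: "'a::euclidean_space \<Rightarrow> real"
  assumes "open S" "times_differentiable_on k S f" "\<And>x. x \<in> S \<Longrightarrow> f x > 0"
  shows "times_differentiable_on k S (\<lambda>x. sqrt (f x))"
  using assms(2)
proof (induction k)
  case 0
  then show ?case by (auto intro!: continuous_on_real_sqrt)
next
  case (Suc k)
  let ?D = "\<lambda>x. frechet_derivative f (at x)"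
  have IH: "times_differentiable_on k S (\<lambda>x. sqrt (f x))"
    using Suc times_differentiable_on_pred by blast
  show ?case
  proof (rule times_differentiable_on_SucI[OF assms(1)])
    show "((\<lambda>x. sqrt (f x)) has_derivative (\<lambda>v. ?D x v * inverse (2 * sqrt (f x)))) (at x)"
      if "x \<in> S" for x
      using assms(3)[OF that] times_differentiable_on_SucD(1)[OF Suc.prems that]
      by (auto intro!: derivative_eq_intros simp: field_simps)
    show "times_differentiable_on k S (\<lambda>x. ?D x v * inverse (2 * sqrt (f x)))" for v
    proof (intro times_differentiable_on_bilinear[OF assms(1) bounded_bilinear_mult]
         times_differentiable_on_SucD(2)[OF Suc.prems] times_differentiable_on_inverse[OF assms(1)] IH
         times_differentiable_on_const[OF assms(1)])
    qed (use assms(3) in force)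
  qed
qed

context
  fixes S :: "'a::euclidean_space set"
  assumes S: "open S"
begin

lemma smooth_on_cong:
  "(\<And>x. x \<in> S \<Longrightarrow> f x = g x) \<Longrightarrow> smooth_on S f \<longleftrightarrow> smooth_on S g"
  using times_differentiable_on_cong[OF S] unfolding smooth_on_def by metis

lemma smooth_on_linear: "bounded_linear L \<Longrightarrow> smooth_on S f \<Longrightarrow> smooth_on S (\<lambda>x. L (f x))"
  unfolding smooth_on_def using times_differentiable_on_linear[OF S] by blast

lemma smooth_on_const: "smooth_on S (\<lambda>x. c)"
  unfolding smooth_on_def using times_differentiable_on_const[OF S] by blast

lemma smooth_on_component: "smooth_on S f \<Longrightarrow> smooth_on S (\<lambda>x. f x $ i)"
  by (rule smooth_on_linear[OF bounded_linear_vec_nth])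

lemma smooth_on_add: "smooth_on S f \<Longrightarrow> smooth_on S g \<Longrightarrow> smooth_on S (\<lambda>x. f x + g x)"
  unfolding smooth_on_def using times_differentiable_on_add[OF S] by blast

lemma smooth_on_minus: "smooth_on S f \<Longrightarrow> smooth_on S (\<lambda>x. - f x)"
  by (rule smooth_on_linear[OF bounded_linear_minus[OF bounded_linear_ident]])

lemma smooth_on_diff: "smooth_on S f \<Longrightarrow> smooth_on S g \<Longrightarrow> smooth_on S (\<lambda>x. f x - g x)"
  using smooth_on_add[OF _ smooth_on_minus] by fastforce

lemma smooth_on_mult:
  fixes f g :: "'a \<Rightarrow> real"
  shows "smooth_on S f \<Longrightarrow> smooth_on S g \<Longrightarrow> smooth_on S (\<lambda>x. f x * g x)"
  unfolding smooth_on_def using times_differentiable_on_bilinear[OF S bounded_bilinear_mult] by blast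

lemma smooth_on_scaleR: "smooth_on S f \<Longrightarrow> smooth_on S g \<Longrightarrow> smooth_on S (\<lambda>x. f x *\<^sub>R g x)"
  unfolding smooth_on_def using times_differentiable_on_bilinear[OF S bounded_bilinear_scaleR] by blast

lemma smooth_on_divide:
  fixes f g :: "'a \<Rightarrow> real"
  shows "smooth_on S f \<Longrightarrow> smooth_on S g \<Longrightarrow> (\<And>x. x \<in> S \<Longrightarrow> g x \<noteq> 0) \<Longrightarrow> smooth_on S (\<lambda>x. f x / g x)"
  unfolding divide_inverse
  by (rule smooth_on_mult) (auto simp: smooth_on_def intro: times_differentiable_on_inverse[OF S])

lemma smooth_on_sqrt:
  fixes f :: "'a \<Rightarrow> real"
  shows "smooth_on S f \<Longrightarrow> (\<And>x. x \<in> S \<Longrightarrow> f x > 0) \<Longrightarrow> smooth_on S (\<lambda>x. sqrt (f x))"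
  unfolding smooth_on_def using times_differentiable_on_sqrt[OF S] by blast

lemma smooth_on_sum:
  assumes "\<And>i. i \<in> I \<Longrightarrow> smooth_on S (f i)" shows "smooth_on S (\<lambda>x. \<Sum>i\<in>I. f i x)"
  using assms by (induction I rule: infinite_finite_induct) (auto intro: smooth_on_const smooth_on_add)

end

lemma smooth_on_subset: "smooth_on S f \<Longrightarrow> T \<subseteq> S \<Longrightarrow> smooth_on T f"
  unfolding smooth_on_def using times_differentiable_on_subset by blast

lemma smooth_on_continuous: "smooth_on S f \<Longrightarrow> continuous_on S f"
  unfolding smooth_on_def using times_differentiable_on_continuous by blast

lemma smooth_on_has_derivative:
  "smooth_on S f \<Longrightarrow> x \<in> S \<Longrightarrow> (f has_derivative frechet_derivative f (at x)) (at x)"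
  unfolding smooth_on_def using times_differentiable_on_SucD(1) by blast

lemma smooth_on_frechet_derivative:
  "smooth_on S f \<Longrightarrow> smooth_on S (\<lambda>x. frechet_derivative f (at x) v)"
  unfolding smooth_on_def using times_differentiable_on_SucD(2) by blast

lemma linear_sum_axis:
  fixes L :: "real ^ 'n \<Rightarrow> 'b::real_vector"
  assumes "linear L" shows "L v = (\<Sum>i\<in>UNIV. (v $ i) *\<^sub>R L (axis i 1))"
proof -
  have "L v = L (\<Sum>i\<in>UNIV. (v $ i) *\<^sub>R axis i 1)"
    using basis_expansion[of v] by (simp add: scalar_mult_eq_scaleR)
  then show ?thesis by (simp add: linear_sum[OF assms] linear_scale[OF assms] o_def)
qed

text \<open>Contracting a derivative with a smooth vector field stays smooth, since in coordinates the
  contraction is a finite sum of partial derivatives times components.\<close>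

lemma smooth_on_derivative_along:
  fixes g :: "real ^ 'n \<Rightarrow> 'b::euclidean_space"
  assumes "open S" "smooth_on S g" "smooth_on S X"
  shows "smooth_on S (\<lambda>x. frechet_derivative g (at x) (X x))"
proof -
  have "smooth_on S (\<lambda>x. \<Sum>i\<in>UNIV. (X x $ i) *\<^sub>R frechet_derivative g (at x) (axis i 1))"
    by (intro smooth_on_sum smooth_on_scaleR smooth_on_component smooth_on_frechet_derivative assms)
  moreover have "frechet_derivative g (at x) (X x) = (\<Sum>i\<in>UNIV. (X x $ i) *\<^sub>R frechet_derivative g (at x) (axis i 1))" if "x \<in> S" for x
    by (rule linear_sum_axis[OF has_derivative_linear[OF smooth_on_has_derivative[OF assms(2) that]]])
  ultimately show ?thesis using smooth_on_cong[OF assms(1)] by (metis (no_types, lifting))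
qed

section \<open>Symmetry of second derivatives\<close>

lemma has_vector_derivative_along_line:
  assumes "(g has_derivative g') (at (x + s *\<^sub>R u))"
  shows "((\<lambda>s. g (x + s *\<^sub>R u)) has_vector_derivative g' u) (at s)"
proof -
  have "((\<lambda>s. x + s *\<^sub>R u) has_vector_derivative u) (at s)"
    by (auto intro!: derivative_eq_intros)
  from vector_derivative_diff_chain_within[OF this, of g g'] assms
  show ?thesis by (simp add: o_def has_derivative_at_withinI)
qed

text \<open>The second difference over a small parallelogram is a mean value of the mixed second
  derivative: apply the mean value theorem first in direction \<open>u\<close>, then in direction \<open>v\<close>.\<close>

lemma second_difference_mean_value:
  fixes g :: "'a::euclidean_space \<Rightarrow> real"
  assumes g: "times_differentiable_on 2 S g" and h: "h > 0"
    and inS: "\<And>s t. s \<in> {0..h} \<Longrightarrow> t \<in> {0..h} \<Longrightarrow> x + s *\<^sub>R u + t *\<^sub>R v \<in> S"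
  obtains \<xi> \<eta> where "0 < \<xi>" "\<xi> < h" "0 < \<eta>" "\<eta> < h"
    "g (x + h *\<^sub>R u + h *\<^sub>R v) - g (x + h *\<^sub>R u) - g (x + h *\<^sub>R v) + g x
      = h * h * frechet_derivative (\<lambda>y. frechet_derivative g (at y) u) (at (x + \<xi> *\<^sub>R u + \<eta> *\<^sub>R v)) v"
proof -
  let ?Du = "\<lambda>y. frechet_derivative g (at y) u"
  have g1: "(g has_derivative frechet_derivative g (at y)) (at y)" if "y \<in> S" for y
    using times_differentiable_on_SucD(1)[of 1 S g y] g that by (simp add: numeral_2_eq_2)
  have g2: "(?Du has_derivative frechet_derivative ?Du (at y)) (at y)" if "y \<in> S" for y
    using times_differentiable_on_SucD(1)[of 0 S ?Du y] times_differentiable_on_SucD(2)[of 1 S g] g that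
    by (simp add: numeral_2_eq_2)
  define \<psi> where "\<psi> s = g ((x + h *\<^sub>R v) + s *\<^sub>R u) - g (x + s *\<^sub>R u)" for s
  have "DERIV \<psi> s :> ?Du ((x + h *\<^sub>R v) + s *\<^sub>R u) - ?Du (x + s *\<^sub>R u)" if "0 \<le> s" "s \<le> h" for s
    unfolding \<psi>_def has_real_derivative_iff_has_vector_derivative
    by (intro has_vector_derivative_diff has_vector_derivative_along_line g1)
      (use inS[of s h] inS[of s 0] that h in \<open>auto simp: algebra_simps\<close>)
  from MVT2[OF h this] obtain \<xi> where \<xi>: "0 < \<xi>" "\<xi> < h"
    "\<psi> h - \<psi> 0 = h * (?Du (x + h *\<^sub>R v + \<xi> *\<^sub>R u) - ?Du (x + \<xi> *\<^sub>R u))" by auto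
  have "DERIV (\<lambda>t. ?Du ((x + \<xi> *\<^sub>R u) + t *\<^sub>R v)) t :> frechet_derivative ?Du (at (x + \<xi> *\<^sub>R u + t *\<^sub>R v)) v"
    if "0 \<le> t" "t \<le> h" for t
    unfolding has_real_derivative_iff_has_vector_derivative
    by (intro has_vector_derivative_along_line g2) (use inS[of \<xi> t] \<xi> that in auto)
  from MVT2[OF h this] obtain \<eta> where \<eta>: "0 < \<eta>" "\<eta> < h"
    "?Du (x + \<xi> *\<^sub>R u + h *\<^sub>R v) - ?Du (x + \<xi> *\<^sub>R u)
      = h * frechet_derivative ?Du (at (x + \<xi> *\<^sub>R u + \<eta> *\<^sub>R v)) v" by auto
  show ?thesis
    by (rule that[OF \<xi>(1,2) \<eta>(1,2)]) (use \<xi>(3) \<eta>(3) in \<open>simp add: \<psi>_def algebra_simps\<close>)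
qed

text \<open>The two orders of differentiation give mean values over the same parallelogram, with the same
  second difference; shrink the parallelogram and use continuity.\<close>

lemma second_derivative_symmetric_real:
  fixes g :: "'a::euclidean_space \<Rightarrow> real"
  assumes S: "open S" "x \<in> S" and g: "times_differentiable_on 2 S g"
  shows "frechet_derivative (\<lambda>y. frechet_derivative g (at y) u) (at x) v
    = frechet_derivative (\<lambda>y. frechet_derivative g (at y) v) (at x) u"
proof -
  define D2 where "D2 u v y = frechet_derivative (\<lambda>y. frechet_derivative g (at y) u) (at y) v" for u v y
  have cont: "continuous_on S (D2 u v)" for u v
    using g unfolding D2_def by (auto simp: numeral_2_eq_2)
  have "dist (D2 u v x) (D2 v u x) \<le> \<epsilon>" if "\<epsilon> > 0" for \<epsilon>
  proof -
    obtain \<delta> where \<delta>: "\<delta> > 0" "ball x \<delta> \<subseteq> S"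
      "\<And>y. dist y x < \<delta> \<Longrightarrow> dist (D2 u v y) (D2 u v x) < \<epsilon> / 2 \<and> dist (D2 v u y) (D2 v u x) < \<epsilon> / 2"
    proof -
      obtain d0 where d0: "d0 > 0" "ball x d0 \<subseteq> S" using S open_contains_ball by blast
      have c: "isCont (D2 u v) x" for u v using cont S continuous_on_eq_continuous_at by blast
      obtain d1 where d1: "d1 > 0" "\<And>y. dist y x < d1 \<Longrightarrow> dist (D2 u v y) (D2 u v x) < \<epsilon> / 2"
        using c[of u v] \<open>\<epsilon> > 0\<close> unfolding continuous_at_eps_delta by (metis half_gt_zero)
      obtain d2 where d2: "d2 > 0" "\<And>y. dist y x < d2 \<Longrightarrow> dist (D2 v u y) (D2 v u x) < \<epsilon> / 2"
        using c[of v u] \<open>\<epsilon> > 0\<close> unfolding continuous_at_eps_delta by (metis half_gt_zero)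
      show ?thesis by (rule that[of "min d0 (min d1 d2)"]) (use d0 d1 d2 in auto)
    qed
    \<comment> \<open>Small enough for the parallelogram to lie in the ball; the \<open>1\<close> covers \<open>u = v = 0\<close>.\<close>
    define h where "h = \<delta> / (2 * (norm u + norm v + 1))"
    have h: "h > 0" using \<delta>(1) norm_ge_zero[of u] norm_ge_zero[of v] unfolding h_def
      by (intro divide_pos_pos) (auto intro: add_nonneg_pos)
    have "h * (2 * (norm u + norm v + 1)) = \<delta>" using norm_ge_zero[of u] norm_ge_zero[of v]
      unfolding h_def by (simp add: add_nonneg_pos less_imp_neq[symmetric])
    then have hd: "h * (norm u + norm v) < \<delta>" using \<delta>(1) h by (simp add: algebra_simps)
    have near: "dist (x + s *\<^sub>R u + t *\<^sub>R v) x < \<delta>" "dist (x + s *\<^sub>R v + t *\<^sub>R u) x < \<delta>"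
      if "s \<in> {0..h}" "t \<in> {0..h}" for s t
    proof -
      have *: "norm (s *\<^sub>R a + t *\<^sub>R b) \<le> h * (norm a + norm b)" for a b :: 'a
        using norm_triangle_ineq[of "s *\<^sub>R a" "t *\<^sub>R b"] that
          mult_right_mono[of s h "norm a"] mult_right_mono[of t h "norm b"]
        by (simp add: algebra_simps)
      show "dist (x + s *\<^sub>R u + t *\<^sub>R v) x < \<delta>"
        using *[of u v] hd by (simp add: dist_norm add.assoc)
      show "dist (x + s *\<^sub>R v + t *\<^sub>R u) x < \<delta>"
        using *[of v u] hd by (simp add: dist_norm add.assoc add.commute)
    qed
    have nS: "y \<in> S" if "dist y x < \<delta>" for y using \<delta>(2) that by (auto simp: dist_commute)
    obtain \<xi> \<eta> where 1: "0 < \<xi>" "\<xi> < h" "0 < \<eta>" "\<eta> < h"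
      "g (x + h *\<^sub>R u + h *\<^sub>R v) - g (x + h *\<^sub>R u) - g (x + h *\<^sub>R v) + g x
        = h * h * D2 u v (x + \<xi> *\<^sub>R u + \<eta> *\<^sub>R v)"
      using second_difference_mean_value[OF g h nS[OF near(1)]] unfolding D2_def by metis
    obtain \<xi>' \<eta>' where 2: "0 < \<xi>'" "\<xi>' < h" "0 < \<eta>'" "\<eta>' < h"
      "g (x + h *\<^sub>R v + h *\<^sub>R u) - g (x + h *\<^sub>R v) - g (x + h *\<^sub>R u) + g x
        = h * h * D2 v u (x + \<xi>' *\<^sub>R v + \<eta>' *\<^sub>R u)"
      using second_difference_mean_value[OF g h nS[OF near(2)]] unfolding D2_def by metis
    have swap: "x + h *\<^sub>R v + h *\<^sub>R u = x + h *\<^sub>R u + h *\<^sub>R v" by (simp add: add_ac)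
    have "h * h * D2 u v (x + \<xi> *\<^sub>R u + \<eta> *\<^sub>R v) = h * h * D2 v u (x + \<xi>' *\<^sub>R v + \<eta>' *\<^sub>R u)"
      using 1(5) 2(5) unfolding swap by linarith
    hence "D2 u v (x + \<xi> *\<^sub>R u + \<eta> *\<^sub>R v) = D2 v u (x + \<xi>' *\<^sub>R v + \<eta>' *\<^sub>R u)" using h by simp
    moreover have "dist (D2 u v (x + \<xi> *\<^sub>R u + \<eta> *\<^sub>R v)) (D2 u v x) < \<epsilon> / 2"
      using \<delta>(3)[OF near(1)[of \<xi> \<eta>]] 1 by auto
    moreover have "dist (D2 v u (x + \<xi>' *\<^sub>R v + \<eta>' *\<^sub>R u)) (D2 v u x) < \<epsilon> / 2"
      using \<delta>(3)[OF near(2)[of \<xi>' \<eta>']] 2 by auto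
    ultimately show ?thesis unfolding dist_real_def by linarith
  qed
  then have "dist (D2 u v x) (D2 v u x) \<le> 0" by (rule field_le_epsilon) simp
  then show ?thesis unfolding D2_def by simp
qed

lemma second_derivative_symmetric:
  fixes g :: "'a::euclidean_space \<Rightarrow> 'b::euclidean_space"
  assumes S: "open S" "x \<in> S" and g: "times_differentiable_on 2 S g"
  shows "frechet_derivative (\<lambda>y. frechet_derivative g (at y) u) (at x) v
    = frechet_derivative (\<lambda>y. frechet_derivative g (at y) v) (at x) u"
proof (rule euclidean_eqI)
  fix b :: 'b
  let ?g = "\<lambda>y. g y \<bullet> b"
  have 1: "frechet_derivative ?g (at y) w = frechet_derivative g (at y) w \<bullet> b" if "y \<in> S" for y w
    using frechet_derivative_eqI[OF has_derivative_inner_left[OF times_differentiable_on_SucD(1)[of 1 S g y]]]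
      g that by (simp add: numeral_2_eq_2)
  have 2: "frechet_derivative (\<lambda>y. frechet_derivative ?g (at y) u) (at x) v
    = frechet_derivative (\<lambda>y. frechet_derivative g (at y) u) (at x) v \<bullet> b" for u v
  proof -
    have "frechet_derivative (\<lambda>y. frechet_derivative ?g (at y) u) (at x) v
      = frechet_derivative (\<lambda>y. frechet_derivative g (at y) u \<bullet> b) (at x) v"
      by (rule fun_cong[OF frechet_derivative_cong_open[OF S 1]])
    also have "\<dots> = frechet_derivative (\<lambda>y. frechet_derivative g (at y) u) (at x) v \<bullet> b"
      using frechet_derivative_eqI[OF has_derivative_inner_left[OF times_differentiable_on_SucD(1)[of 0 S "\<lambda>y. frechet_derivative g (at y) u" x]], of b]
        times_differentiable_on_SucD(2)[of 1 S g] g S(2) by (simp add: numeral_2_eq_2)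
    finally show ?thesis .
  qed
  have "times_differentiable_on 2 S ?g"
    by (rule times_differentiable_on_linear[OF S(1) bounded_linear_inner_left g])
  from second_derivative_symmetric_real[OF S this]
  show "frechet_derivative (\<lambda>y. frechet_derivative g (at y) u) (at x) v \<bullet> b
    = frechet_derivative (\<lambda>y. frechet_derivative g (at y) v) (at x) u \<bullet> b"
    unfolding 2 .
qed

section \<open>Derivative of the determinant\<close>

text \<open>In the Leibniz expansion, differentiating one factor of the product belonging to a
  permutation \<open>p\<close> leaves a vanishing off-diagonal entry unless \<open>p\<close> fixes all other indices, hence
  is the identity.\<close>

lemma has_derivative_det_at_identity:
  fixes M :: "'a::real_normed_vector \<Rightarrow> real ^ 'n ^ 'n"
  assumes M: "\<And>i j. ((\<lambda>y. M y $ i $ j) has_derivative N i j) (at x)" and 1: "M x = mat 1"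
  shows "((\<lambda>y. det (M y)) has_derivative (\<lambda>v. \<Sum>i\<in>UNIV. N i i v)) (at x)"
proof -
  let ?P = "{p. p permutes (UNIV :: 'n set)}"
  define T where "T p v = of_int (sign p) * (\<Sum>i\<in>UNIV. N i (p i) v * (\<Prod>j\<in>UNIV - {i}. M x $ j $ p j))"
    for p v
  have fin: "finite ?P" by (simp add: finite_permutations)
  have "((\<lambda>y. \<Sum>p\<in>?P. of_int (sign p) * (\<Prod>i\<in>UNIV. M y $ i $ p i)) has_derivative (\<lambda>v. \<Sum>p\<in>?P. T p v)) (at x)"
    unfolding T_def by (intro has_derivative_sum has_derivative_mult_right has_derivative_prod M)
  moreover have "(\<Sum>p\<in>?P. T p v) = (\<Sum>i\<in>UNIV. N i i v)" for v
  proof -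
    have "T p v = 0" if p: "p permutes UNIV" "p \<noteq> id" for p
    proof -
      have "(\<Prod>j\<in>UNIV - {i}. M x $ j $ p j) = 0" for i
      proof (rule ccontr)
        assume "(\<Prod>j\<in>UNIV - {i}. M x $ j $ p j) \<noteq> 0"
        then have fix_j: "p j = j" if "j \<noteq> i" for j
          using that by (auto simp: 1 mat_def split: if_splits)
        then have "p i = i" using permutes_inj[OF p(1)] by (metis injD)
        then have "p = id" using fix_j by (metis eq_id_iff)
        then show False using p(2) by simp
      qed
      then show ?thesis unfolding T_def by (simp only: mult_zero_right sum.neutral_const)
    qed
    then have "(\<Sum>p\<in>?P. T p v) = (\<Sum>p\<in>{id}. T p v)"
      using fin by (intro sum.mono_neutral_right) (auto simp: permutes_id)
    also have "\<dots> = (\<Sum>i\<in>UNIV. N i i v)" by (simp add: T_def 1 mat_def)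
    finally show ?thesis .
  qed
  ultimately show ?thesis unfolding det_def by simp
qed

text \<open>Jacobi's formula. Multiplying by the constant matrix \<open>B\<close>, inverse to \<open>M x\<close>, moves the base point to
  the identity, near which the determinant is positive, so that the absolute value disappears.\<close>

lemma has_derivative_abs_det:
  fixes M :: "'a::real_normed_vector \<Rightarrow> real ^ 'n ^ 'n"
  assumes M: "\<And>i j. ((\<lambda>y. M y $ i $ j) has_derivative N i j) (at x)" and B: "B ** M x = mat 1"
  shows "((\<lambda>y. \<bar>det (M y)\<bar>) has_derivative
    (\<lambda>v. \<bar>det (M x)\<bar> * (\<Sum>i\<in>UNIV. \<Sum>k\<in>UNIV. B $ i $ k * N k i v))) (at x)"
proof -
  have "((\<lambda>y. (B ** M y) $ i $ j) has_derivative (\<lambda>v. \<Sum>k\<in>UNIV. B $ i $ k * N k j v)) (at x)" for i j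
    unfolding matrix_matrix_mult_def by (auto intro!: has_derivative_sum has_derivative_mult_right M)
  from has_derivative_det_at_identity[OF this B]
  have d: "((\<lambda>y. det (B ** M y)) has_derivative (\<lambda>v. \<Sum>i\<in>UNIV. \<Sum>k\<in>UNIV. B $ i $ k * N k i v)) (at x)" .
  have 1: "det (B ** M x) = 1" by (simp add: B)
  have det: "det (M x) * det B = 1" using 1 by (simp add: det_mul mult.commute)
  have "((\<lambda>y. det (B ** M y)) \<longlongrightarrow> 1) (at x)"
    using has_derivative_continuous[OF d] 1 by (simp add: continuous_within)
  then have "eventually (\<lambda>y. det (B ** M y) > 0) (at x)"
    by (rule order_tendstoD) simp
  then have "eventually (\<lambda>y. det (B ** M y) = \<bar>det (B ** M y)\<bar>) (at x)"
    by eventually_elim simp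
  from has_derivative_transform_eventually[OF d this]
  have "((\<lambda>y. \<bar>det (B ** M y)\<bar>) has_derivative (\<lambda>v. \<Sum>i\<in>UNIV. \<Sum>k\<in>UNIV. B $ i $ k * N k i v)) (at x)"
    by (simp add: 1)
  from has_derivative_mult_right[OF this, of "\<bar>det (M x)\<bar>"]
  have "((\<lambda>y. \<bar>det (M x)\<bar> * \<bar>det (B ** M y)\<bar>) has_derivative
     (\<lambda>v. \<bar>det (M x)\<bar> * (\<Sum>i\<in>UNIV. \<Sum>k\<in>UNIV. B $ i $ k * N k i v))) (at x)"
    by (simp add: 1)
  moreover have "\<bar>det (M x)\<bar> * \<bar>det (B ** M y)\<bar> = \<bar>det (M y)\<bar>" for y
    using det by (simp add: det_mul flip: abs_mult mult.assoc)
  ultimately show ?thesis by simp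
qed

section \<open>Divergence under a change of coordinates\<close>

text \<open>What a single chart computes in the definition of the divergence, detached from the manifold.\<close>

definition coord_divergence :: "(real ^ 'n \<Rightarrow> real) \<Rightarrow> (real ^ 'n \<Rightarrow> real ^ 'n) \<Rightarrow> real ^ 'n \<Rightarrow> real" where
  "coord_divergence \<mu> X x = (\<Sum>i\<in>UNIV. frechet_derivative (\<lambda>y. \<mu> y * X y $ i) (at x) (axis i 1)) / \<mu> x"

lemma coord_divergence_eq:
  assumes \<mu>: "(\<mu> has_derivative \<mu>') (at x)" and X: "(X has_derivative X') (at x)" and "\<mu> x \<noteq> 0"
  shows "coord_divergence \<mu> X x = \<mu>' (X x) / \<mu> x + (\<Sum>i\<in>UNIV. X' (axis i 1) $ i)"
proof -
  have Xi: "((\<lambda>y. X y $ i) has_derivative (\<lambda>v. X' v $ i)) (at x)" for i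
    by (rule bounded_linear.has_derivative[OF bounded_linear_vec_nth X])
  have "frechet_derivative (\<lambda>y. \<mu> y * X y $ i) (at x) = (\<lambda>v. \<mu> x * X' v $ i + \<mu>' v * X x $ i)" for i
    by (rule frechet_derivative_eqI[OF has_derivative_mult[OF \<mu> Xi]])
  moreover have "\<mu>' (X x) = (\<Sum>i\<in>UNIV. (X x $ i) *\<^sub>R \<mu>' (axis i 1))"
    by (rule linear_sum_axis[OF has_derivative_linear[OF \<mu>]])
  ultimately show ?thesis using assms(3)
    by (simp add: coord_divergence_def sum.distrib add_divide_distrib mult.commute sum_distrib_right[symmetric] sum_distrib_left[symmetric])
qed

text \<open>Differentiating the relation between the densities contributes the logarithmic derivative
  \<open>tr (J\<inverse> DJ(X))\<close> of the Jacobian determinant; differentiating the relation between the fields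
  contributes \<open>tr (J\<inverse> DJ(\<cdot>) X)\<close>. Symmetry of the second derivative of the coordinate change
  makes them equal.\<close>

lemma coord_divergence_change_of_variables:
  fixes T :: "real ^ 'n \<Rightarrow> real ^ 'n"
  assumes S: "open S" "x \<in> S" and T: "times_differentiable_on 2 S T"
    and B: "\<And>v. B (frechet_derivative T (at x) v) = v" "linear B"
    and X: "(X has_derivative X') (at x)" and Y: "(Y has_derivative Y') (at (T x))"
    and XY: "\<And>y. y \<in> S \<Longrightarrow> Y (T y) = frechet_derivative T (at y) (X y)"
    and \<mu>: "(\<mu> has_derivative \<mu>') (at x)" and \<rho>: "(\<rho> has_derivative \<rho>') (at (T x))"
    and \<mu>\<rho>: "\<And>y. y \<in> S \<Longrightarrow> \<mu> y = \<bar>det (matrix (frechet_derivative T (at y)))\<bar> * \<rho> (T y)"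
    and nz: "\<mu> x \<noteq> 0"
  shows "coord_divergence \<mu> X x = coord_divergence \<rho> Y (T x)"
proof -
  let ?J = "\<lambda>y. frechet_derivative T (at y)"
  define H where "H w v = frechet_derivative (\<lambda>y. ?J y w) (at x) v" for w v
  have dT: "(T has_derivative ?J y) (at y)" if "y \<in> S" for y
    using times_differentiable_on_SucD(1)[of 1 S T y] T that by (simp add: numeral_2_eq_2)
  have dJ: "((\<lambda>y. ?J y w) has_derivative H w) (at x)" for w
    using times_differentiable_on_SucD(1)[of 0 S "\<lambda>y. ?J y w" x] times_differentiable_on_SucD(2)[of 1 S T] T S
    unfolding H_def[abs_def] by (simp add: numeral_2_eq_2)
  have linH: "linear (H w)" for w by (rule has_derivative_linear[OF dJ])
  have symH: "H w v = H v w" for v w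
    unfolding H_def by (rule second_derivative_symmetric[OF S T])
  have linJ: "linear (?J y)" if "y \<in> S" for y by (rule has_derivative_linear[OF dT[OF that]])
  have \<rho>nz: "\<rho> (T x) \<noteq> 0" and detnz: "\<bar>det (matrix (?J x))\<bar> \<noteq> 0" using \<mu>\<rho>[OF S(2)] nz by auto
  have Bi: "B v $ i = (\<Sum>k\<in>UNIV. matrix B $ i $ k * v $ k)" for v i
    by (subst linear_sum_axis[OF B(2)]) (simp add: matrix_def mult.commute)
  have BM: "matrix B ** matrix (?J x) = mat 1"
    using matrix_compose[OF linJ[OF S(2)] B(2)] B(1) by (simp add: o_def matrix_id_mat_1[unfolded id_def])
  have BM': "matrix (?J x) ** matrix B = mat 1" using BM matrix_left_right_inverse by blast

  have "((\<lambda>y. matrix (?J y) $ i $ j) has_derivative (\<lambda>v. H (axis j 1) v $ i)) (at x)" for i j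
    unfolding matrix_def by (simp, rule bounded_linear.has_derivative[OF bounded_linear_vec_nth dJ])
  note has_derivative_abs_det[OF this BM]
  moreover have "((\<lambda>y. \<rho> (T y)) has_derivative (\<lambda>v. \<rho>' (?J x v))) (at x)"
    by (rule has_derivative_compose[OF dT[OF S(2)]]) (rule \<rho>)
  ultimately have "((\<lambda>y. \<bar>det (matrix (?J y))\<bar> * \<rho> (T y)) has_derivative
      (\<lambda>v. \<bar>det (matrix (?J x))\<bar> * \<rho>' (?J x v) +
        \<bar>det (matrix (?J x))\<bar> * (\<Sum>i\<in>UNIV. \<Sum>k\<in>UNIV. matrix B $ i $ k * H (axis i 1) v $ k) * \<rho> (T x))) (at x)"
    by (rule has_derivative_mult)
  then have "\<mu>' = (\<lambda>v. \<bar>det (matrix (?J x))\<bar> * \<rho>' (?J x v) +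
        \<bar>det (matrix (?J x))\<bar> * (\<Sum>i\<in>UNIV. \<Sum>k\<in>UNIV. matrix B $ i $ k * H (axis i 1) v $ k) * \<rho> (T x))"
    using has_derivative_unique[OF \<mu>] has_derivative_cong_open[OF S \<mu>\<rho>] by (simp only:)
  then have \<mu>X: "\<mu>' (X x) / \<mu> x = \<rho>' (Y (T x)) / \<rho> (T x) + (\<Sum>i\<in>UNIV. B (H (axis i 1) (X x)) $ i)"
    using nz \<rho>nz detnz XY[OF S(2)] \<mu>\<rho>[OF S(2)] by (simp add: field_simps Bi)

  have Y'J: "Y' (?J x v) = H (X x) v + ?J x (X' v)" for v
  proof -
    have "((\<lambda>y. \<Sum>j\<in>UNIV. (X y $ j) *\<^sub>R ?J y (axis j 1)) has_derivative
       (\<lambda>v. \<Sum>j\<in>UNIV. (X x $ j) *\<^sub>R H (axis j 1) v + (X' v $ j) *\<^sub>R ?J x (axis j 1))) (at x)"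
      by (intro has_derivative_sum has_derivative_scaleR dJ
          bounded_linear.has_derivative[OF bounded_linear_vec_nth X])
    moreover have "(\<Sum>j\<in>UNIV. (X y $ j) *\<^sub>R ?J y (axis j 1)) = Y (T y)" if "y \<in> S" for y
      using XY[OF that] linear_sum_axis[OF linJ[OF that]] by metis
    ultimately have "((\<lambda>y. Y (T y)) has_derivative
       (\<lambda>v. \<Sum>j\<in>UNIV. (X x $ j) *\<^sub>R H (axis j 1) v + (X' v $ j) *\<^sub>R ?J x (axis j 1))) (at x)"
      using has_derivative_transform_within_open[OF _ S, where g = "\<lambda>y. Y (T y)"] by (simp only:)
    moreover have "((\<lambda>y. Y (T y)) has_derivative (\<lambda>v. Y' (?J x v))) (at x)"
      by (rule has_derivative_compose[OF dT[OF S(2)]]) (rule Y)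
    ultimately have "(\<lambda>v. Y' (?J x v)) = (\<lambda>v. \<Sum>j\<in>UNIV. (X x $ j) *\<^sub>R H (axis j 1) v + (X' v $ j) *\<^sub>R ?J x (axis j 1))"
      by (rule has_derivative_unique[rotated])
    then have "Y' (?J x v) = (\<Sum>j\<in>UNIV. (X x $ j) *\<^sub>R H (axis j 1) v + (X' v $ j) *\<^sub>R ?J x (axis j 1))"
      by (rule fun_cong)
    also have "\<dots> = (\<Sum>j\<in>UNIV. (X x $ j) *\<^sub>R H (axis j 1) v) + (\<Sum>j\<in>UNIV. (X' v $ j) *\<^sub>R ?J x (axis j 1))"
      by (rule sum.distrib)
    also have "\<dots> = (\<Sum>j\<in>UNIV. (X x $ j) *\<^sub>R H v (axis j 1)) + (\<Sum>j\<in>UNIV. (X' v $ j) *\<^sub>R ?J x (axis j 1))"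
      by (simp only: symH[of _ v])
    also have "\<dots> = H v (X x) + ?J x (X' v)"
      by (simp only: linear_sum_axis[OF linH, symmetric] linear_sum_axis[OF linJ[OF S(2)], symmetric])
    finally show ?thesis by (simp only: symH[of v])
  qed
  have linY': "linear Y'" by (rule has_derivative_linear[OF Y])
  have tr: "(\<Sum>i\<in>UNIV. L (axis i 1) $ i) = trace (matrix L)" for L :: "real ^ 'n \<Rightarrow> real ^ 'n"
    by (simp add: trace_def matrix_def)
  have "trace (matrix Y') = trace (matrix Y' ** (matrix (?J x) ** matrix B))" by (simp add: BM')
  also have "\<dots> = trace (matrix B ** (matrix Y' ** matrix (?J x)))"
    by (metis trace_mul_sym matrix_mul_assoc)
  also have "\<dots> = trace (matrix (\<lambda>v. B (Y' (?J x v))))"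
    using matrix_compose[OF linJ[OF S(2)] linY'] matrix_compose[OF linear_compose[OF linJ[OF S(2)] linY'] B(2)]
    by (simp add: o_def)
  also have "\<dots> = (\<Sum>i\<in>UNIV. B (Y' (?J x (axis i 1))) $ i)" by (rule tr[symmetric])
  also have "\<dots> = (\<Sum>i\<in>UNIV. B (H (X x) (axis i 1)) $ i) + (\<Sum>i\<in>UNIV. X' (axis i 1) $ i)"
    by (simp add: Y'J linear_add[OF B(2)] B(1) sum.distrib)
  finally have "(\<Sum>i\<in>UNIV. Y' (axis i 1) $ i)
    = (\<Sum>i\<in>UNIV. B (H (axis i 1) (X x)) $ i) + (\<Sum>i\<in>UNIV. X' (axis i 1) $ i)"
    by (simp only: tr symH[of "X x"])
  then show ?thesis
    unfolding coord_divergence_eq[OF \<mu> X nz] coord_divergence_eq[OF \<rho> Y \<rho>nz] \<mu>X by simp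
qed

section \<open>Coordinates on a smooth manifold\<close>

locale manifold_atlas =
  fixes \<A> :: "('m::{t2_space,second_countable_topology}, 'n::finite) chart set"
  assumes smooth_manifold: "smooth_manifold \<A>"
begin

lemma charts_atD: "c \<in> charts_at \<A> p \<Longrightarrow> c \<in> \<A> \<and> p \<in> cdom c"
  by (simp add: charts_at_def)

lemma chart_homeomorphism:
  "c \<in> \<A> \<Longrightarrow> open (cdom c) \<and> open (cmap c ` cdom c) \<and>
     homeomorphism (cdom c) (cmap c ` cdom c) (cmap c) (cinv c)"
  using smooth_manifold by (auto simp: smooth_manifold_def is_chart_def)

lemma cinv_cmap: "c \<in> \<A> \<Longrightarrow> p \<in> cdom c \<Longrightarrow> cinv c (cmap c p) = p"
  using chart_homeomorphism homeomorphism_apply1 by metis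

lemma cinv_cmap_pair: "(D, \<phi>) \<in> \<A> \<Longrightarrow> p \<in> D \<Longrightarrow> cinv (D, \<phi>) (\<phi> p) = p"
  using cinv_cmap[of "(D, \<phi>)" p] by simp

lemma cmap_cinv: "c \<in> \<A> \<Longrightarrow> x \<in> cmap c ` cdom c \<Longrightarrow> cmap c (cinv c x) = x"
  using chart_homeomorphism homeomorphism_apply2 by metis

lemma cinv_in_cdom: "c \<in> \<A> \<Longrightarrow> x \<in> cmap c ` cdom c \<Longrightarrow> cinv c x \<in> cdom c"
  using chart_homeomorphism homeomorphism_image2 by blast

lemma chart_image_iff:
  assumes c: "c \<in> \<A>"
  shows "x \<in> cmap c ` (cdom c \<inter> V) \<longleftrightarrow> x \<in> cmap c ` cdom c \<and> cinv c x \<in> V"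
proof
  assume "x \<in> cmap c ` (cdom c \<inter> V)"
  then obtain p where "p \<in> cdom c" "p \<in> V" "x = cmap c p" by blast
  then show "x \<in> cmap c ` cdom c \<and> cinv c x \<in> V" using cinv_cmap[OF c] by simp
next
  assume x: "x \<in> cmap c ` cdom c \<and> cinv c x \<in> V"
  then have "cinv c x \<in> cdom c \<inter> V" "x = cmap c (cinv c x)"
    using cinv_in_cdom[OF c] cmap_cinv[OF c] by auto
  then show "x \<in> cmap c ` (cdom c \<inter> V)" by blast
qed

lemma open_chart_image:
  assumes "c \<in> \<A>" "open V" shows "open (cmap c ` (cdom c \<inter> V))"
proof -
  have "continuous_on (cmap c ` cdom c) (cinv c)"
    using chart_homeomorphism[OF assms(1)] homeomorphism_def by blast
  then have "open (cinv c -` V \<inter> cmap c ` cdom c)"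
    using continuous_on_open_vimage chart_homeomorphism[OF assms(1)] assms(2) by blast
  moreover have "cmap c ` (cdom c \<inter> V) = cinv c -` V \<inter> cmap c ` cdom c"
    using chart_image_iff[OF assms(1)] by auto
  ultimately show ?thesis by simp
qed

lemma open_chart_preimage:
  assumes "c \<in> \<A>" "open S" shows "open (cdom c \<inter> cmap c -` S)"
proof -
  have "continuous_on (cdom c) (cmap c)"
    using chart_homeomorphism[OF assms(1)] homeomorphism_def by blast
  then show ?thesis
    using continuous_on_open_vimage chart_homeomorphism[OF assms(1)] assms(2) by (metis Int_commute)
qed

lemma chart_at_in: "chart_at \<A> p \<in> charts_at \<A> p"
proof -
  have "\<exists>c. c \<in> charts_at \<A> p" using smooth_manifold unfolding smooth_manifold_def charts_at_def by blast
  then show ?thesis unfolding chart_at_def by (rule someI_ex)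
qed

lemma smooth_transition:
  "c \<in> \<A> \<Longrightarrow> d \<in> \<A> \<Longrightarrow> smooth_on (cmap c ` (cdom c \<inter> cdom d)) (cmap d \<circ> cinv c)"
  using smooth_manifold by (auto simp: smooth_manifold_def)

lemma open_overlap: "c \<in> \<A> \<Longrightarrow> d \<in> \<A> \<Longrightarrow> open (cmap c ` (cdom c \<inter> cdom d))"
  using open_chart_image chart_homeomorphism by blast

lemma has_derivative_transition:
  assumes "c \<in> charts_at \<A> p" "d \<in> charts_at \<A> p"
  shows "(cmap d \<circ> cinv c has_derivative transition_deriv c d p) (at (cmap c p))"
  unfolding transition_deriv_def
  by (rule smooth_on_has_derivative[OF smooth_transition]) (use assms in \<open>auto simp: charts_at_def\<close>)

lemma has_derivative_change_chart:
  assumes c: "c \<in> charts_at \<A> p" and d: "d \<in> charts_at \<A> p"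
    and g: "(g \<circ> cinv c has_derivative g') (at (cmap c p))"
  shows "(g \<circ> cinv d has_derivative (\<lambda>v. g' (transition_deriv d c p v))) (at (cmap d p))"
proof -
  have p: "cinv d (cmap d p) = p" using d charts_atD cinv_cmap by metis
  have "((\<lambda>x. (g \<circ> cinv c) ((cmap c \<circ> cinv d) x)) has_derivative (\<lambda>v. g' (transition_deriv d c p v))) (at (cmap d p))"
    by (rule has_derivative_compose[OF has_derivative_transition[OF d c]]) (use g p in \<open>simp add: o_def\<close>)
  then show ?thesis
  proof (rule has_derivative_transform_within_open)
    show "open (cmap d ` (cdom d \<inter> cdom c))" "cmap d p \<in> cmap d ` (cdom d \<inter> cdom c)"
      using open_overlap c d charts_atD by blast+
    show "(g \<circ> cinv c) ((cmap c \<circ> cinv d) x) = (g \<circ> cinv d) x" if "x \<in> cmap d ` (cdom d \<inter> cdom c)" for x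
      using that c d by (auto simp: charts_at_def cinv_cmap cinv_cmap_pair)
  qed
qed

text \<open>The chain rule on a triple overlap; it makes tangent vectors, being compatible families of
  coordinate vectors, correspond bijectively to their coordinates in one chart.\<close>

lemma transition_cocycle:
  assumes "c \<in> charts_at \<A> p" "d \<in> charts_at \<A> p" "e \<in> charts_at \<A> p"
  shows "transition_deriv d e p (transition_deriv c d p v) = transition_deriv c e p v"
proof -
  have "(cmap e \<circ> cinv c has_derivative (\<lambda>v. transition_deriv d e p (transition_deriv c d p v))) (at (cmap c p))"
    by (rule has_derivative_change_chart[OF assms(2,1) has_derivative_transition[OF assms(2,3)]])
  from has_derivative_unique[OF this has_derivative_transition[OF assms(1,3)]]
  show ?thesis by (simp add: fun_eq_iff)
qed

lemma transition_refl:
  assumes "c \<in> charts_at \<A> p" shows "transition_deriv c c p v = v"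
proof -
  have c: "c \<in> \<A>" "p \<in> cdom c" using assms charts_atD by auto
  have "((\<lambda>x. x) has_derivative transition_deriv c c p) (at (cmap c p))"
    by (rule has_derivative_transform_within_open[OF has_derivative_transition[OF assms assms],
        of "cmap c ` cdom c"]) (use c chart_homeomorphism cmap_cinv in auto)
  from has_derivative_unique[OF this has_derivative_ident] show ?thesis by simp
qed

lemma linear_transition:
  "c \<in> charts_at \<A> p \<Longrightarrow> d \<in> charts_at \<A> p \<Longrightarrow> linear (transition_deriv c d p)"
  by (rule has_derivative_linear[OF has_derivative_transition])

lemma tangent_transition:
  "v \<in> tangent_space \<A> p \<Longrightarrow> c \<in> charts_at \<A> p \<Longrightarrow> d \<in> charts_at \<A> p \<Longrightarrow>
    v d = transition_deriv c d p (v c)"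
  unfolding tangent_space_def by blast

lemma tangent_outside: "v \<in> tangent_space \<A> p \<Longrightarrow> c \<notin> charts_at \<A> p \<Longrightarrow> v c = 0"
  unfolding tangent_space_def by blast

lemma tangent_eqI:
  assumes "u \<in> tangent_space \<A> p" "v \<in> tangent_space \<A> p" "c \<in> charts_at \<A> p" "u c = v c"
  shows "u = v"
proof
  fix d show "u d = v d"
  proof (cases "d \<in> charts_at \<A> p")
    case True
    show ?thesis
      unfolding tangent_transition[OF assms(1,3) True] tangent_transition[OF assms(2,3) True] assms(4) ..
  next
    case False
    show ?thesis unfolding tangent_outside[OF assms(1) False] tangent_outside[OF assms(2) False] ..
  qed
qed

lemma tvec_of_tangent: "c \<in> charts_at \<A> p \<Longrightarrow> tvec_of \<A> c p y \<in> tangent_space \<A> p"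
  unfolding tangent_space_def tvec_of_def by (auto simp: transition_cocycle)

lemma tvec_of_same: "c \<in> charts_at \<A> p \<Longrightarrow> tvec_of \<A> c p y c = y"
  unfolding tvec_of_def by (simp add: transition_refl)

lemma tvec_of_component: "c \<in> charts_at \<A> p \<Longrightarrow> v \<in> tangent_space \<A> p \<Longrightarrow> tvec_of \<A> c p (v c) = v"
  using tangent_eqI[OF tvec_of_tangent] tvec_of_same by metis

lemma tzero_tangent: "tzero \<in> tangent_space \<A> p"
  unfolding tangent_space_def tzero_def using linear_0[OF linear_transition] by auto

lemma tadd_tangent:
  assumes u: "u \<in> tangent_space \<A> p" and v: "v \<in> tangent_space \<A> p"
  shows "tadd u v \<in> tangent_space \<A> p"
  unfolding tangent_space_def mem_Collect_eq
proof (intro conjI ballI allI impI)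
  fix c d assume cd: "c \<in> charts_at \<A> p" "d \<in> charts_at \<A> p"
  show "tadd u v d = transition_deriv c d p (tadd u v c)"
    unfolding tadd_def linear_add[OF linear_transition[OF cd]]
      tangent_transition[OF u cd] tangent_transition[OF v cd] ..
qed (simp add: tadd_def tangent_outside[OF u] tangent_outside[OF v])

lemma tscale_tangent:
  assumes v: "v \<in> tangent_space \<A> p" shows "tscale r v \<in> tangent_space \<A> p"
  unfolding tangent_space_def mem_Collect_eq
proof (intro conjI ballI allI impI)
  fix c d assume cd: "c \<in> charts_at \<A> p" "d \<in> charts_at \<A> p"
  show "tscale r v d = transition_deriv c d p (tscale r v c)"
    unfolding tscale_def linear_scale[OF linear_transition[OF cd]] tangent_transition[OF v cd] ..
qed (simp add: tscale_def tangent_outside[OF v])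

lemma tvec_of_add: "c \<in> charts_at \<A> p \<Longrightarrow> tadd (tvec_of \<A> c p x) (tvec_of \<A> c p y) = tvec_of \<A> c p (x + y)"
  by (rule tangent_eqI[OF tadd_tangent[OF tvec_of_tangent tvec_of_tangent] tvec_of_tangent, where c = c])
    (simp_all add: tvec_of_same tadd_def)

lemma tvec_of_scale: "c \<in> charts_at \<A> p \<Longrightarrow> tscale r (tvec_of \<A> c p x) = tvec_of \<A> c p (r *\<^sub>R x)"
  by (rule tangent_eqI[OF tscale_tangent[OF tvec_of_tangent] tvec_of_tangent, where c = c])
    (simp_all add: tvec_of_same tscale_def)

lemma tangent_eq_tzero_iff:
  "v \<in> tangent_space \<A> p \<Longrightarrow> c \<in> charts_at \<A> p \<Longrightarrow> v = tzero \<longleftrightarrow> v c = 0"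
  using tangent_eqI[OF _ tzero_tangent, of v p c] by (auto simp: tzero_def)

section \<open>Functions and their differentials\<close>

lemma smooth_funD: "smooth_fun \<A> V f \<Longrightarrow> c \<in> \<A> \<Longrightarrow> smooth_on (cmap c ` (cdom c \<inter> V)) (f \<circ> cinv c)"
  unfolding smooth_fun_def by blast

lemma smooth_fun_subset: "smooth_fun \<A> V f \<Longrightarrow> V' \<subseteq> V \<Longrightarrow> smooth_fun \<A> V' f"
  unfolding smooth_fun_def by (meson Int_mono image_mono order_refl smooth_on_subset)

lemma smooth_fun_has_derivative:
  assumes "smooth_fun \<A> V f" "c \<in> charts_at \<A> p" "p \<in> V"
  shows "(f \<circ> cinv c has_derivative frechet_derivative (f \<circ> cinv c) (at (cmap c p))) (at (cmap c p))"
  by (rule smooth_on_has_derivative[OF smooth_funD[OF assms(1)]]) (use assms in \<open>auto simp: charts_at_def\<close>)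

text \<open>The definition of the differential chooses a chart at each point; by the chain rule every chart
  gives the same value.\<close>

lemma differential_chart:
  assumes f: "(f \<circ> cinv c has_derivative f') (at (cmap c p))"
    and c: "c \<in> charts_at \<A> p" and u: "u \<in> tangent_space \<A> p"
  shows "differential \<A> f p u = f' (u c)"
  using frechet_derivative_eqI[OF has_derivative_change_chart[OF c chart_at_in f]]
    tangent_transition[OF u chart_at_in c] unfolding differential_def Let_def by simp

lemma smooth_differential_chart:
  assumes "smooth_fun \<A> V f" "p \<in> V" "c \<in> charts_at \<A> p" "u \<in> tangent_space \<A> p"
  shows "differential \<A> f p u = frechet_derivative (f \<circ> cinv c) (at (cmap c p)) (u c)"
  using differential_chart[OF smooth_fun_has_derivative[OF assms(1,3,2)]] assms by blast

lemma regular_set_chart_iff: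
  assumes f: "smooth_fun \<A> U f" and c: "c \<in> charts_at \<A> p"
  shows "p \<in> regular_set \<A> U f \<longleftrightarrow>
    p \<in> U \<and> (\<exists>i. frechet_derivative (f \<circ> cinv c) (at (cmap c p)) (axis i 1) \<noteq> 0)"
proof (cases "p \<in> U")
  case True
  let ?D = "frechet_derivative (f \<circ> cinv c) (at (cmap c p))"
  have lin: "linear ?D" by (rule has_derivative_linear[OF smooth_fun_has_derivative[OF f c True]])
  have "(\<exists>u\<in>tangent_space \<A> p. differential \<A> f p u \<noteq> 0) \<longleftrightarrow> (\<exists>v. ?D v \<noteq> 0)"
    using smooth_differential_chart[OF f True c] tvec_of_tangent[OF c] tvec_of_same[OF c] by metis
  also have "\<dots> \<longleftrightarrow> (\<exists>i. ?D (axis i 1) \<noteq> 0)"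
    using linear_sum_axis[OF lin] by (metis (no_types, lifting) scaleR_zero_right sum.neutral)
  finally show ?thesis using True by (simp add: regular_set_def)
qed (simp add: regular_set_def)

text \<open>In a chart the regular set is where some partial derivative, a continuous function, is nonzero.\<close>

lemma open_regular_set:
  assumes f: "smooth_fun \<A> U f" and U: "open U"
  shows "open (regular_set \<A> U f)"
proof (rule Topological_Spaces.openI)
  fix p assume p: "p \<in> regular_set \<A> U f"
  define c where "c = chart_at \<A> p"
  have c: "c \<in> charts_at \<A> p" unfolding c_def by (rule chart_at_in)
  then have cA: "c \<in> \<A>" "p \<in> cdom c" using charts_atD by auto
  let ?S = "cmap c ` (cdom c \<inter> U)" 
  obtain i where i: "frechet_derivative (f \<circ> cinv c) (at (cmap c p)) (axis i 1) \<noteq> 0" and pU: "p \<in> U"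
    using p regular_set_chart_iff[OF f c] by auto
  let ?g = "\<lambda>x. frechet_derivative (f \<circ> cinv c) (at x) (axis i 1)"
  have S: "open ?S" by (rule open_chart_image[OF cA(1) U])
  have "continuous_on ?S ?g"
    by (rule smooth_on_continuous[OF smooth_on_frechet_derivative[OF smooth_funD[OF f cA(1)]]])
  then have o: "open (?g -` (- {0}) \<inter> ?S)"
    using continuous_on_open_vimage[OF S] by blast
  show "\<exists>T. open T \<and> p \<in> T \<and> T \<subseteq> regular_set \<A> U f"
  proof (intro exI conjI)
    show "open (cdom c \<inter> cmap c -` (?g -` (- {0}) \<inter> ?S))" by (rule open_chart_preimage[OF cA(1) o])
    show "p \<in> cdom c \<inter> cmap c -` (?g -` (- {0}) \<inter> ?S)" using cA pU i by auto
    show "cdom c \<inter> cmap c -` (?g -` (- {0}) \<inter> ?S) \<subseteq> regular_set \<A> U f"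
    proof
      fix q assume q: "q \<in> cdom c \<inter> cmap c -` (?g -` (- {0}) \<inter> ?S)"
      then have "c \<in> charts_at \<A> q" using cA by (simp add: charts_at_def)
      moreover have "q \<in> U"
      proof -
        have "cmap c q \<in> ?S" "q \<in> cdom c" using q by auto
        then show ?thesis using chart_image_iff[OF cA(1), of "cmap c q" U] cinv_cmap[OF cA(1), of q] by simp
      qed
      ultimately show "q \<in> regular_set \<A> U f" using regular_set_chart_iff[OF f] q by auto
    qed
  qed
qed

text \<open>The charts chosen at the points of \<open>V\<close> may vary wildly from point to point. Smoothness is obtained
  from expressions \<open>g c\<close> that are valid on a whole chart \<open>c\<close> and agree on overlaps.\<close>

lemma smooth_fun_chartI:
  assumes "open V" "\<And>c. c \<in> \<A> \<Longrightarrow> smooth_on (cmap c ` (cdom c \<inter> V)) (g c)"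
    and "\<And>c p. c \<in> charts_at \<A> p \<Longrightarrow> p \<in> V \<Longrightarrow> h p = g c (cmap c p)"
  shows "smooth_fun \<A> V h"
  unfolding smooth_fun_def
proof
  fix c assume c: "c \<in> \<A>"
  have "smooth_on (cmap c ` (cdom c \<inter> V)) (h \<circ> cinv c) \<longleftrightarrow> smooth_on (cmap c ` (cdom c \<inter> V)) (g c)"
  proof (rule smooth_on_cong[OF open_chart_image[OF c assms(1)]])
    fix x assume "x \<in> cmap c ` (cdom c \<inter> V)"
    then obtain p where "p \<in> cdom c" "p \<in> V" "x = cmap c p" by auto
    then show "(h \<circ> cinv c) x = g c x" using assms(3)[of c p] c by (simp add: charts_at_def cinv_cmap)
  qed
  then show "smooth_on (cmap c ` (cdom c \<inter> V)) (h \<circ> cinv c)" using assms(2)[OF c] by simp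
qed

lemma smooth_fun_cong:
  assumes "open V" "smooth_fun \<A> V g" "\<And>p. p \<in> V \<Longrightarrow> h p = g p" shows "smooth_fun \<A> V h"
  by (rule smooth_fun_chartI[OF assms(1) smooth_funD[OF assms(2)]])
    (use assms(3) in \<open>auto simp: charts_at_def cinv_cmap cinv_cmap_pair\<close>)

lemma smooth_fun_diff:
  assumes "open V" "smooth_fun \<A> V g" "smooth_fun \<A> V h" shows "smooth_fun \<A> V (\<lambda>p. g p - h p)"
  by (rule smooth_fun_chartI[OF assms(1) smooth_on_diff[OF open_chart_image[OF _ assms(1)] smooth_funD[OF assms(2)] smooth_funD[OF assms(3)]]])
    (auto simp: charts_at_def cinv_cmap cinv_cmap_pair)

lemma smooth_fun_divide:
  assumes "open V" "smooth_fun \<A> V g" "smooth_fun \<A> V h" "\<And>p. p \<in> V \<Longrightarrow> h p \<noteq> 0"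
  shows "smooth_fun \<A> V (\<lambda>p. g p / h p)"
  by (rule smooth_fun_chartI[OF assms(1) smooth_on_divide[OF open_chart_image[OF _ assms(1)] smooth_funD[OF assms(2)] smooth_funD[OF assms(3)]]])
    (use assms(4) in \<open>auto simp: charts_at_def cinv_cmap cinv_cmap_pair\<close>)

lemma smooth_fun_sqrt:
  assumes "open V" "smooth_fun \<A> V g" "\<And>p. p \<in> V \<Longrightarrow> g p > 0"
  shows "smooth_fun \<A> V (\<lambda>p. sqrt (g p))"
  by (rule smooth_fun_chartI[OF assms(1) smooth_on_sqrt[OF open_chart_image[OF _ assms(1)] smooth_funD[OF assms(2)]]])
    (use assms(3) in \<open>auto simp: charts_at_def cinv_cmap cinv_cmap_pair\<close>)

lemma smooth_vector_fieldD:
  assumes "smooth_vector_field \<A> V X"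
  shows "p \<in> V \<Longrightarrow> X p \<in> tangent_space \<A> p"
    and "c \<in> \<A> \<Longrightarrow> smooth_on (cmap c ` (cdom c \<inter> V)) (\<lambda>x. X (cinv c x) c)"
  using assms by (auto simp: smooth_vector_field_def)

lemma smooth_fun_differential:
  assumes V: "open V" and f: "smooth_fun \<A> V f" and X: "smooth_vector_field \<A> V X"
  shows "smooth_fun \<A> V (\<lambda>p. differential \<A> f p (X p))"
  by (rule smooth_fun_chartI[OF V smooth_on_derivative_along[OF open_chart_image[OF _ V] smooth_funD[OF f]
          smooth_vector_fieldD(2)[OF X]]])
    (use smooth_differential_chart[OF f] smooth_vector_fieldD(1)[OF X] in \<open>auto simp: cinv_cmap cinv_cmap_pair dest: charts_atD\<close>)

section \<open>Vector fields and their divergence\<close>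

lemma volume_formD:
  assumes "volume_form \<A> \<nu>"
  shows "c \<in> \<A> \<Longrightarrow> smooth_on (cmap c ` cdom c) (\<nu> c \<circ> cinv c)"
    and "c \<in> \<A> \<Longrightarrow> p \<in> cdom c \<Longrightarrow> \<nu> c p > 0"
    and "c \<in> \<A> \<Longrightarrow> d \<in> \<A> \<Longrightarrow> p \<in> cdom c \<inter> cdom d \<Longrightarrow>
      \<nu> c p = \<bar>det (matrix (transition_deriv c d p))\<bar> * \<nu> d p"
  using assms unfolding volume_form_def by blast+

lemma smooth_vector_field_subset:
  "smooth_vector_field \<A> V X \<Longrightarrow> V' \<subseteq> V \<Longrightarrow> smooth_vector_field \<A> V' X"
  unfolding smooth_vector_field_def by (meson Int_mono image_mono order_refl smooth_on_subset subsetD)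

lemma smooth_vector_field_cong:
  assumes "open V" "smooth_vector_field \<A> V X" "\<And>p. p \<in> V \<Longrightarrow> Y p = X p"
  shows "smooth_vector_field \<A> V Y"
  unfolding smooth_vector_field_def
proof (intro conjI ballI)
  fix c assume c: "c \<in> \<A>"
  have "smooth_on (cmap c ` (cdom c \<inter> V)) (\<lambda>x. Y (cinv c x) c) \<longleftrightarrow> smooth_on (cmap c ` (cdom c \<inter> V)) (\<lambda>x. X (cinv c x) c)"
    by (rule smooth_on_cong[OF open_chart_image[OF c assms(1)]]) (use assms(3) cinv_cmap[OF c] in auto)
  then show "smooth_on (cmap c ` (cdom c \<inter> V)) (\<lambda>x. Y (cinv c x) c)"
    using smooth_vector_fieldD(2)[OF assms(2) c] by simp
qed (use assms in \<open>auto simp: smooth_vector_field_def\<close>)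

lemma smooth_vector_field_combine:
  assumes V: "open V" and g: "smooth_fun \<A> V g" and h: "smooth_fun \<A> V h"
    and X: "smooth_vector_field \<A> V X" and Y: "smooth_vector_field \<A> V Y"
  shows "smooth_vector_field \<A> V (\<lambda>p. tadd (tscale (g p) (X p)) (tscale (h p) (Y p)))"
  unfolding smooth_vector_field_def
proof (intro conjI ballI)
  fix c assume c: "c \<in> \<A>"
  note o = open_chart_image[OF c V]
  show "smooth_on (cmap c ` (cdom c \<inter> V)) (\<lambda>x. tadd (tscale (g (cinv c x)) (X (cinv c x))) (tscale (h (cinv c x)) (Y (cinv c x))) c)"
    using smooth_on_add[OF o smooth_on_scaleR[OF o smooth_funD[OF g c] smooth_vector_fieldD(2)[OF X c]]
        smooth_on_scaleR[OF o smooth_funD[OF h c] smooth_vector_fieldD(2)[OF Y c]]]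
    by (simp add: tadd_def tscale_def)
qed (use X Y in \<open>auto intro!: tadd_tangent tscale_tangent dest: smooth_vector_fieldD(1)\<close>)

text \<open>The divergence, too, is defined with a chart chosen separately at each point. Without its
  invariance under coordinate changes not even continuity of the divergence would follow.\<close>

lemma divergence_chart:
  assumes \<nu>: "volume_form \<A> \<nu>" and V: "open V" and X: "smooth_vector_field \<A> V X"
    and p: "p \<in> V" and d: "d \<in> charts_at \<A> p"
  shows "divergence \<A> \<nu> X p = coord_divergence (\<nu> d \<circ> cinv d) (\<lambda>x. X (cinv d x) d) (cmap d p)"
proof -
  define c where "c = chart_at \<A> p"
  have c: "c \<in> charts_at \<A> p" unfolding c_def by (rule chart_at_in)
  have cA: "c \<in> \<A>" "p \<in> cdom c" and dA: "d \<in> \<A>" "p \<in> cdom d" using c d charts_atD by auto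
  have TS: "X q \<in> tangent_space \<A> q" if "q \<in> V" for q using smooth_vector_fieldD(1)[OF X that] .
  let ?S = "cmap c ` (cdom c \<inter> (cdom d \<inter> V))"
  have dd: "open (cdom d)" using chart_homeomorphism[OF dA(1)] by blast
  have S: "open ?S" "cmap c p \<in> ?S" using cA dA p open_chart_image[OF cA(1) open_Int[OF dd V]] by auto
  have Tp: "(cmap d \<circ> cinv c) (cmap c p) = cmap d p" using cA cinv_cmap[OF cA(1)] by simp
  have der: "(\<lambda>x. X (cinv e x) e) differentiable (at (cmap e p))" 
     "(\<nu> e \<circ> cinv e) differentiable (at (cmap e p))" if e: "e \<in> charts_at \<A> p" for e
  proof -
    have e': "e \<in> \<A>" "p \<in> cdom e" using e charts_atD by auto
    show "(\<lambda>x. X (cinv e x) e) differentiable (at (cmap e p))"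
      using smooth_on_has_derivative[OF smooth_vector_fieldD(2)[OF X e'(1)]] e' p
      unfolding differentiable_def by blast
    from smooth_on_has_derivative[OF volume_formD(1)[OF \<nu> e'(1)]] show "(\<nu> e \<circ> cinv e) differentiable (at (cmap e p))"
      using e' unfolding differentiable_def by blast
  qed
  have TS2: "frechet_derivative (cmap d \<circ> cinv c) (at y) = transition_deriv c d (cinv c y)"
    and inS: "cinv c y \<in> cdom c" "cinv c y \<in> cdom d" "cinv c y \<in> V" if "y \<in> ?S" for y
  proof -
    obtain q where q: "q \<in> cdom c" "q \<in> cdom d" "q \<in> V" "y = cmap c q" using \<open>y \<in> ?S\<close> by blast
    then have "cinv c y = q" using cinv_cmap[OF cA(1)] by simp
    then show "cinv c y \<in> cdom c" "cinv c y \<in> cdom d" "cinv c y \<in> V"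
      "frechet_derivative (cmap d \<circ> cinv c) (at y) = transition_deriv c d (cinv c y)"
      using q by (simp_all add: transition_deriv_def)
  qed
  have "coord_divergence (\<nu> c \<circ> cinv c) (\<lambda>x. X (cinv c x) c) (cmap c p)
    = coord_divergence (\<nu> d \<circ> cinv d) (\<lambda>x. X (cinv d x) d) ((cmap d \<circ> cinv c) (cmap c p))"
  proof (rule coord_divergence_change_of_variables[OF S, where B = "transition_deriv d c p"])
    show "times_differentiable_on 2 ?S (cmap d \<circ> cinv c)"
      using smooth_on_subset[OF smooth_transition[OF cA(1) dA(1)], of ?S] by (auto simp: smooth_on_def)
    show "transition_deriv d c p (frechet_derivative (cmap d \<circ> cinv c) (at (cmap c p)) v) = v" for v
      using transition_cocycle[OF c d c] transition_refl[OF c] unfolding transition_deriv_def by metis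
    show "linear (transition_deriv d c p)" by (rule linear_transition[OF d c])
    show "((\<lambda>x. X (cinv c x) c) has_derivative frechet_derivative (\<lambda>x. X (cinv c x) c) (at (cmap c p))) (at (cmap c p))"
      "(\<nu> c \<circ> cinv c has_derivative frechet_derivative (\<nu> c \<circ> cinv c) (at (cmap c p))) (at (cmap c p))"
      using der[OF c] frechet_derivative_works by blast+
    show "((\<lambda>x. X (cinv d x) d) has_derivative frechet_derivative (\<lambda>x. X (cinv d x) d) (at (cmap d p))) (at ((cmap d \<circ> cinv c) (cmap c p)))"
      "(\<nu> d \<circ> cinv d has_derivative frechet_derivative (\<nu> d \<circ> cinv d) (at (cmap d p))) (at ((cmap d \<circ> cinv c) (cmap c p)))"
      unfolding Tp using der[OF d] frechet_derivative_works by blast+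
    show "X (cinv d ((cmap d \<circ> cinv c) y)) d = frechet_derivative (cmap d \<circ> cinv c) (at y) (X (cinv c y) c)"
      if "y \<in> ?S" for y
    proof -
      have "c \<in> charts_at \<A> (cinv c y)" "d \<in> charts_at \<A> (cinv c y)"
        using inS[OF that] cA dA by (auto simp: charts_at_def)
      from tangent_transition[OF TS[OF inS(3)[OF that]] this]
      show ?thesis using TS2[OF that] cinv_cmap[OF dA(1) inS(2)[OF that]] by simp
    qed
    show "(\<nu> c \<circ> cinv c) y = \<bar>det (matrix (frechet_derivative (cmap d \<circ> cinv c) (at y)))\<bar>
        * (\<nu> d \<circ> cinv d) ((cmap d \<circ> cinv c) y)" if "y \<in> ?S" for y
      using volume_formD(3)[OF \<nu> cA(1) dA(1), of "cinv c y"] inS[OF that] TS2[OF that]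
        cinv_cmap[OF dA(1) inS(2)[OF that]] by simp
    show "(\<nu> c \<circ> cinv c) (cmap c p) \<noteq> 0"
      using volume_formD(2)[OF \<nu> cA] cinv_cmap[OF cA] by simp
  qed
  moreover have "divergence \<A> \<nu> X p = coord_divergence (\<nu> c \<circ> cinv c) (\<lambda>x. X (cinv c x) c) (cmap c p)"
    using cA cinv_cmap[OF cA(1)] by (simp add: divergence_def Let_def lie_derivative_def coord_divergence_def c_def)
  ultimately show ?thesis unfolding Tp by simp
qed

lemma divergence_local_formula:
  assumes \<nu>: "volume_form \<A> \<nu>" and V: "open V" and X: "smooth_vector_field \<A> V X"
    and p: "p \<in> V" and c: "c \<in> charts_at \<A> p"
  shows "divergence \<A> \<nu> X p = frechet_derivative (\<nu> c \<circ> cinv c) (at (cmap c p)) (X p c) / \<nu> c p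
      + (\<Sum>i\<in>UNIV. frechet_derivative (\<lambda>x. X (cinv c x) c) (at (cmap c p)) (axis i 1) $ i)"
proof -
  have cA: "c \<in> \<A>" "p \<in> cdom c" using c charts_atD by auto
  have smX: "smooth_on (cmap c ` (cdom c \<inter> V)) (\<lambda>x. X (cinv c x) c)"
    by (rule smooth_vector_fieldD(2)[OF X cA(1)])
  have sm\<nu>: "smooth_on (cmap c ` cdom c) (\<nu> c \<circ> cinv c)" by (rule volume_formD(1)[OF \<nu> cA(1)])
  have "\<nu> c p > 0" by (rule volume_formD(2)[OF \<nu> cA])
  then show ?thesis
    unfolding divergence_chart[OF \<nu> V X p c]
    by (subst coord_divergence_eq[OF smooth_on_has_derivative[OF sm\<nu>] smooth_on_has_derivative[OF smX]])
      (use cA p cinv_cmap[OF cA(1)] in auto)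
qed

lemma smooth_fun_divergence:
  assumes \<nu>: "volume_form \<A> \<nu>" and V: "open V" and X: "smooth_vector_field \<A> V X"
  shows "smooth_fun \<A> V (divergence \<A> \<nu> X)"
proof (rule smooth_fun_chartI[OF V])
  fix c assume c: "c \<in> \<A>"
  note o = open_chart_image[OF c V]
  have smX: "smooth_on (cmap c ` (cdom c \<inter> V)) (\<lambda>x. X (cinv c x) c)"
    by (rule smooth_vector_fieldD(2)[OF X c])
  have sm\<nu>: "smooth_on (cmap c ` (cdom c \<inter> V)) (\<nu> c \<circ> cinv c)"
    by (rule smooth_on_subset[OF volume_formD(1)[OF \<nu> c]]) auto
  have "\<nu> c p > 0" if "p \<in> cdom c" for p by (rule volume_formD(2)[OF \<nu> c that])
  then show "smooth_on (cmap c ` (cdom c \<inter> V)) (\<lambda>x. frechet_derivative (\<nu> c \<circ> cinv c) (at x) (X (cinv c x) c) / (\<nu> c \<circ> cinv c) x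
      + (\<Sum>i\<in>UNIV. frechet_derivative (\<lambda>x. X (cinv c x) c) (at x) (axis i 1) $ i))"
    by (intro smooth_on_add smooth_on_divide smooth_on_sum smooth_on_component smooth_on_frechet_derivative
        smooth_on_derivative_along o smX sm\<nu>) (auto simp: cinv_cmap[OF c] less_imp_neq[symmetric])
next
  fix c p assume c: "c \<in> charts_at \<A> p" "p \<in> V"
  then show "divergence \<A> \<nu> X p = frechet_derivative (\<nu> c \<circ> cinv c) (at (cmap c p)) (X (cinv c (cmap c p)) c) / (\<nu> c \<circ> cinv c) (cmap c p)
      + (\<Sum>i\<in>UNIV. frechet_derivative (\<lambda>x. X (cinv c x) c) (at (cmap c p)) (axis i 1) $ i)"
    using divergence_local_formula[OF \<nu> V X c(2,1)] charts_atD[OF c(1)] by (simp add: cinv_cmap)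
qed

text \<open>The Leibniz rule \<open>div (g X + h Y) = g div X + dg(X) + h div Y + dh(Y)\<close>, read off in one chart.\<close>

lemma divergence_combine:
  assumes \<nu>: "volume_form \<A> \<nu>" and V: "open V" and g: "smooth_fun \<A> V g" and h: "smooth_fun \<A> V h"
    and X: "smooth_vector_field \<A> V X" and Y: "smooth_vector_field \<A> V Y"
    and Z: "smooth_vector_field \<A> V Z" and Z_eq: "\<And>p. p \<in> V \<Longrightarrow> Z p = tadd (tscale (g p) (X p)) (tscale (h p) (Y p))"
    and p: "p \<in> V"
  shows "divergence \<A> \<nu> Z p = g p * divergence \<A> \<nu> X p + differential \<A> g p (X p)
      + h p * divergence \<A> \<nu> Y p + differential \<A> h p (Y p)"
proof -
  define c where "c = chart_at \<A> p"
  have c: "c \<in> charts_at \<A> p" unfolding c_def by (rule chart_at_in)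
  have cA: "c \<in> \<A>" "p \<in> cdom c" using c charts_atD by auto
  define x where "x = cmap c p"
  have x: "cinv c x = p" "x \<in> cmap c ` (cdom c \<inter> V)" unfolding x_def using cA p cinv_cmap[OF cA(1)] by auto
  let ?\<nu> = "frechet_derivative (\<nu> c \<circ> cinv c) (at x)"
  have dX: "((\<lambda>x. X (cinv c x) c) has_derivative frechet_derivative (\<lambda>x. X (cinv c x) c) (at x)) (at x)"
    by (rule smooth_on_has_derivative[OF smooth_vector_fieldD(2)[OF X cA(1)] x(2)])
  have dY: "((\<lambda>x. Y (cinv c x) c) has_derivative frechet_derivative (\<lambda>x. Y (cinv c x) c) (at x)) (at x)"
    by (rule smooth_on_has_derivative[OF smooth_vector_fieldD(2)[OF Y cA(1)] x(2)])
  have dg: "((\<lambda>x. g (cinv c x)) has_derivative frechet_derivative (g \<circ> cinv c) (at x)) (at x)"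
    using smooth_on_has_derivative[OF smooth_funD[OF g cA(1)] x(2)] by (simp add: o_def)
  have dh: "((\<lambda>x. h (cinv c x)) has_derivative frechet_derivative (h \<circ> cinv c) (at x)) (at x)"
    using smooth_on_has_derivative[OF smooth_funD[OF h cA(1)] x(2)] by (simp add: o_def)
  have sm\<nu>: "smooth_on (cmap c ` cdom c) (\<nu> c \<circ> cinv c)" by (rule volume_formD(1)[OF \<nu> cA(1)])
  have lin: "linear ?\<nu>"
    by (rule has_derivative_linear[OF smooth_on_has_derivative[OF sm\<nu>]]) (use x in auto)
  have Zc: "Z p c = g p *\<^sub>R X p c + h p *\<^sub>R Y p c" using Z_eq[OF p] by (simp add: tadd_def tscale_def)
  have "((\<lambda>x. g (cinv c x) *\<^sub>R X (cinv c x) c + h (cinv c x) *\<^sub>R Y (cinv c x) c) has_derivative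
     (\<lambda>v. (g (cinv c x) *\<^sub>R frechet_derivative (\<lambda>x. X (cinv c x) c) (at x) v + frechet_derivative (g \<circ> cinv c) (at x) v *\<^sub>R X (cinv c x) c)
        + (h (cinv c x) *\<^sub>R frechet_derivative (\<lambda>x. Y (cinv c x) c) (at x) v + frechet_derivative (h \<circ> cinv c) (at x) v *\<^sub>R Y (cinv c x) c))) (at x)"
    by (intro has_derivative_add has_derivative_scaleR dX dY dg dh)
  then have "((\<lambda>x. Z (cinv c x) c) has_derivative
     (\<lambda>v. (g (cinv c x) *\<^sub>R frechet_derivative (\<lambda>x. X (cinv c x) c) (at x) v + frechet_derivative (g \<circ> cinv c) (at x) v *\<^sub>R X (cinv c x) c)
        + (h (cinv c x) *\<^sub>R frechet_derivative (\<lambda>x. Y (cinv c x) c) (at x) v + frechet_derivative (h \<circ> cinv c) (at x) v *\<^sub>R Y (cinv c x) c))) (at x)"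
    by (rule has_derivative_transform_within_open[OF _ open_chart_image[OF cA(1) V] x(2)])
      (use Z_eq cinv_cmap[OF cA(1)] in \<open>auto simp: tadd_def tscale_def\<close>)
  note DZ = frechet_derivative_eqI[OF this]
  have along: "(\<Sum>i\<in>UNIV. frechet_derivative (k \<circ> cinv c) (at x) (axis i 1) * K p c $ i) = differential \<A> k p (K p)"
    if "smooth_fun \<A> V k" "smooth_vector_field \<A> V K" for k K
  proof -
    have "differential \<A> k p (K p) = frechet_derivative (k \<circ> cinv c) (at x) (K p c)"
      unfolding x_def by (rule smooth_differential_chart[OF that(1) p c smooth_vector_fieldD(1)[OF that(2) p]])
    moreover have "linear (frechet_derivative (k \<circ> cinv c) (at x))"
      by (rule has_derivative_linear[OF smooth_on_has_derivative[OF smooth_funD[OF that(1) cA(1)] x(2)]])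
    ultimately show ?thesis using linear_sum_axis[of "frechet_derivative (k \<circ> cinv c) (at x)" "K p c"] by (simp add: mult.commute)
  qed
  show ?thesis
    unfolding divergence_local_formula[OF \<nu> V X p c] divergence_local_formula[OF \<nu> V Y p c]
      divergence_local_formula[OF \<nu> V Z p c] x_def[symmetric] DZ Zc linear_add[OF lin] linear_scale[OF lin]
      along[OF g X, symmetric] along[OF h Y, symmetric]
    by (simp add: x(1) sum.distrib sum_distrib_left algebra_simps add_divide_distrib)
qed

end

section \<open>Fundamental tensors of positively homogeneous functions\<close>

text \<open>The fundamental tensor in linear coordinates of one tangent space.\<close>

definition halved_square_hessian :: "('a::real_vector \<Rightarrow> real) \<Rightarrow> 'a \<Rightarrow> 'a \<Rightarrow> 'a \<Rightarrow> real" where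
  "halved_square_hessian h x u\<^sub>1 u\<^sub>2 =
    1/2 * deriv (\<lambda>t\<^sub>2. deriv (\<lambda>t\<^sub>1. (h (x + (t\<^sub>1 *\<^sub>R u\<^sub>1 + t\<^sub>2 *\<^sub>R u\<^sub>2)))\<^sup>2) 0) 0"

lemma open_line_preimage:
  fixes S :: "'a::real_normed_vector set"
  assumes "open S" shows "open {t::real. x + t *\<^sub>R u \<in> S}"
proof -
  have "open ((\<lambda>t. x + t *\<^sub>R u) -` S)"
    by (rule open_vimage[OF assms]) (intro continuous_intros)
  then show ?thesis by (simp add: vimage_def)
qed

lemma DERIV_cong_open:
  assumes "open T" "x \<in> T" "\<And>y. y \<in> T \<Longrightarrow> f y = g y" "(g has_field_derivative D) (at x)"
  shows "(f has_field_derivative D) (at x)"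
  by (rule has_field_derivative_transform_within_open[OF assms(4,1,2)]) (simp add: assms(3))

text \<open>What remains of a conic Finsler metric on one tangent space, off the zero vector: \<open>h\<close> is the
  metric in linear coordinates and \<open>h'\<close> its derivative.\<close>

locale homogeneous_on_cone =
  fixes S :: "'a::euclidean_space set" and h :: "'a \<Rightarrow> real" and h' :: "'a \<Rightarrow> 'a \<Rightarrow> real"
  assumes open_S: "open S"
    and cone: "x \<in> S \<Longrightarrow> r > 0 \<Longrightarrow> r *\<^sub>R x \<in> S"
    and homogeneous: "x \<in> S \<Longrightarrow> r > 0 \<Longrightarrow> h (r *\<^sub>R x) = r * h x"
    and deriv: "x \<in> S \<Longrightarrow> (h has_derivative h' x) (at x)"
    and deriv2: "x \<in> S \<Longrightarrow> (\<lambda>y. h' y u) differentiable (at x)"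
begin

lemma linear_deriv: "x \<in> S \<Longrightarrow> linear (h' x)"
  by (rule has_derivative_linear[OF deriv])

lemma DERIV_line: "x + s *\<^sub>R u \<in> S \<Longrightarrow> ((\<lambda>t. h (x + t *\<^sub>R u)) has_real_derivative h' (x + s *\<^sub>R u) u) (at s)"
  unfolding has_real_derivative_iff_has_vector_derivative
  by (rule has_vector_derivative_along_line[OF deriv])

lemma euler: assumes x: "x \<in> S" shows "h' x x = h x"
proof -
  have "((\<lambda>t. h (x + t *\<^sub>R x)) has_real_derivative h' x x) (at 0)"
    using DERIV_line[of x 0 x] x by simp
  moreover have "((\<lambda>t. h (x + t *\<^sub>R x)) has_real_derivative h x) (at 0)"
  proof (rule DERIV_cong_open[of "{-1<..}"])
    show "h (x + t *\<^sub>R x) = (1 + t) * h x" if "t \<in> {-1<..}" for t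
      using homogeneous[OF x, of "1 + t"] that by (simp add: scaleR_add_left)
  qed (auto intro!: derivative_eq_intros)
  ultimately show ?thesis by (rule DERIV_unique)
qed

text \<open>The derivative of a function that is homogeneous of degree one is homogeneous of degree zero.\<close>

lemma deriv_scale: assumes x: "x \<in> S" and r: "r > 0" shows "h' (r *\<^sub>R x) = h' x"
proof -
  have "((\<lambda>y. h (r *\<^sub>R y)) has_derivative (\<lambda>v. h' (r *\<^sub>R x) (r *\<^sub>R v))) (at x)"
    by (rule has_derivative_compose[OF has_derivative_scaleR_right[OF has_derivative_ident] deriv[OF cone[OF x r]]])
  then have "((\<lambda>y. r * h y) has_derivative (\<lambda>v. h' (r *\<^sub>R x) (r *\<^sub>R v))) (at x)"
    by (rule has_derivative_transform_within_open[OF _ open_S x]) (simp add: homogeneous r)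
  from has_derivative_unique[OF this has_derivative_mult_right[OF deriv[OF x]]]
  have "h' (r *\<^sub>R x) (r *\<^sub>R v) = r * h' x v" for v by (simp add: fun_eq_iff)
  then show ?thesis using r by (simp add: fun_eq_iff linear_scale[OF linear_deriv[OF cone[OF x r]]])
qed

lemma deriv_square_line:
  assumes "x \<in> S" shows "deriv (\<lambda>t. (h (x + t *\<^sub>R u))\<^sup>2) 0 = 2 * h x * h' x u"
proof -
  have "((\<lambda>t. (h (x + t *\<^sub>R u))\<^sup>2) has_real_derivative 2 * h x * h' x u) (at 0)"
    using DERIV_power[OF DERIV_line[of x 0 u], of 2] assms by (simp add: mult_ac)
  then show ?thesis by (rule DERIV_imp_deriv)
qed

lemma differentiable_deriv_line:
  assumes "x + s *\<^sub>R u \<in> S"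
  shows "(\<lambda>t. h' (x + t *\<^sub>R u) v) differentiable (at s)"
proof -
  have "(\<lambda>t. x + t *\<^sub>R u) differentiable (at s)"
    unfolding differentiable_def by (auto intro!: derivative_eq_intros exI)
  then show ?thesis
    using differentiable_chain_at[of "\<lambda>t. x + t *\<^sub>R u" s "\<lambda>y. h' y v"] deriv2[OF assms] by (simp add: o_def)
qed

text \<open>Euler's relation turns the first derivative in direction \<open>v = x - t u\<close>, at \<open>x = v + t u\<close>,
  into \<open>2 h\<^sup>2 - t (h\<^sup>2)'(u)\<close>, so that a second derivative of \<open>h\<close> does not enter.\<close>

lemma hessian_diagonal:
  assumes v: "v \<in> S"
  shows "halved_square_hessian h v v u = h v * h' v u"
proof -
  let ?T = "{t. v + t *\<^sub>R u \<in> S}"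
  define k where "k t = 2 * h (v + t *\<^sub>R u) * h' (v + t *\<^sub>R u) u" for t
  have T: "open ?T" "0 \<in> ?T" using open_line_preimage[OF open_S] v by auto
  have inner: "deriv (\<lambda>t\<^sub>1. (h (v + (t\<^sub>1 *\<^sub>R v + t *\<^sub>R u)))\<^sup>2) 0 = 2 * (h (v + t *\<^sub>R u))\<^sup>2 - t * k t"
    if t: "t \<in> ?T" for t
  proof -
    let ?x = "v + t *\<^sub>R u"
    have x: "?x \<in> S" using t by simp
    have "deriv (\<lambda>t\<^sub>1. (h (v + (t\<^sub>1 *\<^sub>R v + t *\<^sub>R u)))\<^sup>2) 0 = deriv (\<lambda>t\<^sub>1. (h (?x + t\<^sub>1 *\<^sub>R v))\<^sup>2) 0"
      by (simp add: add_ac)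
    also have "\<dots> = 2 * h ?x * h' ?x v" by (rule deriv_square_line[OF x])
    also have "h' ?x v = h ?x - t * h' ?x u"
      using euler[OF x] by (simp add: linear_add[OF linear_deriv[OF x]] linear_scale[OF linear_deriv[OF x]])
    finally show ?thesis by (simp add: k_def power2_eq_square algebra_simps)
  qed
  have "isCont k 0" unfolding k_def
    by (intro continuous_intros differentiable_imp_continuous_within[OF differentiable_deriv_line]
        DERIV_isCont[OF DERIV_line]) (use v in auto)
  then have "((\<lambda>t. t * k t) has_real_derivative k 0) (at 0)"
    unfolding CARAT_DERIV by (intro exI[of _ k]) simp
  moreover have "((\<lambda>t. 2 * (h (v + t *\<^sub>R u))\<^sup>2) has_real_derivative 4 * h v * h' v u) (at 0)"
    using DERIV_cmult[OF DERIV_power[OF DERIV_line[of v 0 u], of 2], of 2] v by (simp add: mult_ac)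
  ultimately have "((\<lambda>t. 2 * (h (v + t *\<^sub>R u))\<^sup>2 - t * k t) has_real_derivative 4 * h v * h' v u - k 0) (at 0)"
    by (intro DERIV_diff)
  then have "((\<lambda>t. deriv (\<lambda>t\<^sub>1. (h (v + (t\<^sub>1 *\<^sub>R v + t *\<^sub>R u)))\<^sup>2) 0) has_real_derivative 4 * h v * h' v u - k 0) (at 0)"
    by (rule DERIV_cong_open[OF T inner, rotated])
  from DERIV_imp_deriv[OF this] show ?thesis unfolding halved_square_hessian_def k_def by simp
qed

text \<open>The function differentiated here is the derivative of \<open>t \<mapsto> h\<^sup>2(x + t w) / 2\<close>.\<close>

lemma DERIV_square_deriv_line:
  assumes x: "x \<in> S"
  shows "((\<lambda>t. h (x + t *\<^sub>R w) * h' (x + t *\<^sub>R w) w) has_real_derivative halved_square_hessian h x w w) (at 0)"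
proof -
  let ?T = "{t. x + t *\<^sub>R w \<in> S}"
  let ?g = "\<lambda>t. h (x + t *\<^sub>R w) * h' (x + t *\<^sub>R w) w"
  have T: "open ?T" "0 \<in> ?T" using open_line_preimage[OF open_S] x by auto
  have "(\<lambda>t. h (x + t *\<^sub>R w)) differentiable (at 0)"
    using DERIV_line[of x 0 w] x unfolding real_differentiable_def by auto
  moreover have "(\<lambda>t. h' (x + t *\<^sub>R w) w) differentiable (at 0)"
    by (rule differentiable_deriv_line) (use x in simp)
  ultimately have "?g differentiable (at 0)" by (rule differentiable_mult)
  then obtain D where D: "(?g has_real_derivative D) (at 0)" unfolding real_differentiable_def by auto
  have inner: "deriv (\<lambda>t\<^sub>1. (h (x + (t\<^sub>1 *\<^sub>R w + t *\<^sub>R w)))\<^sup>2) 0 = 2 * ?g t" if "t \<in> ?T" for t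
  proof -
    have "deriv (\<lambda>t\<^sub>1. (h (x + (t\<^sub>1 *\<^sub>R w + t *\<^sub>R w)))\<^sup>2) 0 = deriv (\<lambda>t\<^sub>1. (h ((x + t *\<^sub>R w) + t\<^sub>1 *\<^sub>R w))\<^sup>2) 0"
      by (simp add: add_ac)
    then show ?thesis using deriv_square_line[of "x + t *\<^sub>R w" w] that by simp
  qed
  have "((\<lambda>t. deriv (\<lambda>t\<^sub>1. (h (x + (t\<^sub>1 *\<^sub>R w + t *\<^sub>R w)))\<^sup>2) 0) has_real_derivative 2 * D) (at 0)"
    by (rule DERIV_cong_open[OF T inner DERIV_cmult[OF D]])
  from DERIV_imp_deriv[OF this] show ?thesis using D unfolding halved_square_hessian_def by simp
qed

text \<open>The Legendre map of a Minkowski norm is injective: half the squared norm has positive second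
  derivative along the segment from \<open>u\<close> to \<open>v\<close>, hence different derivatives at its ends. A
  segment through the origin has \<open>v\<close> a negative multiple of \<open>u\<close>, where the signs of the
  derivatives already differ.\<close>

lemma legendre_injective:
  assumes S: "S = UNIV - {0}"
    and pos: "\<And>x w. x \<noteq> 0 \<Longrightarrow> w \<noteq> 0 \<Longrightarrow> halved_square_hessian h x w w > 0"
    and u: "u \<noteq> 0" and v: "v \<noteq> 0" and eq: "\<And>w. h u * h' u w = h v * h' v w"
  shows "u = v"
proof (rule ccontr)
  assume "u \<noteq> v"
  define w where "w = v - u"
  have w: "w \<noteq> 0" using \<open>u \<noteq> v\<close> w_def by simp
  show False
  proof (cases "\<exists>t\<in>{0..1}. u + t *\<^sub>R w = 0")
    case False
    let ?g = "\<lambda>t. h (u + t *\<^sub>R w) * h' (u + t *\<^sub>R w) w"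
    have D: "(?g has_real_derivative halved_square_hessian h (u + t *\<^sub>R w) w w) (at t)"
      if "0 \<le> t" "t \<le> 1" for t
    proof -
      have "((\<lambda>s. ?g (s + t)) has_real_derivative halved_square_hessian h (u + t *\<^sub>R w) w w) (at 0)"
        using DERIV_square_deriv_line[of "u + t *\<^sub>R w" w] False that S by (simp add: algebra_simps)
      then show ?thesis using DERIV_shift[of ?g _ 0 t] by simp
    qed
    obtain t where "0 < t" "t < 1" "?g 1 - ?g 0 = (1 - 0) * halved_square_hessian h (u + t *\<^sub>R w) w w"
      using MVT2[of 0 1 ?g, OF _ D] by auto
    moreover have "?g 1 = ?g 0" using eq[of w] by (simp add: w_def)
    moreover have "u + t *\<^sub>R w \<noteq> 0" using False \<open>0 < t\<close> \<open>t < 1\<close> by auto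
    ultimately show False using pos[of "u + t *\<^sub>R w" w] w by simp
  next
    case True
    then obtain t where t: "0 \<le> t" "t \<le> 1" "u + t *\<^sub>R w = 0" by auto
    have "(1 - t) *\<^sub>R u + t *\<^sub>R v = 0" using t(3) by (simp add: w_def algebra_simps)
    moreover have "t \<noteq> 0" "t \<noteq> 1" using u v calculation by auto
    ultimately have tp: "0 < t" "t < 1" and tv: "t *\<^sub>R v = (t - 1) *\<^sub>R u"
      using t by (auto simp: algebra_simps eq_neg_iff_add_eq_0)
    have uS: "u \<in> S" "v \<in> S" using u v S by auto
    have pos': "h x * h x > 0" if "x \<in> S" for x
      using hessian_diagonal[OF that, of x] pos[of x x] euler[OF that] that S by simp
    have "t * (h v * h v) = h v * h' v (t *\<^sub>R v)" 
      by (simp add: linear_scale[OF linear_deriv[OF uS(2)]] euler[OF uS(2)])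
    also have "\<dots> = h u * h' u ((t - 1) *\<^sub>R u)" using eq tv by metis
    also have "\<dots> = (t - 1) * (h u * h u)"
      by (simp add: linear_scale[OF linear_deriv[OF uS(1)]] euler[OF uS(1)])
    finally have "t * (h v * h v) = (t - 1) * (h u * h u)" .
    moreover have "t * (h v * h v) > 0" using tp pos'[OF uS(2)] by simp
    moreover have "(t - 1) * (h u * h u) < 0" using tp pos'[OF uS(1)] by (simp add: mult_neg_pos)
    ultimately show False by simp
  qed
qed

end

section \<open>Legendre duals under navigation\<close>

text \<open>Differentiating \<open>h (y / z y - w) = 1\<close> at \<open>y = x\<close> shows that the derivatives of \<open>z\<close> at \<open>x\<close>
  and of \<open>h\<close> at \<open>u = x / z x - w\<close> are proportional, with factor \<open>1 + h' u w\<close>; this factor is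
  positive precisely by the inequality selecting the part of the translated indicatrix.\<close>

lemma navigation_derivative:
  assumes h: "homogeneous_on_cone S h h'" and z: "homogeneous_on_cone T z z'"
    and x: "x \<in> T" and zpos: "\<And>y. y \<in> T \<Longrightarrow> z y > 0"
    and nav: "\<And>y. y \<in> T \<Longrightarrow> h ((1 / z y) *\<^sub>R y - w) = 1"
    and uS: "u \<in> S" and u: "u = (1 / z x) *\<^sub>R x - w"
    and side: "halved_square_hessian h u u (- w) < 1"
  shows "1 + h' u w > 0" and "h' u v = (1 + h' u w) * z' x v"
proof -
  interpret h: homogeneous_on_cone S h h' by (rule h)
  interpret z: homogeneous_on_cone T z z' by (rule z)
  note lin = h.linear_deriv[OF uS]
  have hu: "h u = 1" using nav[OF x] u by simp
  show pos: "1 + h' u w > 0"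
    using side h.hessian_diagonal[OF uS, of "- w"] hu by (simp add: linear_neg[OF lin])
  have zx: "z x > 0" by (rule zpos[OF x])
  have "((\<lambda>y. inverse (z y) *\<^sub>R y - w) has_derivative
     (\<lambda>v. inverse (z x) *\<^sub>R v + (- (inverse (z x) * z' x v * inverse (z x))) *\<^sub>R x - 0)) (at x)"
    by (intro has_derivative_diff has_derivative_scaleR Deriv.has_derivative_inverse z.deriv x has_derivative_ident has_derivative_const)
      (use zx in auto)
  from has_derivative_compose[OF this, of h "h' u"] h.deriv[OF uS]
  have "((\<lambda>y. h (inverse (z y) *\<^sub>R y - w)) has_derivative
     (\<lambda>v. h' u (inverse (z x) *\<^sub>R v + (- (inverse (z x) * z' x v * inverse (z x))) *\<^sub>R x))) (at x)"
    by (simp add: u divide_inverse)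
  then have "((\<lambda>y. 1) has_derivative
     (\<lambda>v. h' u (inverse (z x) *\<^sub>R v + (- (inverse (z x) * z' x v * inverse (z x))) *\<^sub>R x))) (at x)"
    by (rule has_derivative_transform_within_open[OF _ z.open_S x]) (use nav in \<open>auto simp: divide_inverse\<close>)
  from has_derivative_unique[OF this has_derivative_const]
  have "h' u (inverse (z x) *\<^sub>R v + (- (inverse (z x) * z' x v * inverse (z x))) *\<^sub>R x) = 0"
    by (rule fun_cong)
  then have "h' u v = z' x v * (inverse (z x) * h' u x)"
    using zx by (simp add: linear_diff[OF lin] linear_add[OF lin] linear_scale[OF lin] linear_neg[OF lin] field_simps)
  moreover have "inverse (z x) * h' u x = 1 + h' u w"
  proof -
    have "inverse (z x) *\<^sub>R x = u + w" by (simp add: u divide_inverse)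
    then have "h' u (inverse (z x) *\<^sub>R x) = h' u u + h' u w" by (simp add: linear_add[OF lin])
    then show ?thesis by (simp add: linear_scale[OF lin] h.euler[OF uS] hu)
  qed
  ultimately show "h' u v = (1 + h' u w) * z' x v" by simp
qed

section \<open>Conic Finsler metrics on a single tangent space\<close>

lemma open_slice:
  fixes S :: "('a::topological_space \<times> 'b::topological_space) set"
  assumes "open S" shows "open {y. (x, y) \<in> S}"
proof -
  have "open (Pair x -` S)" by (rule open_vimage[OF assms]) (intro continuous_intros)
  then show ?thesis by (simp add: vimage_def)
qed

text \<open>Smoothness of a metric concerns position and velocity together. Fixing the position gives
  smoothness on a tangent space, with derivatives taken in the directions \<open>(0, v)\<close>.\<close>

lemma times_differentiable_on_slice:
  fixes \<Phi> :: "'a::euclidean_space \<times> 'b::euclidean_space \<Rightarrow> 'c::euclidean_space"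
  assumes S: "open S" and "times_differentiable_on k S \<Phi>"
  shows "times_differentiable_on k {y. (x, y) \<in> S} (\<lambda>y. \<Phi> (x, y))"
  using assms(2)
proof (induction k arbitrary: \<Phi>)
  case 0
  then have "continuous_on S \<Phi>" by simp
  moreover have "continuous_on {y. (x, y) \<in> S} (Pair x)" by (intro continuous_intros)
  ultimately have "continuous_on {y. (x, y) \<in> S} (\<lambda>y. \<Phi> (x, y))"
    by (rule continuous_on_compose2) blast
  then show ?case by simp
next
  case (Suc k)
  show ?case
  proof (rule times_differentiable_on_SucI[OF open_slice[OF S]])
    fix y assume y: "y \<in> {y. (x, y) \<in> S}"
    have "((\<lambda>y. (x, y)) has_derivative (\<lambda>v. (0, v))) (at y)"
      by (intro has_derivative_Pair has_derivative_const has_derivative_ident)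
    from has_derivative_compose[OF this] times_differentiable_on_SucD(1)[OF Suc.prems, of "(x, y)"] y
    show "((\<lambda>y. \<Phi> (x, y)) has_derivative (\<lambda>v. frechet_derivative \<Phi> (at (x, y)) (0, v))) (at y)"
      by blast
  next
    show "times_differentiable_on k {y. (x, y) \<in> S} (\<lambda>y. frechet_derivative \<Phi> (at (x, y)) (0, v))" for v
      by (rule Suc.IH[OF times_differentiable_on_SucD(2)[OF Suc.prems]])
  qed
qed

lemma smooth_on_slice:
  fixes \<Phi> :: "'a::euclidean_space \<times> 'b::euclidean_space \<Rightarrow> 'c::euclidean_space"
  assumes "open S" "smooth_on S \<Phi>" shows "smooth_on {y. (x, y) \<in> S} (\<lambda>y. \<Phi> (x, y))"
  unfolding smooth_on_def
proof
  fix k show "times_differentiable_on k {y. (x, y) \<in> S} (\<lambda>y. \<Phi> (x, y))"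
    by (rule times_differentiable_on_slice[OF assms(1)]) (use assms(2) in \<open>simp add: smooth_on_def\<close>)
qed

context manifold_atlas
begin

lemma tm_image_iff:
  assumes B: "B \<subseteq> tangent_bundle \<A>" and c: "c \<in> charts_at \<A> p"
  shows "(cmap c p, y) \<in> tm_image c B \<longleftrightarrow> (p, tvec_of \<A> c p y) \<in> B"
proof
  assume "(cmap c p, y) \<in> tm_image c B"
  then obtain q v where q: "(q, v) \<in> B" "q \<in> cdom c" "cmap c p = cmap c q" "y = v c"
    unfolding tm_image_def by blast
  have "q = p" using q cinv_cmap charts_atD[OF c] by metis
  moreover have "v \<in> tangent_space \<A> q" using q(1) B by (auto simp: tangent_bundle_def)
  ultimately show "(p, tvec_of \<A> c p y) \<in> B" using tvec_of_component[OF c] q by simp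
next
  assume "(p, tvec_of \<A> c p y) \<in> B"
  then show "(cmap c p, y) \<in> tm_image c B"
    unfolding tm_image_def mem_Collect_eq
    by (intro exI[of _ p] exI[of _ "tvec_of \<A> c p y"]) (simp add: tvec_of_same[OF c] charts_atD[OF c])
qed

lemma open_tm_image_off_zero:
  assumes A: "tm_open \<A> A" and c: "c \<in> \<A>"
  shows "open (tm_image c (off_zero A))"
proof -
  have "tm_image c (off_zero A) = tm_image c A \<inter> snd -` (- {0})"
  proof (intro set_eqI iffI)
    fix \<xi> assume "\<xi> \<in> tm_image c (off_zero A)"
    then obtain p v where v: "\<xi> = (cmap c p, v c)" "(p, v) \<in> A" "v \<noteq> tzero" "p \<in> cdom c"
      unfolding tm_image_def off_zero_def by blast
    then have "v \<in> tangent_space \<A> p" "c \<in> charts_at \<A> p"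
      using A c by (auto simp: tm_open_def tangent_bundle_def charts_at_def)
    then show "\<xi> \<in> tm_image c A \<inter> snd -` (- {0})"
      using v tangent_eq_tzero_iff[of v p c] unfolding tm_image_def by auto
  next
    fix \<xi> assume \<xi>: "\<xi> \<in> tm_image c A \<inter> snd -` (- {0})"
    then obtain p v where v: "\<xi> = (cmap c p, v c)" "(p, v) \<in> A" "p \<in> cdom c"
      unfolding tm_image_def by blast
    then have "v \<noteq> tzero" using \<xi> by (auto simp: tzero_def)
    then show "\<xi> \<in> tm_image c (off_zero A)" using v unfolding tm_image_def off_zero_def by blast
  qed
  moreover have "open (snd -` (- {0}) :: ((real ^ 'n) \<times> (real ^ 'n)) set)"
    by (intro open_vimage continuous_intros)
  moreover have "open (tm_image c A)" using A c by (simp add: tm_open_def)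
  ultimately show ?thesis by auto
qed

lemma metric_on_fibre:
  assumes F: "conic_finsler_metric \<A> A F" and c: "c \<in> charts_at \<A> p"
  defines "h \<equiv> \<lambda>y. F (p, tvec_of \<A> c p y)"
  shows "homogeneous_on_cone {y. (p, tvec_of \<A> c p y) \<in> off_zero A} h (\<lambda>y. frechet_derivative h (at y))"
proof -
  let ?S = "{y. (p, tvec_of \<A> c p y) \<in> off_zero A}"
  have cA: "c \<in> \<A>" "p \<in> cdom c" using charts_atD[OF c] by auto
  have A: "tm_open \<A> A" and sm: "smooth_on (tm_image c (off_zero A)) (F \<circ> tm_inv \<A> c)"
    using F cA by (auto simp: conic_finsler_metric_def tm_smooth_on_def)
  have sub: "off_zero A \<subseteq> tangent_bundle \<A>" using A by (auto simp: tm_open_def off_zero_def)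
  have o: "open (tm_image c (off_zero A))" by (rule open_tm_image_off_zero[OF A cA(1)])
  have S: "?S = {y. (cmap c p, y) \<in> tm_image c (off_zero A)}" using tm_image_iff[OF sub c] by auto
  have h: "h = (\<lambda>y. (F \<circ> tm_inv \<A> c) (cmap c p, y))"
    unfolding h_def tm_inv_def by (simp add: cinv_cmap[OF cA])
  have opS: "open ?S" unfolding S by (rule open_slice[OF o])
  have smh: "smooth_on ?S h"
    unfolding S h by (rule smooth_on_slice[OF o sm])
  show ?thesis
  proof
    show "open ?S" by (rule opS)
    show "r *\<^sub>R x \<in> ?S" "h (r *\<^sub>R x) = r * h x" if x: "x \<in> ?S" and r: "r > 0" for x r
    proof -
      have sc: "tvec_of \<A> c p (r *\<^sub>R x) = tscale r (tvec_of \<A> c p x)"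
        using tvec_of_scale[OF c] by simp
      have xA: "(p, tvec_of \<A> c p x) \<in> A" "tvec_of \<A> c p x \<noteq> tzero" using x by (auto simp: off_zero_def)
      have cone: "(q, tscale r v) \<in> A" "F (q, tscale r v) = r * F (q, v)" if "(q, v) \<in> A" for q v
        using F that r unfolding conic_finsler_metric_def by blast+
      have "tscale r (tvec_of \<A> c p x) \<noteq> tzero"
        using xA(2) r by (auto simp: tscale_def tzero_def fun_eq_iff)
      then show "r *\<^sub>R x \<in> ?S" using cone(1)[OF xA(1)] by (simp add: sc off_zero_def)
      show "h (r *\<^sub>R x) = r * h x" unfolding h_def sc by (rule cone(2)[OF xA(1)])
    qed
    show "(h has_derivative frechet_derivative h (at x)) (at x)" if "x \<in> ?S" for x
      by (rule smooth_on_has_derivative[OF smh that])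
    show "(\<lambda>y. frechet_derivative h (at y) u) differentiable (at x)" if "x \<in> ?S" for x u
      using smooth_on_has_derivative[OF smooth_on_frechet_derivative[OF smh] that]
      unfolding differentiable_def by blast
  qed
qed

lemma fundamental_tensor_coord:
  assumes c: "c \<in> charts_at \<A> p"
    and v: "v \<in> tangent_space \<A> p" "u\<^sub>1 \<in> tangent_space \<A> p" "u\<^sub>2 \<in> tangent_space \<A> p"
  shows "fundamental_tensor F p v u\<^sub>1 u\<^sub>2 = halved_square_hessian (\<lambda>y. F (p, tvec_of \<A> c p y)) (v c) (u\<^sub>1 c) (u\<^sub>2 c)"
proof -
  have "tadd v (tadd (tscale t\<^sub>1 u\<^sub>1) (tscale t\<^sub>2 u\<^sub>2)) = tvec_of \<A> c p (v c + (t\<^sub>1 *\<^sub>R u\<^sub>1 c + t\<^sub>2 *\<^sub>R u\<^sub>2 c))" for t\<^sub>1 t\<^sub>2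
    unfolding tvec_of_add[OF c, symmetric] tvec_of_scale[OF c, symmetric] tvec_of_component[OF c v(1)]
      tvec_of_component[OF c v(2)] tvec_of_component[OF c v(3)] ..
  then show ?thesis unfolding fundamental_tensor_def halved_square_hessian_def by simp
qed

lemma off_zero_tangent_bundle_fibre:
  assumes c: "c \<in> charts_at \<A> p"
  shows "{y. (p, tvec_of \<A> c p y) \<in> off_zero (tangent_bundle \<A>)} = UNIV - {0}"
  using tvec_of_tangent[OF c] tangent_eq_tzero_iff[OF tvec_of_tangent[OF c] c] tvec_of_same[OF c]
  by (auto simp: off_zero_def tangent_bundle_def)

text \<open>A function has at most one gradient for a Finsler metric. Hence the gradient field occurring in
  the notion of isoparametricity for \<open>F\<close> is the one computed from the gradient for \<open>Z\<close> by navigation.\<close>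

lemma finsler_gradient_unique:
  assumes F: "finsler_metric \<A> F"
    and u: "u \<in> tangent_space \<A> p" "u \<noteq> tzero" and v: "v \<in> tangent_space \<A> p" "v \<noteq> tzero"
    and eq: "\<And>w. w \<in> tangent_space \<A> p \<Longrightarrow> fundamental_tensor F p u u w = fundamental_tensor F p v v w"
  shows "u = v"
proof -
  define c where "c = chart_at \<A> p"
  have c: "c \<in> charts_at \<A> p" unfolding c_def by (rule chart_at_in)
  let ?h = "\<lambda>y. F (p, tvec_of \<A> c p y)"
  have F': "conic_finsler_metric \<A> (tangent_bundle \<A>) F" using F by (simp add: finsler_metric_def)
  interpret homogeneous_on_cone "UNIV - {0}" ?h "\<lambda>y. frechet_derivative ?h (at y)"
    using metric_on_fibre[OF F' c] unfolding off_zero_tangent_bundle_fibre[OF c] .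
  have nz: "u c \<noteq> 0" "v c \<noteq> 0" using u v tangent_eq_tzero_iff[OF _ c] by auto
  have "u c = v c"
  proof (rule legendre_injective[OF refl _ nz])
    fix x w :: "real ^ 'n" assume "x \<noteq> 0" "w \<noteq> 0"
    then have xw: "tvec_of \<A> c p x \<noteq> tzero" "tvec_of \<A> c p w \<noteq> tzero"
      using tangent_eq_tzero_iff[OF tvec_of_tangent[OF c] c] tvec_of_same[OF c] by auto
    then have "fundamental_tensor F p (tvec_of \<A> c p x) (tvec_of \<A> c p w) (tvec_of \<A> c p w) > 0"
      using F' tvec_of_tangent[OF c]
      unfolding conic_finsler_metric_def off_zero_def tangent_bundle_def by blast
    then show "halved_square_hessian ?h x w w > 0"
      using fundamental_tensor_coord[OF c tvec_of_tangent[OF c] tvec_of_tangent[OF c] tvec_of_tangent[OF c]]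
        tvec_of_same[OF c] by simp
  next
    fix w
    have "fundamental_tensor F p u u (tvec_of \<A> c p w) = fundamental_tensor F p v v (tvec_of \<A> c p w)"
      by (rule eq[OF tvec_of_tangent[OF c]])
    then show "?h (u c) * frechet_derivative ?h (at (u c)) w = ?h (v c) * frechet_derivative ?h (at (v c)) w"
      using fundamental_tensor_coord[OF c u(1) u(1) tvec_of_tangent[OF c]]
        fundamental_tensor_coord[OF c v(1) v(1) tvec_of_tangent[OF c]]
        hessian_diagonal nz tvec_of_same[OF c] by simp
  qed
  then show ?thesis by (rule tangent_eqI[OF u(1) v(1) c])
qed

text \<open>The gradients of one function with respect to \<open>Z\<close> and \<open>F\<close> determine each other: if \<open>X\<close> is
  the \<open>Z\<close>-Legendre dual of a covector \<open>\<xi>\<close>, then \<open>(Z X - \<xi> W) (X / Z X - W)\<close> is its \<open>F\<close>-Legendre dual,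
  and has \<open>F\<close>-length \<open>Z X - \<xi> W\<close>.\<close>

lemma zermelo_legendre_dual:
  assumes F: "finsler_metric \<A> F" and Z: "conic_zermelo_metric \<A> F W A Z"
    and W: "W p \<in> tangent_space \<A> p" and X: "(p, X) \<in> off_zero A"
  defines "\<xi> \<equiv> fundamental_tensor Z p X X"
  defines "y \<equiv> Z (p, X) - \<xi> (W p)"
  defines "Y \<equiv> tscale y (tadd (tscale (1 / Z (p, X)) X) (tscale (-1) (W p)))"
  shows "X \<in> tangent_space \<A> p" and "Z (p, X) > 0" and "(Z (p, X))\<^sup>2 = \<xi> X" and "y > 0"
    and "Y \<in> tangent_space \<A> p" and "Y \<noteq> tzero" and "F (p, Y) = y"
    and "\<And>v. v \<in> tangent_space \<A> p \<Longrightarrow> fundamental_tensor F p Y Y v = \<xi> v"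
proof -
  define c where "c = chart_at \<A> p"
  have c: "c \<in> charts_at \<A> p" unfolding c_def by (rule chart_at_in)
  let ?h = "\<lambda>y. F (p, tvec_of \<A> c p y)" and ?z = "\<lambda>y. Z (p, tvec_of \<A> c p y)"
  let ?h' = "\<lambda>y. frechet_derivative ?h (at y)" and ?z' = "\<lambda>y. frechet_derivative ?z (at y)"
  let ?T = "{y. (p, tvec_of \<A> c p y) \<in> off_zero A}"
  have F': "conic_finsler_metric \<A> (tangent_bundle \<A>) F" using F by (simp add: finsler_metric_def)
  have Z': "conic_finsler_metric \<A> A Z" using Z by (simp add: conic_zermelo_metric_def)
  have h: "homogeneous_on_cone (UNIV - {0}) ?h ?h'"
    using metric_on_fibre[OF F' c] unfolding off_zero_tangent_bundle_fibre[OF c] .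
  have z: "homogeneous_on_cone ?T ?z ?z'" by (rule metric_on_fibre[OF Z' c])
  interpret h: homogeneous_on_cone "UNIV - {0}" ?h ?h' by (rule h)
  interpret z: homogeneous_on_cone ?T ?z ?z' by (rule z)
  show XT: "X \<in> tangent_space \<A> p"
    using X Z' by (auto simp: conic_finsler_metric_def tm_open_def tangent_bundle_def off_zero_def)
  have tvX: "tvec_of \<A> c p (X c) = X" by (rule tvec_of_component[OF c XT])
  have x: "X c \<in> ?T" using X tvX by simp
  have F0: "F (p, tzero) = 0"
  proof -
    have "(p, tzero) \<in> tangent_bundle \<A>" using tzero_tangent by (simp add: tangent_bundle_def)
    moreover have "F (q, tscale r v) = r * F (q, v)" if "(q, v) \<in> tangent_bundle \<A>" "r > 0" for q v r
      using F' that unfolding conic_finsler_metric_def by blast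
    ultimately have "F (p, tscale 2 tzero) = 2 * F (p, tzero)" by simp
    moreover have "tscale 2 tzero = (tzero :: ('m, 'n) tvec)" by (simp add: tscale_def tzero_def)
    ultimately show ?thesis by simp
  qed
  have zrel: "Z (p, v) > 0 \<and> (p, tscale (inverse (Z (p, v))) v) \<in> zermelo_indicatrix \<A> F W"
    if "(p, v) \<in> off_zero A" for v
  proof -
    have v: "(p, v) \<in> A" "v \<noteq> tzero" using that by (auto simp: off_zero_def)
    have "\<forall>\<xi>\<in>A. Z \<xi> \<ge> 0" using Z' unfolding conic_finsler_metric_def by (elim conjE)
    then have "Z (p, v) \<ge> 0" using v(1) by (rule bspec)
    moreover have "\<forall>(p, v)\<in>A. (\<forall>r>0. Z (p, v) = r \<longleftrightarrow> (p, tscale (inverse r) v) \<in> zermelo_indicatrix \<A> F W) \<and>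
        (Z (p, v) = 0 \<longleftrightarrow> v = tzero)"
      using Z unfolding conic_zermelo_metric_def by (elim conjE)
    from bspec[OF this v(1)]
    have "\<forall>r>0. Z (p, v) = r \<longleftrightarrow> (p, tscale (inverse r) v) \<in> zermelo_indicatrix \<A> F W"
      "Z (p, v) = 0 \<longleftrightarrow> v = tzero" by simp_all
    ultimately show ?thesis using v(2) by (metis order_le_less)
  qed
  have nav: "?z y > 0" "?h ((1 / ?z y) *\<^sub>R y - W p c) = 1"
     "halved_square_hessian ?h ((1 / ?z y) *\<^sub>R y - W p c) ((1 / ?z y) *\<^sub>R y - W p c) (- W p c) < 1"
     if y: "y \<in> ?T" for y
  proof -
    have yA: "(p, tvec_of \<A> c p y) \<in> off_zero A" using y by simp
    show "?z y > 0" using zrel[OF yA] by blast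
    from zrel[OF yA] obtain u where u: "tscale (inverse (?z y)) (tvec_of \<A> c p y) = tadd u (W p)"
      "u \<in> tangent_space \<A> p" "F (p, u) = 1" "fundamental_tensor F p u u (tscale (-1) (W p)) < 1"
      unfolding zermelo_indicatrix_def by blast
    from fun_cong[OF u(1), of c] have uc: "u c = (1 / ?z y) *\<^sub>R y - W p c"
      by (simp add: tscale_def tadd_def tvec_of_same[OF c] divide_inverse algebra_simps)
    show "?h ((1 / ?z y) *\<^sub>R y - W p c) = 1"
      using u(3) tvec_of_component[OF c u(2)] by (simp add: uc)
    show "halved_square_hessian ?h ((1 / ?z y) *\<^sub>R y - W p c) ((1 / ?z y) *\<^sub>R y - W p c) (- W p c) < 1"
      using u(4) unfolding fundamental_tensor_coord[OF c u(2) u(2) tscale_tangent[OF W]] uc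
      by (simp add: tscale_def)
  qed
  define u where "u = (1 / ?z (X c)) *\<^sub>R X c - W p c"
  have zX: "?z (X c) = Z (p, X)" by (simp add: tvX)
  have uS: "u \<in> UNIV - {0}"
  proof -
    have "?h u = 1" using nav(2)[OF x] by (simp add: u_def)
    moreover have "tvec_of \<A> c p 0 = tzero"
      using tangent_eq_tzero_iff[OF tvec_of_tangent[OF c] c] tvec_of_same[OF c] by blast
    ultimately show ?thesis using F0 by auto
  qed
  have side: "halved_square_hessian ?h u u (- W p c) < 1" using nav(3)[OF x] by (simp add: u_def)
  \<comment> \<open>The differentials of \<open>F\<close> and \<open>Z\<close> at corresponding indicatrix points differ by the factor \<open>\<mu>\<close>.\<close>
  define \<mu> where "\<mu> = 1 + ?h' u (W p c)"
  have \<mu>: "\<mu> > 0" "\<And>v. ?h' u v = \<mu> * ?z' (X c) v"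
    unfolding \<mu>_def using navigation_derivative[OF h z x nav(1) nav(2) uS u_def side] by blast+
  show Zpos: "Z (p, X) > 0" using nav(1)[OF x] zX by simp
  have \<xi>: "\<xi> v = Z (p, X) * ?z' (X c) (v c)" if "v \<in> tangent_space \<A> p" for v
    unfolding \<xi>_def fundamental_tensor_coord[OF c XT XT that] z.hessian_diagonal[OF x] zX ..
  show "(Z (p, X))\<^sup>2 = \<xi> X" using \<xi>[OF XT] z.euler[OF x] zX by (simp add: power2_eq_square)
  have y: "y = Z (p, X) / \<mu>"
    using \<mu>(1) \<mu>(2)[of "W p c"] \<xi>[OF W] unfolding y_def \<mu>_def by (simp add: field_simps)
  show ypos: "y > 0" using y \<mu>(1) Zpos by simp
  show YT: "Y \<in> tangent_space \<A> p"
    unfolding Y_def by (intro tscale_tangent tadd_tangent XT W)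
  have Yc: "Y c = y *\<^sub>R u" by (simp add: Y_def u_def zX tscale_def tadd_def)
  show "Y \<noteq> tzero" using tangent_eq_tzero_iff[OF YT c] Yc ypos uS by simp
  have hY: "?h (y *\<^sub>R u) = y" using h.homogeneous[OF uS ypos] nav(2)[OF x] by (simp add: u_def)
  show "F (p, Y) = y" using hY tvec_of_component[OF c YT] Yc by simp
  show "fundamental_tensor F p Y Y v = \<xi> v" if v: "v \<in> tangent_space \<A> p" for v
    unfolding fundamental_tensor_coord[OF c YT YT v] Yc h.hessian_diagonal[OF h.cone[OF uS ypos]]
      h.deriv_scale[OF uS ypos] \<mu>(2) \<xi>[OF v] hY
    using y \<mu>(1) by simp
qed

end

section \<open>Ordinary differential equations\<close>

lemma C1_lipschitz_on_compact_convex: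
  fixes f :: "'a::euclidean_space \<Rightarrow> 'b::euclidean_space"
  assumes f: "times_differentiable_on 1 S f" and K: "compact K" "convex K" "K \<subseteq> S"
  obtains L where "L \<ge> 0" "\<And>x y. x \<in> K \<Longrightarrow> y \<in> K \<Longrightarrow> norm (f x - f y) \<le> L * norm (x - y)"
proof -
  let ?D = "\<lambda>x. frechet_derivative f (at x)"
  define n where "n x = (\<Sum>b\<in>Basis. norm (?D x b))" for x
  have der: "(f has_derivative ?D x) (at x)" if "x \<in> K" for x
    using times_differentiable_on_SucD(1)[of 0 S f x] f that K(3) by auto
  have "continuous_on S (\<lambda>x. ?D x b)" for b
    using times_differentiable_on_SucD(2)[of 0 S f b] f by simp
  then have "continuous_on K n" unfolding n_def
    using K(3) by (intro continuous_intros) (blast intro: continuous_on_subset)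
  then have "bounded (n ` K)" using K(1) by (intro compact_imp_bounded compact_continuous_image)
  then obtain L where L: "L > 0" "\<And>x. x \<in> K \<Longrightarrow> norm (n x) \<le> L"
    unfolding bounded_pos by auto
  have on: "onorm (?D x) \<le> L" if x: "x \<in> K" for x
  proof (rule onorm_le)
    fix v
    have lin: "linear (?D x)" by (rule has_derivative_linear[OF der[OF x]])
    have "?D x v = (\<Sum>b\<in>Basis. (v \<bullet> b) *\<^sub>R ?D x b)"
      using linear_sum[OF lin, of "\<lambda>b. (v \<bullet> b) *\<^sub>R b" Basis] by (simp add: linear_scale[OF lin] euclidean_representation)
    then have "norm (?D x v) \<le> (\<Sum>b\<in>Basis. \<bar>v \<bullet> b\<bar> * norm (?D x b))"
      using norm_sum[of "\<lambda>b. (v \<bullet> b) *\<^sub>R ?D x b" Basis] by simp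
    also have "\<dots> \<le> (\<Sum>b\<in>Basis. norm v * norm (?D x b))"
      by (intro sum_mono mult_right_mono Basis_le_norm) auto
    also have "\<dots> = n x * norm v" by (simp add: n_def sum_distrib_left mult.commute)
    also have "\<dots> \<le> L * norm v" using L(2)[OF x] by (intro mult_right_mono) auto
    finally show "norm (?D x v) \<le> L * norm v" .
  qed
  show ?thesis
  proof (rule that[of L])
    show "norm (f x - f y) \<le> L * norm (x - y)" if "x \<in> K" "y \<in> K" for x y
      by (rule differentiable_bound[OF K(2) _ on that]) (use der has_derivative_at_withinI in blast)
  qed (use L in simp)
qed

text \<open>Picard iteration: on bounded continuous curves, frozen outside \<open>[0, T]\<close> so that they live on the
  whole line, the integral operator is a contraction.\<close>

lemma ode_existence_lipschitz:
  fixes G :: "'a::euclidean_space \<Rightarrow> 'a"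
  assumes L: "\<And>x y. norm (G x - G y) \<le> L * norm (x - y)" and B: "\<And>x. norm (G x) \<le> B"
    and T: "T > 0" "L * T < 1" "L \<ge> 0"
  obtains \<phi> where "\<phi> 0 = x0" "\<And>t. t \<in> {0..T} \<Longrightarrow> (\<phi> has_vector_derivative G (\<phi> t)) (at t within {0..T})"
    "\<And>t. t \<in> {0..T} \<Longrightarrow> norm (\<phi> t - x0) \<le> B * T"
proof -
  define cl where "cl t = max 0 (min T t)" for t :: real
  have cl: "cl t \<in> {0..T}" "t \<in> {0..T} \<Longrightarrow> cl t = t" for t using T by (auto simp: cl_def)
  define I where "I \<phi> t = integral {0..t} (\<lambda>s. G (\<phi> s))" for \<phi> :: "real \<Rightarrow> 'a" and t
  have B0: "B \<ge> 0" using B norm_ge_zero order_trans by blast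
  have "continuous_on UNIV G"
    by (rule lipschitz_on_continuous_on[of L]) (use L T in \<open>auto simp: lipschitz_on_def dist_norm\<close>)
  then have cG: "continuous_on {0..t} (\<lambda>s. G (\<phi> s))" if "continuous_on UNIV \<phi>" for \<phi> :: "real \<Rightarrow> 'a" and t
    using continuous_on_compose2[of UNIV G "{0..t}" \<phi>] that continuous_on_subset by blast
  have IB: "norm (I \<phi> t) \<le> B * T" if \<phi>: "continuous_on UNIV \<phi>" and t: "t \<in> {0..T}" for \<phi> t
  proof -
    have "norm (I \<phi> t) \<le> B * (t - 0)"
      unfolding I_def by (rule integral_bound) (use t B cG[OF \<phi>] in auto)
    also have "\<dots> \<le> B * T" using t B0 by (auto intro: mult_left_mono)
    finally show ?thesis .
  qed
  define P where "P \<phi> = Bcontfun (\<lambda>t. x0 + I (apply_bcontfun \<phi>) (cl t))" for \<phi> :: "real \<Rightarrow>\<^sub>C 'a"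
  have P: "apply_bcontfun (P \<phi>) t = x0 + I (apply_bcontfun \<phi>) (cl t)" for \<phi> t
  proof -
    have "continuous_on {0..T} (I (apply_bcontfun \<phi>))"
      unfolding I_def by (rule indefinite_integral_continuous_1[OF integrable_continuous_real[OF cG]]) auto
    then have "continuous_on UNIV (\<lambda>t. I (apply_bcontfun \<phi>) (cl t))"
      by (rule continuous_on_compose2) (use cl in \<open>auto simp: cl_def intro!: continuous_intros\<close>)
    then have "(\<lambda>t. x0 + I (apply_bcontfun \<phi>) (cl t)) \<in> bcontfun"
    proof (intro bcontfun_normI)
      show "norm (x0 + I (apply_bcontfun \<phi>) (cl t)) \<le> norm x0 + B * T" for t
        using norm_triangle_ineq IB[OF continuous_on_apply_bcontfun cl(1)] by (meson add_left_mono order_trans)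
    qed (intro continuous_intros)
    then show ?thesis unfolding P_def by (simp add: Bcontfun_inverse)
  qed
  have "dist (P \<phi>) (P \<psi>) \<le> L * T * dist \<phi> \<psi>" for \<phi> \<psi>
  proof (rule dist_bound)
    fix t
    have c: "continuous_on {0..cl t} (\<lambda>s. G (apply_bcontfun \<phi> s))" for \<phi> by (rule cG) simp
    have "I (apply_bcontfun \<phi>) (cl t) - I (apply_bcontfun \<psi>) (cl t)
      = integral {0..cl t} (\<lambda>s. G (apply_bcontfun \<phi> s) - G (apply_bcontfun \<psi> s))"
      unfolding I_def by (intro integral_diff[symmetric] integrable_continuous_real c)
    also have "norm \<dots> \<le> (L * dist \<phi> \<psi>) * (cl t - 0)"
    proof (rule integral_bound)
      show "norm (G (apply_bcontfun \<phi> s) - G (apply_bcontfun \<psi> s)) \<le> L * dist \<phi> \<psi>" for s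
        using L[of "apply_bcontfun \<phi> s" "apply_bcontfun \<psi> s"] dist_bounded[of \<phi> s \<psi>] T(3)
          mult_left_mono[of "norm (apply_bcontfun \<phi> s - apply_bcontfun \<psi> s)" "dist \<phi> \<psi>" L]
        by (simp add: dist_norm)
    qed (use cl(1)[of t] c in \<open>auto intro!: continuous_intros\<close>)
    also have "\<dots> \<le> (L * dist \<phi> \<psi>) * T"
      using cl(1)[of t] T(3) by (intro mult_left_mono) auto
    finally show "dist (apply_bcontfun (P \<phi>) t) (apply_bcontfun (P \<psi>) t) \<le> L * T * dist \<phi> \<psi>"
      by (simp add: P dist_norm mult_ac)
  qed
  then obtain \<phi> where fixed_point: "P \<phi> = \<phi>"
    using banach_fix_type[of "L * T" P] T by (auto intro: mult_nonneg_nonneg)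
  define y where "y = apply_bcontfun \<phi>"
  have y: "y t = x0 + I y t" if "t \<in> {0..T}" for t
    using P[of \<phi> t] fixed_point cl(2)[OF that] by (simp add: y_def)
  have cy: "continuous_on UNIV y" by (simp add: y_def)
  show ?thesis
  proof (rule that[of y])
    show "y 0 = x0" using y[of 0] T by (simp add: I_def)
    show "(y has_vector_derivative G (y t)) (at t within {0..T})" if t: "t \<in> {0..T}" for t
    proof -
      have "((\<lambda>t. x0 + I y t) has_vector_derivative 0 + G (y t)) (at t within {0..T})"
        unfolding I_def
        by (intro has_vector_derivative_add has_vector_derivative_const integral_has_vector_derivative cG cy t)
      from has_vector_derivative_transform[OF t _ this, of y] show ?thesis using y by simp
    qed
    show "norm (y t - x0) \<le> B * T" if "t \<in> {0..T}" for t using y[OF that] IB[OF cy that] by simp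
  qed
qed

lemma ode_local_existence:
  fixes V :: "'a::euclidean_space \<Rightarrow> 'a"
  assumes S: "open S" "x0 \<in> S" and V: "times_differentiable_on 1 S V"
  shows "\<exists>T \<phi>. T > 0 \<and> \<phi> 0 = x0 \<and>
    (\<forall>t\<in>{0..T}. \<phi> t \<in> S \<and> (\<phi> has_vector_derivative V (\<phi> t)) (at t within {0..T}))"
proof -
  obtain r where r: "r > 0" "cball x0 r \<subseteq> S" using S open_contains_cball by blast
  let ?K = "cball x0 r"
  have K: "compact ?K" "convex ?K" "closed ?K" "?K \<noteq> {}" using r by auto
  obtain L where L: "L \<ge> 0" "\<And>x y. x \<in> ?K \<Longrightarrow> y \<in> ?K \<Longrightarrow> norm (V x - V y) \<le> L * norm (x - y)"
    using C1_lipschitz_on_compact_convex[OF V K(1,2) r(2)] by blast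
  have "bounded (V ` ?K)"
    using times_differentiable_on_continuous[OF V] r(2) K(1)
    by (blast intro: compact_imp_bounded compact_continuous_image continuous_on_subset)
  then obtain B where B: "B > 0" "\<And>x. x \<in> ?K \<Longrightarrow> norm (V x) \<le> B" unfolding bounded_pos by auto
  \<comment> \<open>Composing with the nonexpansive projection to the ball makes the field globally Lipschitz.\<close>
  define G where "G x = V (closest_point ?K x)" for x
  have cp: "closest_point ?K x \<in> ?K" for x by (rule closest_point_in_set[OF K(3,4)])
  \<comment> \<open>Too short for a curve of speed at most \<open>B\<close> to leave the ball, and short enough for a contraction.\<close>
  define T where "T = min (r / B) (1 / (L + 1))"
  have T: "T > 0" "L * T < 1" "L \<ge> 0" "B * T \<le> r"
  proof -
    show T0: "T > 0" using r B L by (simp add: T_def)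
    have "T \<le> 1 / (L + 1)" by (simp add: T_def)
    then have "T * (L + 1) \<le> 1" using L(1) by (simp add: pos_le_divide_eq)
    then show "L * T < 1" using T0 by (simp add: algebra_simps)
    have "T \<le> r / B" by (simp add: T_def)
    then show "B * T \<le> r" using B(1) by (simp add: pos_le_divide_eq mult.commute)
  qed (rule L)
  have "norm (G x - G y) \<le> L * norm (x - y)" for x y
    unfolding G_def using L(2)[OF cp cp, of x y] closest_point_lipschitz[OF K(2,3,4), of x y]
      mult_left_mono[OF _ L(1)] by (metis dist_norm order_trans)
  moreover have "norm (G x) \<le> B" for x unfolding G_def by (rule B(2)[OF cp])
  ultimately obtain \<phi> where \<phi>: "\<phi> 0 = x0"
    "\<And>t. t \<in> {0..T} \<Longrightarrow> (\<phi> has_vector_derivative G (\<phi> t)) (at t within {0..T})"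
    "\<And>t. t \<in> {0..T} \<Longrightarrow> norm (\<phi> t - x0) \<le> B * T"
    using ode_existence_lipschitz[OF _ _ T(1-3)] by blast
  have inK: "\<phi> t \<in> ?K" if "t \<in> {0..T}" for t
    using \<phi>(3)[OF that] T(4) by (simp add: dist_norm norm_minus_commute)
  show ?thesis
  proof (intro exI[of _ T] exI[of _ \<phi>] conjI ballI)
    show "\<phi> t \<in> S" if "t \<in> {0..T}" for t using inK[OF that] r(2) by blast
    show "(\<phi> has_vector_derivative V (\<phi> t)) (at t within {0..T})" if "t \<in> {0..T}" for t
      using \<phi>(2)[OF that] closest_point_self[OF inK[OF that]] by (simp add: G_def)
  qed (fact T(1) \<phi>(1))+
qed

text \<open>Two solutions with the same start sweep out an interval on which \<open>w\<close> is Lipschitz, and the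
  squared distance, discounted exponentially, decreases.\<close>

lemma scalar_ode_unique:
  fixes w y\<^sub>1 y\<^sub>2 :: "real \<Rightarrow> real"
  assumes w: "times_differentiable_on 1 S w"
    and y1: "\<And>s. s \<in> {0..1} \<Longrightarrow> y\<^sub>1 s \<in> S"
      "\<And>s. s \<in> {0..1} \<Longrightarrow> (y\<^sub>1 has_real_derivative c * w (y\<^sub>1 s)) (at s within {0..1})"
    and y2: "\<And>s. s \<in> {0..1} \<Longrightarrow> y\<^sub>2 s \<in> S"
      "\<And>s. s \<in> {0..1} \<Longrightarrow> (y\<^sub>2 has_real_derivative c * w (y\<^sub>2 s)) (at s within {0..1})"
    and start: "y\<^sub>1 0 = y\<^sub>2 0"
  shows "y\<^sub>1 1 = y\<^sub>2 1"
proof -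
  let ?K = "y\<^sub>1 ` {0..1} \<union> y\<^sub>2 ` {0..1}"
  have cont: "continuous_on {0..1} y\<^sub>1" "continuous_on {0..1} y\<^sub>2"
    by (rule DERIV_continuous_on[OF y1(2)] DERIV_continuous_on[OF y2(2)], assumption)+
  have "y\<^sub>1 0 \<in> y\<^sub>1 ` {0..1}" "y\<^sub>2 0 \<in> y\<^sub>2 ` {0..1}" by auto
  then have "y\<^sub>1 ` {0..1} \<inter> y\<^sub>2 ` {0..1} \<noteq> {}" unfolding start by blast
  then have "connected ?K"
    by (intro connected_Un connected_continuous_image cont) simp_all
  then have K: "convex ?K" by (simp add: connected_convex_1)
  have "compact ?K" by (intro compact_Un compact_continuous_image cont) auto
  moreover have "?K \<subseteq> S" using y1(1) y2(1) by auto
  ultimately obtain L where L: "L \<ge> 0"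
    "\<And>x y. x \<in> ?K \<Longrightarrow> y \<in> ?K \<Longrightarrow> norm (w x - w y) \<le> L * norm (x - y)"
    using C1_lipschitz_on_compact_convex[OF w _ K] by blast
  define k where "k = 2 * \<bar>c\<bar> * L"
  define E where "E s = (y\<^sub>1 s - y\<^sub>2 s)\<^sup>2 * exp (- k * s)" for s
  define E' where "E' s = (2 * c * (y\<^sub>1 s - y\<^sub>2 s) * (w (y\<^sub>1 s) - w (y\<^sub>2 s)) - k * (y\<^sub>1 s - y\<^sub>2 s)\<^sup>2) * exp (- k * s)" for s
  have "(E has_real_derivative E' s) (at s within {0..1})" if "s \<in> {0..1}" for s
    unfolding E_def E'_def
    by (rule derivative_eq_intros y1(2)[OF that] y2(2)[OF that] refl)+ (simp add: algebra_simps power2_eq_square)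
  then have "(E has_derivative (*) (E' s)) (at s within {0..1})" if "0 \<le> s" "s \<le> 1" for s
    using that by (simp add: has_field_derivative_def)
  from mvt_very_simple[OF _ this] obtain s where s: "s \<in> {0..1}" "E 1 - E 0 = E' s" by auto
  have "c * (y\<^sub>1 s - y\<^sub>2 s) * (w (y\<^sub>1 s) - w (y\<^sub>2 s)) \<le> \<bar>c\<bar> * \<bar>y\<^sub>1 s - y\<^sub>2 s\<bar> * \<bar>w (y\<^sub>1 s) - w (y\<^sub>2 s)\<bar>"
    by (metis abs_ge_self abs_mult)
  also have "\<dots> \<le> \<bar>c\<bar> * \<bar>y\<^sub>1 s - y\<^sub>2 s\<bar> * (L * \<bar>y\<^sub>1 s - y\<^sub>2 s\<bar>)"
    using L(2)[of "y\<^sub>1 s" "y\<^sub>2 s"] s by (intro mult_left_mono) auto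
  also have "\<dots> = \<bar>c\<bar> * L * (y\<^sub>1 s - y\<^sub>2 s)\<^sup>2" by (simp add: power2_eq_square)
  finally have "E' s \<le> 0" unfolding E'_def k_def by (intro mult_nonpos_nonneg) (auto simp: algebra_simps)
  moreover have "E 0 = 0" using start by (simp add: E_def)
  ultimately have "E 1 \<le> 0" using s by simp
  then have "(y\<^sub>1 1 - y\<^sub>2 1)\<^sup>2 \<le> 0" unfolding E_def by (simp add: mult_le_0_iff not_le)
  then show ?thesis by simp
qed

section \<open>Projectability of a vector field through its differential\<close>

context manifold_atlas
begin

text \<open>Projectability of a vector field speaks about all integral curves; it has consequences only
  because there is one through every point.\<close>

lemma integral_curve_exists:
  assumes W: "smooth_vector_field \<A> UNIV W" and V: "open V" "p \<in> V"
  shows "\<exists>T \<gamma>. T > 0 \<and> \<gamma> 0 = p \<and> (\<forall>t\<in>{0..T}. integral_curve \<A> V W \<gamma> t)"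
proof -
  define c where "c = chart_at \<A> p"
  have c: "c \<in> charts_at \<A> p" unfolding c_def by (rule chart_at_in)
  have cA: "c \<in> \<A>" "p \<in> cdom c" using charts_atD[OF c] by auto
  let ?S = "cmap c ` (cdom c \<inter> V)"
  have S: "open ?S" "cmap c p \<in> ?S" using open_chart_image[OF cA(1) V(1)] cA V by auto
  have "smooth_on ?S (\<lambda>x. W (cinv c x) c)"
    by (rule smooth_on_subset[OF smooth_vector_fieldD(2)[OF W cA(1)]]) auto
  then have "times_differentiable_on 1 ?S (\<lambda>x. W (cinv c x) c)" unfolding smooth_on_def by blast
  from ode_local_existence[OF S this] obtain T \<phi> where T: "T > 0" and \<phi>: "\<phi> 0 = cmap c p"
    "\<And>t. t \<in> {0..T} \<Longrightarrow> \<phi> t \<in> ?S"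
    "\<And>t. t \<in> {0..T} \<Longrightarrow> (\<phi> has_vector_derivative W (cinv c (\<phi> t)) c) (at t within {0..T})"
    by blast
  define \<gamma> where "\<gamma> = cinv c \<circ> \<phi>"
  have \<gamma>c: "\<gamma> t \<in> cdom c" "\<gamma> t \<in> V" "cmap c (\<gamma> t) = \<phi> t" if "t \<in> {0..T}" for t
  proof -
    have "\<phi> t \<in> cmap c ` cdom c" using \<phi>(2)[OF that] by blast
    then show "\<gamma> t \<in> cdom c" "cmap c (\<gamma> t) = \<phi> t" unfolding \<gamma>_def
      using cinv_in_cdom[OF cA(1)] cmap_cinv[OF cA(1)] by auto
    show "\<gamma> t \<in> V" using \<phi>(2)[OF that] chart_image_iff[OF cA(1)] by (simp add: \<gamma>_def)
  qed
  have "integral_curve \<A> V W \<gamma> t" if t: "t \<in> {0..T}" for t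
  proof -
    have seg: "closed_segment 0 t = {0..t}" using t by (simp add: closed_segment_eq_real_ivl)
    have sub: "s \<in> {0..T}" if "s \<in> {0..t}" for s using t that by auto
    have d\<phi>: "(\<phi> has_vector_derivative W (\<gamma> s) c) (at s within {0..t})" if "s \<in> {0..t}" for s
      using has_vector_derivative_within_subset[OF \<phi>(3)[OF sub[OF that]], of "{0..t}"] t by (auto simp: \<gamma>_def)
    have "continuous_on {0..t} \<phi>"
      using d\<phi> by (meson continuous_on_eq_continuous_within has_vector_derivative_continuous)
    moreover have "continuous_on (cmap c ` cdom c) (cinv c)"
      using chart_homeomorphism[OF cA(1)] homeomorphism_def by blast
    moreover have "\<phi> ` {0..t} \<subseteq> cmap c ` cdom c" using \<phi>(2) sub by blast
    ultimately have "continuous_on {0..t} \<gamma>"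
      unfolding \<gamma>_def by (intro continuous_on_compose) (auto intro: continuous_on_subset)
    moreover have "\<gamma> ` {0..t} \<subseteq> V" using \<gamma>c(2) sub by blast
    moreover have "((cmap d \<circ> \<gamma>) has_vector_derivative W (\<gamma> s) d) (at s within {0..t})"
      if s: "s \<in> {0..t}" and d: "d \<in> charts_at \<A> (\<gamma> s)" for s d
    proof -
      have cs: "c \<in> charts_at \<A> (\<gamma> s)" using cA \<gamma>c(1)[OF sub[OF s]] by (simp add: charts_at_def)
      have "(cmap d \<circ> cinv c has_derivative transition_deriv c d (\<gamma> s)) (at (\<phi> s) within \<phi> ` {0..t})"
        using has_derivative_transition[OF cs d] \<gamma>c(3)[OF sub[OF s]] by (simp add: has_derivative_at_withinI)
      from vector_derivative_diff_chain_within[OF d\<phi>[OF s] this]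
      have "((cmap d \<circ> cinv c \<circ> \<phi>) has_vector_derivative W (\<gamma> s) d) (at s within {0..t})"
        unfolding tangent_transition[OF smooth_vector_fieldD(1)[OF W UNIV_I] cs d] .
      moreover have "cmap d \<circ> cinv c \<circ> \<phi> = cmap d \<circ> \<gamma>" unfolding \<gamma>_def by (rule o_assoc[symmetric])
      ultimately show ?thesis by (simp only:)
    qed
    ultimately show ?thesis unfolding integral_curve_def seg by blast
  qed
  moreover have "\<gamma> 0 = p" using \<phi>(1) cinv_cmap[OF cA] by (simp add: \<gamma>_def)
  ultimately show ?thesis using T by blast
qed

lemma smooth_fun_along_integral_curve:
  assumes V: "open V" and f: "smooth_fun \<A> V f" and X: "\<And>p. p \<in> V \<Longrightarrow> X p \<in> tangent_space \<A> p"
    and \<gamma>: "integral_curve \<A> V X \<gamma> t" and s: "s \<in> closed_segment 0 t"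
  shows "((\<lambda>s. f (\<gamma> s)) has_real_derivative differential \<A> f (\<gamma> s) (X (\<gamma> s))) (at s within closed_segment 0 t)"
proof -
  let ?I = "closed_segment 0 t"
  define c where "c = chart_at \<A> (\<gamma> s)"
  have c: "c \<in> charts_at \<A> (\<gamma> s)" unfolding c_def by (rule chart_at_in)
  have cA: "c \<in> \<A>" "\<gamma> s \<in> cdom c" using charts_atD[OF c] by auto
  have \<gamma>V: "\<gamma> s \<in> V" and d\<gamma>: "((cmap c \<circ> \<gamma>) has_vector_derivative X (\<gamma> s) c) (at s within ?I)"
    and cont: "continuous_on ?I \<gamma>"
    using \<gamma> s c unfolding integral_curve_def by blast+
  have "(f \<circ> cinv c has_derivative frechet_derivative (f \<circ> cinv c) (at (cmap c (\<gamma> s))))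
      (at ((cmap c \<circ> \<gamma>) s) within (cmap c \<circ> \<gamma>) ` ?I)"
    using smooth_fun_has_derivative[OF f c \<gamma>V] by (simp add: has_derivative_at_withinI)
  from vector_derivative_diff_chain_within[OF d\<gamma> this]
  have "((f \<circ> cinv c \<circ> (cmap c \<circ> \<gamma>)) has_vector_derivative differential \<A> f (\<gamma> s) (X (\<gamma> s))) (at s within ?I)"
    unfolding smooth_differential_chart[OF f \<gamma>V c X[OF \<gamma>V]] .
  then have "((f \<circ> cinv c \<circ> (cmap c \<circ> \<gamma>)) has_derivative (\<lambda>h. h *\<^sub>R differential \<A> f (\<gamma> s) (X (\<gamma> s)))) (at s within ?I)"
    by (simp add: has_vector_derivative_def)
  then have "((\<lambda>s. f (\<gamma> s)) has_derivative (\<lambda>h. h *\<^sub>R differential \<A> f (\<gamma> s) (X (\<gamma> s)))) (at s within ?I)"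
  proof (rule has_derivative_transform_eventually[OF _ _ _ s])
    have "(\<gamma> \<longlongrightarrow> \<gamma> s) (at s within ?I)" using cont s by (simp add: continuous_on_def)
    then have "\<forall>\<^sub>F x in at s within ?I. \<gamma> x \<in> cdom c"
      by (rule topological_tendstoD) (use chart_homeomorphism[OF cA(1)] cA in blast)+
    then show "\<forall>\<^sub>F x in at s within ?I. (f \<circ> cinv c \<circ> (cmap c \<circ> \<gamma>)) x = f (\<gamma> x)"
      by eventually_elim (simp add: cinv_cmap[OF cA(1)])
    show "(f \<circ> cinv c \<circ> (cmap c \<circ> \<gamma>)) s = f (\<gamma> s)" by (simp add: cinv_cmap[OF cA])
  qed
  then show ?thesis by (simp add: has_field_derivative_def mult_commute_abs)
qed

text \<open>Integral curves of \<open>W\<close> from two points of one level set pass through the same level sets at the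
  same times, so \<open>f\<close> has the same derivative along both at time \<open>0\<close>.\<close>

lemma projectable_differential:
  assumes R: "open R" and f: "smooth_fun \<A> R f" and W: "smooth_vector_field \<A> UNIV W"
    and proj: "projectable_vf \<A> R f W"
  shows "projectable_fun R f (\<lambda>p. differential \<A> f p (W p))"
  unfolding projectable_fun_def
proof (intro ballI impI)
  fix p q assume p: "p \<in> R" and q: "q \<in> R" and fpq: "f p = f q"
  obtain T \<gamma> where \<gamma>: "T > 0" "\<gamma> 0 = p" "\<And>t. t \<in> {0..T} \<Longrightarrow> integral_curve \<A> R W \<gamma> t"
    using integral_curve_exists[OF W R p] by blast
  obtain T' \<delta> where \<delta>: "T' > 0" "\<delta> 0 = q" "\<And>t. t \<in> {0..T'} \<Longrightarrow> integral_curve \<A> R W \<delta> t"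
    using integral_curve_exists[OF W R q] by blast
  define t where "t = min T T'"
  have t: "t > 0" using \<gamma>(1) \<delta>(1) by (simp add: t_def)
  have seg: "closed_segment 0 t = {0..t}" using t by (simp add: closed_segment_eq_real_ivl)
  have ic: "integral_curve \<A> R W \<gamma> s" "integral_curve \<A> R W \<delta> s" if "s \<in> {0..t}" for s
    using \<gamma>(3) \<delta>(3) that by (auto simp: t_def)
  have agree: "f (\<gamma> s) = f (\<delta> s)" if "s \<in> {0..t}" for s
    using proj ic[OF that] \<gamma>(2) \<delta>(2) fpq unfolding projectable_vf_def by metis
  have W': "\<And>p. p \<in> R \<Longrightarrow> W p \<in> tangent_space \<A> p" using smooth_vector_fieldD(1)[OF W] by blast
  have 0: "0 \<in> {0..t}" and tt: "t \<in> {0..t}" using t by auto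
  have "((\<lambda>s. f (\<gamma> s)) has_vector_derivative differential \<A> f p (W p)) (at 0 within {0..t})"
    using smooth_fun_along_integral_curve[OF R f W' ic(1)[OF tt], of 0] \<gamma>(2)
    unfolding seg has_real_derivative_iff_has_vector_derivative using 0 by simp
  moreover have "((\<lambda>s. f (\<delta> s)) has_vector_derivative differential \<A> f q (W q)) (at 0 within {0..t})"
    using smooth_fun_along_integral_curve[OF R f W' ic(2)[OF tt], of 0] \<delta>(2)
    unfolding seg has_real_derivative_iff_has_vector_derivative using 0 by simp
  then have "((\<lambda>s. f (\<gamma> s)) has_vector_derivative differential \<A> f q (W q)) (at 0 within {0..t})"
    by (rule has_vector_derivative_transform[OF 0, rotated]) (use agree in auto)
  ultimately show "differential \<A> f p (W p) = differential \<A> f q (W q)"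
    using vector_derivative_unique_within_closed_interval[of 0 t 0] t 0 by auto
qed

text \<open>If \<open>df(W) = w \<circ> f\<close> then \<open>f\<close> along any integral curve solves \<open>y' = w(y)\<close>, and its final value is
  determined by its initial value. Rescaling time to \<open>[0, 1]\<close> treats both signs of \<open>t\<close> at once.\<close>

lemma projectable_vf_if_differential:
  assumes R: "open R" and f: "smooth_fun \<A> R f" and W: "smooth_vector_field \<A> UNIV W"
    and w: "times_differentiable_on 1 (f ` R) w"
    and df: "\<And>p. p \<in> R \<Longrightarrow> differential \<A> f p (W p) = w (f p)"
  shows "projectable_vf \<A> R f W"
  unfolding projectable_vf_def
proof (intro allI impI, elim conjE)
  fix t \<gamma> \<delta>
  assume \<gamma>: "integral_curve \<A> R W \<gamma> t" and \<delta>: "integral_curve \<A> R W \<delta> t" and start: "f (\<gamma> 0) = f (\<delta> 0)"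
  have W': "\<And>p. p \<in> R \<Longrightarrow> W p \<in> tangent_space \<A> p" using smooth_vector_fieldD(1)[OF W] by blast
  have img: "(\<lambda>s. s * t) ` {0..1} = closed_segment 0 t"
    by (auto simp: closed_segment_def)
  have sol: "f (\<gamma> (s * t)) \<in> f ` R"
    "((\<lambda>s. f (\<gamma> (s * t))) has_real_derivative t * w (f (\<gamma> (s * t)))) (at s within {0..1})"
    if \<gamma>: "integral_curve \<A> R W \<gamma> t" and s: "s \<in> {0..1}" for \<gamma> s
  proof -
    have st: "s * t \<in> closed_segment 0 t" using s img by blast
    then have R': "\<gamma> (s * t) \<in> R" using \<gamma> unfolding integral_curve_def by blast
    then show "f (\<gamma> (s * t)) \<in> f ` R" by blast
    have "((\<lambda>s. f (\<gamma> s)) has_real_derivative w (f (\<gamma> (s * t)))) (at (s * t) within (\<lambda>s. s * t) ` {0..1})"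
      using smooth_fun_along_integral_curve[OF R f W' \<gamma> st] df[OF R'] img by simp
    moreover have "((\<lambda>s. s * t) has_real_derivative t) (at s within {0..1})"
      by (auto intro!: derivative_eq_intros)
    ultimately have "((\<lambda>s. f (\<gamma> s)) \<circ> (\<lambda>s. s * t) has_real_derivative w (f (\<gamma> (s * t))) * t) (at s within {0..1})"
      by (rule DERIV_image_chain)
    then show "((\<lambda>s. f (\<gamma> (s * t))) has_real_derivative t * w (f (\<gamma> (s * t)))) (at s within {0..1})"
      by (simp add: o_def mult.commute)
  qed
  have "f (\<gamma> (1 * t)) = f (\<delta> (1 * t))"
    by (rule scalar_ode_unique[OF w sol(1)[OF \<gamma>] sol(2)[OF \<gamma>] sol(1)[OF \<delta>] sol(2)[OF \<delta>]])
      (use start in auto)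
  then show "f (\<gamma> t) = f (\<delta> t)" by simp
qed

end

section \<open>Functions constant on the level sets of a submersion\<close>

context manifold_atlas
begin

text \<open>Along a coordinate line on which \<open>f\<close> has nonzero derivative, \<open>f\<close> is locally invertible.\<close>

lemma local_section:
  assumes U: "open U" and f: "smooth_fun \<A> U f" and p: "p \<in> regular_set \<A> U f"
  shows "\<exists>c I \<sigma>. c \<in> charts_at \<A> p \<and> open I \<and> f p \<in> I \<and> \<sigma> (f p) = p \<and>
    (\<forall>t\<in>I. \<sigma> t \<in> cdom c \<and> \<sigma> t \<in> regular_set \<A> U f \<and> f (\<sigma> t) = t) \<and>
    (\<lambda>t. cmap c (\<sigma> t)) differentiable (at (f p))"
proof -
  let ?R = "regular_set \<A> U f"
  define c where "c = chart_at \<A> p"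
  have c: "c \<in> charts_at \<A> p" unfolding c_def by (rule chart_at_in)
  have cA: "c \<in> \<A>" "p \<in> cdom c" using charts_atD[OF c] by auto
  define x where "x = cmap c p"
  have px: "cinv c x = p" unfolding x_def by (rule cinv_cmap[OF cA])
  let ?S = "cmap c ` (cdom c \<inter> ?R)"
  have S: "open ?S" by (rule open_chart_image[OF cA(1) open_regular_set[OF f U]])
  have xS: "x \<in> ?S" using cA p by (simp add: x_def)
  have smf: "smooth_on ?S (f \<circ> cinv c)"
    by (rule smooth_on_subset[OF smooth_funD[OF f cA(1)]]) (auto simp: regular_set_def)
  obtain i where i: "frechet_derivative (f \<circ> cinv c) (at x) (axis i 1) \<noteq> 0"
    using p regular_set_chart_iff[OF f c] unfolding x_def by blast
  define v :: "real ^ 'n" where "v = axis i 1"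
  define g where "g s = (f \<circ> cinv c) (x + s *\<^sub>R v)" for s :: real
  define g' where "g' s = frechet_derivative (f \<circ> cinv c) (at (x + s *\<^sub>R v)) v" for s :: real
  let ?J = "{s. x + s *\<^sub>R v \<in> ?S}"
  have J: "open ?J" "0 \<in> ?J" using open_line_preimage[OF S] xS by auto
  have bl: "blinfun_apply (a *\<^sub>R id_blinfun) = (\<lambda>s. s * a)" for a :: real
    by (rule ext) (simp add: blinfun.scaleR_left)
  have dg: "(g has_derivative blinfun_apply (g' s *\<^sub>R id_blinfun)) (at s)" if "s \<in> ?J" for s
    using has_vector_derivative_along_line[OF smooth_on_has_derivative[OF smf], of x s v] that
    unfolding g_def g'_def has_vector_derivative_def bl by simp
  have "continuous_on ?S (\<lambda>y. frechet_derivative (f \<circ> cinv c) (at y) v)"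
    by (rule smooth_on_continuous[OF smooth_on_frechet_derivative[OF smf]])
  then have "continuous_on ?J g'" unfolding g'_def
    by (rule continuous_on_compose2) (auto intro!: continuous_intros)
  then have cg: "continuous_on ?J (\<lambda>s. g' s *\<^sub>R (id_blinfun :: real \<Rightarrow>\<^sub>L real))" by (intro continuous_intros)
  have "g' 0 \<noteq> 0" using i by (simp add: g'_def v_def)
  then have "((1 / g' 0) *\<^sub>R id_blinfun) o\<^sub>L (g' 0 *\<^sub>R id_blinfun) = (id_blinfun :: real \<Rightarrow>\<^sub>L real)"
    by (intro blinfun_eqI) (simp add: blinfun.scaleR_left)
  from inverse_function_theorem[OF J(1) dg cg J(2) this]
  obtain J' I \<tau> \<tau>' where J': "J' \<subseteq> ?J" "0 \<in> J'" and I: "open I" "g 0 \<in> I" and hom: "homeomorphism J' I g \<tau>"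
    and d\<tau>: "\<And>y. y \<in> I \<Longrightarrow> (\<tau> has_derivative \<tau>' y) (at y)"
    by metis
  have g0: "g 0 = f p" by (simp add: g_def px)
  have \<tau>: "\<tau> t \<in> ?J" "g (\<tau> t) = t" if "t \<in> I" for t
    using hom J'(1) that homeomorphism_image2[OF hom] homeomorphism_apply2[OF hom] by blast+
  have \<tau>0: "\<tau> (f p) = 0" using homeomorphism_apply1[OF hom J'(2)] g0 by simp
  define \<sigma> where "\<sigma> t = cinv c (x + \<tau> t *\<^sub>R v)" for t
  have \<sigma>: "\<sigma> t \<in> cdom c \<and> \<sigma> t \<in> ?R \<and> f (\<sigma> t) = t" "cmap c (\<sigma> t) = x + \<tau> t *\<^sub>R v" if "t \<in> I" for t
  proof -
    have in_S: "x + \<tau> t *\<^sub>R v \<in> ?S" using \<tau>(1)[OF that] by simp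
    then have "x + \<tau> t *\<^sub>R v \<in> cmap c ` cdom c" "\<sigma> t \<in> ?R"
      using chart_image_iff[OF cA(1)] by (auto simp: \<sigma>_def)
    then show "\<sigma> t \<in> cdom c \<and> \<sigma> t \<in> ?R \<and> f (\<sigma> t) = t" "cmap c (\<sigma> t) = x + \<tau> t *\<^sub>R v"
      using cinv_in_cdom[OF cA(1)] cmap_cinv[OF cA(1)] \<tau>(2)[OF that] by (auto simp: \<sigma>_def g_def)
  qed
  have "((\<lambda>t. x + \<tau> t *\<^sub>R v) has_derivative (\<lambda>h. 0 + \<tau>' (f p) h *\<^sub>R v)) (at (f p))"
    using d\<tau>[OF I(2)] unfolding g0
    by (intro has_derivative_add has_derivative_const has_derivative_scaleR_left)
  then have "((\<lambda>t. cmap c (\<sigma> t)) has_derivative (\<lambda>h. 0 + \<tau>' (f p) h *\<^sub>R v)) (at (f p))"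
    by (rule has_derivative_transform_within_open[OF _ I(1)]) (use I(2) g0 \<sigma>(2) in auto)
  then have "(\<lambda>t. cmap c (\<sigma> t)) differentiable (at (f p))" unfolding differentiable_def by blast
  moreover have "\<sigma> (f p) = p" by (simp add: \<sigma>_def \<tau>0 px)
  ultimately show ?thesis using c I g0 \<sigma>(1) by metis
qed

lemma open_image_regular_set:
  assumes "open U" "smooth_fun \<A> U f" shows "open (f ` regular_set \<A> U f)"
proof (rule Topological_Spaces.openI)
  fix t assume "t \<in> f ` regular_set \<A> U f"
  then obtain p where p: "p \<in> regular_set \<A> U f" "t = f p" by blast
  obtain I \<sigma> where "open I" "f p \<in> I" "\<forall>t\<in>I. \<sigma> t \<in> regular_set \<A> U f \<and> f (\<sigma> t) = t"
    using local_section[OF assms p(1)] by blast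
  then show "\<exists>T. open T \<and> t \<in> T \<and> T \<subseteq> f ` regular_set \<A> U f"
    using p(2) by (intro exI[of _ I]) (metis imageI subsetI)
qed

text \<open>Near \<open>f p\<close> the function \<open>\<phi>\<close> is the composition of \<open>h\<close> with a differentiable local section of \<open>f\<close>.\<close>

lemma descent_differentiable:
  assumes U: "open U" and f: "smooth_fun \<A> U f" and h: "smooth_fun \<A> (regular_set \<A> U f) h"
    and \<phi>: "\<And>p. p \<in> regular_set \<A> U f \<Longrightarrow> h p = \<phi> (f p)" and p: "p \<in> regular_set \<A> U f"
  shows "(\<phi> has_real_derivative deriv \<phi> (f p)) (at (f p))"
proof -
  obtain c I \<sigma> where c: "c \<in> charts_at \<A> p" and I: "open I" "f p \<in> I" and \<sigma>p: "\<sigma> (f p) = p"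
    and \<sigma>: "\<forall>t\<in>I. \<sigma> t \<in> cdom c \<and> \<sigma> t \<in> regular_set \<A> U f \<and> f (\<sigma> t) = t"
    and d\<sigma>: "(\<lambda>t. cmap c (\<sigma> t)) differentiable (at (f p))"
    using local_section[OF U f p] by blast
  have cA: "c \<in> \<A>" using charts_atD[OF c] by blast
  obtain \<sigma>' where \<sigma>': "((\<lambda>t. cmap c (\<sigma> t)) has_derivative \<sigma>') (at (f p))"
    using d\<sigma> unfolding differentiable_def by blast
  have "((\<lambda>t. (h \<circ> cinv c) (cmap c (\<sigma> t))) has_derivative
      (\<lambda>v. frechet_derivative (h \<circ> cinv c) (at (cmap c p)) (\<sigma>' v))) (at (f p))"
    by (rule has_derivative_compose[OF \<sigma>']) (use smooth_fun_has_derivative[OF h c p] in \<open>simp only: \<sigma>p\<close>)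
  then have "(\<phi> has_derivative (\<lambda>v. frechet_derivative (h \<circ> cinv c) (at (cmap c p)) (\<sigma>' v))) (at (f p))"
  proof (rule has_derivative_transform_within_open[OF _ I])
    fix t assume "t \<in> I"
    then have "\<sigma> t \<in> cdom c" "\<sigma> t \<in> regular_set \<A> U f" "f (\<sigma> t) = t" using \<sigma> by blast+
    then show "(h \<circ> cinv c) (cmap c (\<sigma> t)) = \<phi> t" using \<phi>[of "\<sigma> t"] cinv_cmap[OF cA, of "\<sigma> t"] by simp
  qed
  then have "\<phi> differentiable (at (f p))" unfolding differentiable_def by blast
  then show ?thesis by (simp add: DERIV_deriv_iff_real_differentiable)
qed

lemma descent_chain_rule:
  assumes U: "open U" and f: "smooth_fun \<A> U f" and h: "smooth_fun \<A> (regular_set \<A> U f) h"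
    and \<phi>: "\<And>p. p \<in> regular_set \<A> U f \<Longrightarrow> h p = \<phi> (f p)" and p: "p \<in> regular_set \<A> U f"
    and c: "c \<in> charts_at \<A> p"
  shows "frechet_derivative (h \<circ> cinv c) (at (cmap c p)) v
    = deriv \<phi> (f p) * frechet_derivative (f \<circ> cinv c) (at (cmap c p)) v"
proof -
  have cA: "c \<in> \<A>" "p \<in> cdom c" using charts_atD[OF c] by auto
  have pU: "p \<in> U" using p by (simp add: regular_set_def)
  let ?S = "cmap c ` (cdom c \<inter> regular_set \<A> U f)"
  have S: "open ?S" by (rule open_chart_image[OF cA(1) open_regular_set[OF f U]])
  have pS: "cmap c p \<in> ?S" using cA p by blast
  have "(\<phi> has_derivative (*) (deriv \<phi> (f p))) (at ((f \<circ> cinv c) (cmap c p)))"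
    using descent_differentiable[OF U f h \<phi> p] cinv_cmap[OF cA] by (simp add: has_field_derivative_def)
  from has_derivative_compose[OF smooth_fun_has_derivative[OF f c pU] this]
  have "((\<lambda>x. \<phi> ((f \<circ> cinv c) x)) has_derivative
     (\<lambda>v. deriv \<phi> (f p) * frechet_derivative (f \<circ> cinv c) (at (cmap c p)) v)) (at (cmap c p))" .
  then have "(h \<circ> cinv c has_derivative
     (\<lambda>v. deriv \<phi> (f p) * frechet_derivative (f \<circ> cinv c) (at (cmap c p)) v)) (at (cmap c p))"
  proof (rule has_derivative_transform_within_open[OF _ S pS])
    fix x assume "x \<in> ?S"
    then have "cinv c x \<in> regular_set \<A> U f" using chart_image_iff[OF cA(1)] by blast
    then show "\<phi> ((f \<circ> cinv c) x) = (h \<circ> cinv c) x" using \<phi> by simp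
  qed
  from frechet_derivative_eqI[OF this] show ?thesis by simp
qed

text \<open>If \<open>h = \<phi> \<circ> f\<close> is smooth then so is \<open>\<phi>' \<circ> f\<close>, being the quotient of the products of the coordinate
  gradients \<open>\<nabla>h \<bullet> \<nabla>f\<close> and \<open>\<nabla>f \<bullet> \<nabla>f\<close>. So differentiability of \<open>\<phi>\<close> can be iterated.\<close>

lemma descent_smooth:
  assumes U: "open U" and f: "smooth_fun \<A> U f" and h: "smooth_fun \<A> (regular_set \<A> U f) h"
    and \<phi>: "\<And>p. p \<in> regular_set \<A> U f \<Longrightarrow> h p = \<phi> (f p)"
  shows "smooth_on (f ` regular_set \<A> U f) \<phi>"
proof -
  let ?R = "regular_set \<A> U f"
  have R: "open ?R" by (rule open_regular_set[OF f U])
  have fR: "smooth_fun \<A> ?R f" by (rule smooth_fun_subset[OF f]) (auto simp: regular_set_def)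
  have o: "open (f ` ?R)" by (rule open_image_regular_set[OF U f])
  have "times_differentiable_on k (f ` ?R) \<phi>" for k
    using h \<phi>
  proof (induction k arbitrary: h \<phi>)
    case 0
    have "isCont \<phi> t" if "t \<in> f ` ?R" for t
      using that DERIV_isCont[OF descent_differentiable[OF U f 0]] by blast
    then show ?case by (simp add: continuous_at_imp_continuous_on)
  next
    case (Suc k)
    let ?D = "\<lambda>k c x i. frechet_derivative (k \<circ> cinv c) (at x) (axis i 1)"
    have sm: "smooth_fun \<A> ?R (\<lambda>p. deriv \<phi> (f p))"
    proof (rule smooth_fun_chartI[OF R])
      fix c assume c: "c \<in> \<A>"
      note oc = open_chart_image[OF c R]
      show "smooth_on (cmap c ` (cdom c \<inter> ?R))
        (\<lambda>x. (\<Sum>i\<in>UNIV. ?D h c x i * ?D f c x i) / (\<Sum>i\<in>UNIV. ?D f c x i * ?D f c x i))"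
      proof (intro smooth_on_divide smooth_on_sum smooth_on_mult smooth_on_frechet_derivative
          smooth_funD[OF fR c] smooth_funD[OF Suc.prems(1) c] oc)
        fix x assume "x \<in> cmap c ` (cdom c \<inter> ?R)"
        then obtain p where p: "p \<in> cdom c" "p \<in> ?R" "x = cmap c p" by blast
        then obtain i where "?D f c x i \<noteq> 0"
          using regular_set_chart_iff[OF f, of c p] c by (auto simp: charts_at_def)
        then have "(\<Sum>i\<in>UNIV. ?D f c x i * ?D f c x i) > 0"
          by (intro sum_pos2[of UNIV i]) (simp_all add: zero_less_mult_iff linorder_neq_iff disj_commute)
        then show "(\<Sum>i\<in>UNIV. ?D f c x i * ?D f c x i) \<noteq> 0" by simp
      qed
    next
      fix c p assume c: "c \<in> charts_at \<A> p" and p: "p \<in> ?R"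
      let ?x = "cmap c p"
      obtain i where "?D f c ?x i \<noteq> 0" using regular_set_chart_iff[OF f c] p by blast
      then have pos: "(\<Sum>i\<in>UNIV. ?D f c ?x i * ?D f c ?x i) > 0"
        by (intro sum_pos2[of UNIV i]) (simp_all add: zero_less_mult_iff linorder_neq_iff disj_commute)
      have chain: "?D h c ?x i = deriv \<phi> (f p) * ?D f c ?x i" for i
        by (rule descent_chain_rule[OF U f Suc.prems p c])
      have "(\<Sum>i\<in>UNIV. ?D h c ?x i * ?D f c ?x i) = deriv \<phi> (f p) * (\<Sum>i\<in>UNIV. ?D f c ?x i * ?D f c ?x i)"
        by (simp add: chain sum_distrib_left mult.assoc)
      then show "deriv \<phi> (f p) = (\<Sum>i\<in>UNIV. ?D h c ?x i * ?D f c ?x i) / (\<Sum>i\<in>UNIV. ?D f c ?x i * ?D f c ?x i)"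
        using pos by simp
    qed
    show ?case
    proof (rule times_differentiable_on_SucI[OF o])
      fix t assume "t \<in> f ` ?R"
      then show "(\<phi> has_derivative (\<lambda>v. deriv \<phi> t * v)) (at t)"
        using descent_differentiable[OF U f Suc.prems] by (auto simp: has_field_derivative_def)
    next
      show "times_differentiable_on k (f ` ?R) (\<lambda>t. deriv \<phi> t * v)" for v
        by (rule times_differentiable_on_linear[OF o bounded_linear_mult_left Suc.IH[OF sm]]) simp
    qed
  qed
  then show ?thesis by (simp add: smooth_on_def)
qed

lemma projectable_fun_factor:
  assumes "projectable_fun V f h" obtains \<phi> where "\<And>p. p \<in> V \<Longrightarrow> h p = \<phi> (f p)"
proof (rule that[of "\<lambda>t. h (inv_into V f t)"])
  fix p assume p: "p \<in> V"
  then have "inv_into V f (f p) \<in> V" "f (inv_into V f (f p)) = f p"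
    by (auto intro: inv_into_into f_inv_into_f)
  then show "h p = h (inv_into V f (f p))" using assms p unfolding projectable_fun_def by metis
qed

text \<open>Since \<open>dh(X) = (\<phi>' \<circ> f) df(X)\<close> when \<open>h = \<phi> \<circ> f\<close>.\<close>

lemma differential_projectable:
  assumes U: "open U" and f: "smooth_fun \<A> U f" and h: "smooth_fun \<A> (regular_set \<A> U f) h"
    and hp: "projectable_fun (regular_set \<A> U f) f h"
    and X: "\<And>p. p \<in> regular_set \<A> U f \<Longrightarrow> X p \<in> tangent_space \<A> p"
    and fX: "projectable_fun (regular_set \<A> U f) f (\<lambda>p. differential \<A> f p (X p))"
  shows "projectable_fun (regular_set \<A> U f) f (\<lambda>p. differential \<A> h p (X p))"
proof -
  obtain \<phi> where \<phi>: "\<And>p. p \<in> regular_set \<A> U f \<Longrightarrow> h p = \<phi> (f p)" using projectable_fun_factor[OF hp] by blast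
  have "differential \<A> h p (X p) = deriv \<phi> (f p) * differential \<A> f p (X p)" if p: "p \<in> regular_set \<A> U f" for p
  proof -
    have pU: "p \<in> U" using p by (simp add: regular_set_def)
    show ?thesis
      unfolding smooth_differential_chart[OF h p chart_at_in X[OF p]] smooth_differential_chart[OF f pU chart_at_in X[OF p]]
      by (rule descent_chain_rule[OF U f h \<phi> p chart_at_in])
  qed
  then show ?thesis using fX unfolding projectable_fun_def by metis
qed

end

section \<open>Isoparametric functions and projectability\<close>

lemma projectable_funD: "projectable_fun V f h \<Longrightarrow> p \<in> V \<Longrightarrow> q \<in> V \<Longrightarrow> f p = f q \<Longrightarrow> h p = h q"
  unfolding projectable_fun_def by blast

lemma projectable_fun_pointwise:
  assumes "projectable_fun V f g" "projectable_fun V f h" "\<And>p. p \<in> V \<Longrightarrow> k p = K (g p) (h p)"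
  shows "projectable_fun V f k"
  using assms unfolding projectable_fun_def by metis

context manifold_atlas
begin

lemma gradient_fieldD:
  assumes "gradient_field \<A> A F U f X"
  shows "smooth_vector_field \<A> (regular_set \<A> U f) X"
    and "p \<in> regular_set \<A> U f \<Longrightarrow> (p, X p) \<in> off_zero A"
    and "p \<in> regular_set \<A> U f \<Longrightarrow> u \<in> tangent_space \<A> p \<Longrightarrow>
      fundamental_tensor F p (X p) (X p) u = differential \<A> f p u"
  using assms unfolding gradient_field_def by blast+

lemma isoparametricD:
  assumes iso: "isoparametric \<A> A F \<nu> U f" and "\<And>\<xi>. \<xi> \<in> A \<Longrightarrow> F \<xi> \<ge> 0"
  shows "\<exists>X. gradient_field \<A> A F U f X \<and>
    projectable_fun (regular_set \<A> U f) f (\<lambda>p. F (p, X p)) \<and>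
    projectable_fun (regular_set \<A> U f) f (divergence \<A> \<nu> X)"
proof -
  let ?R = "regular_set \<A> U f"
  obtain X a b where X: "gradient_field \<A> A F U f X"
    and ab: "\<forall>p\<in>?R. (F (p, X p))\<^sup>2 = b (f p) \<and> divergence \<A> \<nu> X p = a (f p)"
    using iso unfolding isoparametric_def by blast
  have nonneg: "F (p, X p) \<ge> 0" if "p \<in> ?R" for p
    using gradient_fieldD(2)[OF X that] assms(2) by (auto simp: off_zero_def)
  show ?thesis
  proof (intro exI[of _ X] conjI X)
    show "projectable_fun ?R f (\<lambda>p. F (p, X p))"
      unfolding projectable_fun_def using ab nonneg by (metis power2_eq_imp_eq)
    show "projectable_fun ?R f (divergence \<A> \<nu> X)"
      unfolding projectable_fun_def using ab by metis
  qed
qed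

text \<open>Conversely the functions \<open>a\<close> and \<open>b\<close> inherit their regularity from that of the length and
  divergence of the gradient, because \<open>f\<close> is a submersion where \<open>df \<noteq> 0\<close>.\<close>

lemma isoparametricI:
  assumes \<nu>: "volume_form \<A> \<nu>" and adm: "admissible \<A> A F U f" and nonconst: "\<not> f constant_on U"
    and X: "gradient_field \<A> A F U f X"
    and sm: "smooth_fun \<A> (regular_set \<A> U f) (\<lambda>p. F (p, X p))"
    and projF: "projectable_fun (regular_set \<A> U f) f (\<lambda>p. F (p, X p))"
    and projdiv: "projectable_fun (regular_set \<A> U f) f (divergence \<A> \<nu> X)"
  shows "isoparametric \<A> A F \<nu> U f"
proof -
  let ?R = "regular_set \<A> U f"
  have U: "open U" and f: "smooth_fun \<A> U f" using adm by (auto simp: admissible_def)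
  have R: "open ?R" by (rule open_regular_set[OF f U])
  have o: "open (f ` ?R)" by (rule open_image_regular_set[OF U f])
  obtain \<beta> where \<beta>: "\<And>p. p \<in> ?R \<Longrightarrow> F (p, X p) = \<beta> (f p)" using projectable_fun_factor[OF projF] by blast
  obtain a where a: "\<And>p. p \<in> ?R \<Longrightarrow> divergence \<A> \<nu> X p = a (f p)" using projectable_fun_factor[OF projdiv] by blast
  have sm\<beta>: "smooth_on (f ` ?R) \<beta>" by (rule descent_smooth[OF U f sm \<beta>])
  then have b: "smooth_on (f ` ?R) (\<lambda>t. \<beta> t * \<beta> t)" by (intro smooth_on_mult[OF o])
  have "smooth_on (f ` ?R) a"
    by (rule descent_smooth[OF U f smooth_fun_divergence[OF \<nu> R gradient_fieldD(1)[OF X]] a])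
  then have ca: "continuous_on (f ` ?R) a" by (rule smooth_on_continuous)
  have cb: "continuous_on (f ` ?R) (\<lambda>t. \<beta> t * \<beta> t)" by (rule smooth_on_continuous[OF b])
  have "(F (p, X p))\<^sup>2 = \<beta> (f p) * \<beta> (f p)" if "p \<in> ?R" for p by (simp add: \<beta>[OF that] power2_eq_square)
  then have "\<forall>p\<in>?R. (F (p, X p))\<^sup>2 = (\<lambda>t. \<beta> t * \<beta> t) (f p) \<and> divergence \<A> \<nu> X p = a (f p)" using a by blast
  moreover have "smooth_on (interior (f ` ?R)) (\<lambda>t. \<beta> t * \<beta> t)" using b o by (simp add: interior_open)
  ultimately show ?thesis
    unfolding isoparametric_def using adm nonconst X ca cb by blast
qed

section \<open>Gradients with respect to navigation data\<close>

context
  fixes F Z :: "'m \<times> ('m, 'n) tvec \<Rightarrow> real"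
    and A :: "('m \<times> ('m, 'n) tvec) set" and W :: "'m \<Rightarrow> ('m, 'n) tvec"
    and \<nu> :: "('m, 'n) chart \<Rightarrow> 'm \<Rightarrow> real" and U :: "'m set" and f :: "'m \<Rightarrow> real"
  assumes F: "finsler_metric \<A> F" and W: "smooth_vector_field \<A> UNIV W"
    and Z: "conic_zermelo_metric \<A> F W A Z" and \<nu>: "volume_form \<A> \<nu>"
    and U: "open U" and f: "smooth_fun \<A> U f"
begin

abbreviation "R \<equiv> regular_set \<A> U f"
abbreviation "\<omega> \<equiv> \<lambda>p. differential \<A> f p (W p)"

lemma open_R: "open R" by (rule open_regular_set[OF f U])

lemma R_subset: "R \<subseteq> U" by (auto simp: regular_set_def)

lemma W_tangent: "W p \<in> tangent_space \<A> p" using smooth_vector_fieldD(1)[OF W] by blast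

lemma smooth_f_R: "smooth_fun \<A> R f" by (rule smooth_fun_subset[OF f R_subset])

lemma smooth_W_R: "smooth_vector_field \<A> R W" by (rule smooth_vector_field_subset[OF W]) simp

lemma smooth_\<omega>: "smooth_fun \<A> R \<omega>" by (rule smooth_fun_differential[OF open_R smooth_f_R smooth_W_R])

text \<open>A gradient for \<open>Z\<close> is Legendre dual to \<open>df\<close>, so the pointwise duality applies with \<open>\<xi> = df\<close>.\<close>

lemma gradient_dual:
  assumes X: "gradient_field \<A> A Z U f X" and p: "p \<in> R"
  defines "Y \<equiv> tscale (Z (p, X p) - \<omega> p) (tadd (tscale (1 / Z (p, X p)) (X p)) (tscale (-1) (W p)))"
  shows "Z (p, X p) > 0" "(Z (p, X p))\<^sup>2 = differential \<A> f p (X p)" "Z (p, X p) - \<omega> p > 0"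
    "Y \<in> tangent_space \<A> p" "Y \<noteq> tzero" "F (p, Y) = Z (p, X p) - \<omega> p"
    "\<And>v. v \<in> tangent_space \<A> p \<Longrightarrow> fundamental_tensor F p Y Y v = differential \<A> f p v"
proof -
  note dual = zermelo_legendre_dual[OF F Z W_tangent gradient_fieldD(2)[OF X p]]
  note \<xi> = gradient_fieldD(3)[OF X p]
  have Y: "Y = tscale (Z (p, X p) - fundamental_tensor Z p (X p) (X p) (W p))
      (tadd (tscale (1 / Z (p, X p)) (X p)) (tscale (-1) (W p)))"
    unfolding Y_def \<xi>[OF W_tangent] ..
  show "Z (p, X p) > 0" by (rule dual(2))
  show "(Z (p, X p))\<^sup>2 = differential \<A> f p (X p)" using dual(3) \<xi>[OF dual(1)] by simp
  show "Z (p, X p) - \<omega> p > 0" using dual(4) unfolding \<xi>[OF W_tangent] .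
  show "Y \<in> tangent_space \<A> p" unfolding Y by (rule dual(5))
  show "Y \<noteq> tzero" unfolding Y by (rule dual(6))
  show "F (p, Y) = Z (p, X p) - \<omega> p" using dual(7) unfolding Y_def \<xi>[OF W_tangent] .
  show "fundamental_tensor F p Y Y v = differential \<A> f p v" if "v \<in> tangent_space \<A> p" for v
    using dual(8)[OF that] unfolding Y_def \<xi>[OF W_tangent] \<xi>[OF that] .
qed

text \<open>Euler's relation makes \<open>Z(\<nabla>f)\<close> the square root of \<open>df(\<nabla>f)\<close>, whose smoothness is plain from that of
  \<open>\<nabla>f\<close>.\<close>

lemma smooth_length:
  assumes X: "gradient_field \<A> A Z U f X"
  shows "smooth_fun \<A> R (\<lambda>p. Z (p, X p))" and "smooth_fun \<A> R (\<lambda>p. Z (p, X p) - \<omega> p)"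
proof -
  have "smooth_fun \<A> R (\<lambda>p. sqrt (differential \<A> f p (X p)))"
  proof (rule smooth_fun_sqrt[OF open_R smooth_fun_differential[OF open_R smooth_f_R gradient_fieldD(1)[OF X]]])
    fix p assume "p \<in> R"
    then show "differential \<A> f p (X p) > 0"
      using gradient_dual(1,2)[OF X] by (metis zero_less_power)
  qed
  then show Z: "smooth_fun \<A> R (\<lambda>p. Z (p, X p))"
  proof (rule smooth_fun_cong[OF open_R])
    fix p assume p: "p \<in> R"
    show "Z (p, X p) = sqrt (differential \<A> f p (X p))"
      unfolding gradient_dual(2)[OF X p, symmetric] using gradient_dual(1)[OF X p] by simp
  qed
  show "smooth_fun \<A> R (\<lambda>p. Z (p, X p) - \<omega> p)" by (rule smooth_fun_diff[OF open_R Z smooth_\<omega>])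
qed

lemma navigation_gradient_exists:
  assumes X: "gradient_field \<A> A Z U f X"
  shows "\<exists>Y. gradient_field \<A> (tangent_bundle \<A>) F U f Y"
proof -
  let ?\<zeta> = "\<lambda>p. Z (p, X p)"
  define Y where "Y p = (if p \<in> R then tscale (?\<zeta> p - \<omega> p) (tadd (tscale (1 / ?\<zeta> p) (X p)) (tscale (-1) (W p))) else tzero)" for p
  have Y: "Y p = tadd (tscale ((?\<zeta> p - \<omega> p) / ?\<zeta> p) (X p)) (tscale (\<omega> p - ?\<zeta> p) (W p))" if "p \<in> R" for p
  proof
    fix c
    have neg: "(\<omega> p - ?\<zeta> p) *\<^sub>R v = - ((?\<zeta> p - \<omega> p) *\<^sub>R v)" for v :: "real ^ 'n"
      by (simp add: scaleR_diff_left)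
    show "Y p c = tadd (tscale ((?\<zeta> p - \<omega> p) / ?\<zeta> p) (X p)) (tscale (\<omega> p - ?\<zeta> p) (W p)) c"
      using that by (simp add: Y_def tadd_def tscale_def scaleR_diff_right neg)
  qed
  have "smooth_vector_field \<A> R (\<lambda>p. tadd (tscale ((?\<zeta> p - \<omega> p) / ?\<zeta> p) (X p)) (tscale (\<omega> p - ?\<zeta> p) (W p)))"
    by (intro smooth_vector_field_combine smooth_fun_divide smooth_fun_diff smooth_length[OF X] smooth_\<omega>
        open_R smooth_W_R gradient_fieldD(1)[OF X]) (use gradient_dual(1)[OF X] in force)
  then have smY: "smooth_vector_field \<A> R Y" by (rule smooth_vector_field_cong[OF open_R]) (rule Y)
  have "gradient_field \<A> (tangent_bundle \<A>) F U f Y"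
    unfolding gradient_field_def
  proof (intro conjI ballI smY)
    fix p assume p: "p \<in> R"
    show "(p, Y p) \<in> off_zero (tangent_bundle \<A>)"
      using gradient_dual(4,5)[OF X p] p by (simp add: Y_def off_zero_def tangent_bundle_def)
    show "fundamental_tensor F p (Y p) (Y p) u = differential \<A> f p u" if "u \<in> tangent_space \<A> p" for u
      using gradient_dual(7)[OF X p that] p by (simp add: Y_def)
  qed (simp add: Y_def)
  then show ?thesis by blast
qed

text \<open>By uniqueness any gradient \<open>Y\<close> for \<open>F\<close> is the dual of \<open>X\<close> computed above; solving for \<open>X\<close> expresses it
  through \<open>Y\<close> and \<open>W\<close>.\<close>

lemma navigation_gradients:
  assumes X: "gradient_field \<A> A Z U f X" and Y: "gradient_field \<A> (tangent_bundle \<A>) F U f Y" and p: "p \<in> R"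
  shows "Z (p, X p) = F (p, Y p) + \<omega> p" "F (p, Y p) > 0" "(F (p, Y p))\<^sup>2 = differential \<A> f p (Y p)"
    "X p = tadd (tscale (Z (p, X p) / F (p, Y p)) (Y p)) (tscale (Z (p, X p)) (W p))"
proof -
  note dual = gradient_dual[OF X p]
  let ?Y = "tscale (Z (p, X p) - \<omega> p) (tadd (tscale (1 / Z (p, X p)) (X p)) (tscale (-1) (W p)))"
  have Yp: "Y p \<in> tangent_space \<A> p" "Y p \<noteq> tzero"
    using gradient_fieldD(2)[OF Y p] by (auto simp: off_zero_def tangent_bundle_def)
  have eq: "Y p = ?Y"
    by (rule finsler_gradient_unique[OF F Yp dual(4,5)]) (simp add: gradient_fieldD(3)[OF Y p] dual(7))
  show 1: "Z (p, X p) = F (p, Y p) + \<omega> p" using dual(6) by (simp add: eq)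
  then show 2: "F (p, Y p) > 0" using dual(3) by simp
  have "fundamental_tensor F p (Y p) (Y p) (Y p) = (F (p, Y p))\<^sup>2"
  proof -
    define c where "c = chart_at \<A> p"
    have c: "c \<in> charts_at \<A> p" unfolding c_def by (rule chart_at_in)
    let ?h = "\<lambda>y. F (p, tvec_of \<A> c p y)"
    interpret homogeneous_on_cone "UNIV - {0}" ?h "\<lambda>y. frechet_derivative ?h (at y)"
      using metric_on_fibre[OF F[unfolded finsler_metric_def] c] unfolding off_zero_tangent_bundle_fibre[OF c] .
    have nz: "Y p c \<in> UNIV - {0}" using Yp tangent_eq_tzero_iff[OF Yp(1) c] by simp
    show ?thesis
      unfolding fundamental_tensor_coord[OF c Yp(1) Yp(1) Yp(1)] hessian_diagonal[OF nz] euler[OF nz]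
        tvec_of_component[OF c Yp(1)] power2_eq_square ..
  qed
  then show "(F (p, Y p))\<^sup>2 = differential \<A> f p (Y p)" using gradient_fieldD(3)[OF Y p Yp(1)] by simp
  show "X p = tadd (tscale (Z (p, X p) / F (p, Y p)) (Y p)) (tscale (Z (p, X p)) (W p))"
  proof
    fix c
    have Yc: "Y p c = F (p, Y p) *\<^sub>R ((1 / Z (p, X p)) *\<^sub>R X p c - W p c)"
      using fun_cong[OF eq, of c] 1 by (simp add: tadd_def tscale_def)
    show "X p c = tadd (tscale (Z (p, X p) / F (p, Y p)) (Y p)) (tscale (Z (p, X p)) (W p)) c"
      using 2 dual(1) by (simp add: tadd_def tscale_def Yc scaleR_diff_right)
  qed
qed

lemma navigation_smooth_length:
  assumes X: "gradient_field \<A> A Z U f X" and Y: "gradient_field \<A> (tangent_bundle \<A>) F U f Y"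
  shows "smooth_fun \<A> R (\<lambda>p. F (p, Y p))"
  by (rule smooth_fun_cong[OF open_R smooth_length(2)[OF X]]) (use navigation_gradients(1)[OF X Y] in simp)

lemma navigation_divergence:
  assumes X: "gradient_field \<A> A Z U f X" and Y: "gradient_field \<A> (tangent_bundle \<A>) F U f Y" and p: "p \<in> R"
  shows "divergence \<A> \<nu> X p = Z (p, X p) / F (p, Y p) * divergence \<A> \<nu> Y p
      + differential \<A> (\<lambda>p. Z (p, X p) / F (p, Y p)) p (Y p)
      + Z (p, X p) * divergence \<A> \<nu> W p + differential \<A> (\<lambda>p. Z (p, X p)) p (W p)"
proof (rule divergence_combine[OF \<nu> open_R _ smooth_length(1)[OF X] gradient_fieldD(1)[OF Y] smooth_W_R
      gradient_fieldD(1)[OF X] navigation_gradients(4)[OF X Y] p])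
  show "smooth_fun \<A> R (\<lambda>p. Z (p, X p) / F (p, Y p))"
    by (rule smooth_fun_divide[OF open_R smooth_length(1)[OF X] navigation_smooth_length[OF X Y]])
      (use navigation_gradients(2)[OF X Y] in force)
qed

text \<open>When \<open>\<omega>\<close> and the lengths of the gradients are projectable, the divergences of the two gradients
  and of \<open>W\<close> satisfy an affine relation with projectable coefficients, and each of the three enters
  it with a nonzero factor; so two of them determine the projectability of the third.\<close>

lemma navigation_divergence_projectable:
  assumes X: "gradient_field \<A> A Z U f X" and Y: "gradient_field \<A> (tangent_bundle \<A>) F U f Y"
    and proj: "projectable_fun R f \<omega>" "projectable_fun R f (\<lambda>p. F (p, Y p))"
      "projectable_fun R f (\<lambda>p. Z (p, X p))"
  shows "\<exists>r e. projectable_fun R f r \<and> projectable_fun R f e \<and> (\<forall>p\<in>R. r p > 0 \<and> Z (p, X p) > 0 \<and>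
    divergence \<A> \<nu> X p = r p * divergence \<A> \<nu> Y p + e p + Z (p, X p) * divergence \<A> \<nu> W p)"
proof -
  let ?r = "\<lambda>p. Z (p, X p) / F (p, Y p)"
  let ?e = "\<lambda>p. differential \<A> ?r p (Y p) + differential \<A> (\<lambda>p. Z (p, X p)) p (W p)"
  have pos: "F (p, Y p) > 0" "Z (p, X p) > 0" if "p \<in> R" for p
    using navigation_gradients(2)[OF X Y that] gradient_dual(1)[OF X that] by auto
  have r: "projectable_fun R f ?r" by (rule projectable_fun_pointwise[OF proj(3,2)]) simp
  have smr: "smooth_fun \<A> R ?r"
    by (rule smooth_fun_divide[OF open_R smooth_length(1)[OF X] navigation_smooth_length[OF X Y]])
      (use pos in force)
  have Yt: "Y p \<in> tangent_space \<A> p" if "p \<in> R" for p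
    by (rule smooth_vector_fieldD(1)[OF gradient_fieldD(1)[OF Y] that])
  have fY: "projectable_fun R f (\<lambda>p. differential \<A> f p (Y p))"
    by (rule projectable_fun_pointwise[OF proj(2,2), where K = "\<lambda>x y. x\<^sup>2"])
      (simp add: navigation_gradients(3)[OF X Y])
  have "projectable_fun R f (\<lambda>p. differential \<A> ?r p (Y p))"
    by (rule differential_projectable[OF U f smr r Yt fY])
  moreover have "projectable_fun R f (\<lambda>p. differential \<A> (\<lambda>p. Z (p, X p)) p (W p))"
    by (rule differential_projectable[OF U f smooth_length(1)[OF X] proj(3) W_tangent proj(1)])
  ultimately have e: "projectable_fun R f ?e" by (rule projectable_fun_pointwise) simp
  show ?thesis
    by (intro exI[of _ ?r] exI[of _ ?e] conjI ballI r e) (use pos navigation_divergence[OF X Y] in simp_all)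
qed

lemma metrics_nonneg: "\<xi> \<in> A \<Longrightarrow> Z \<xi> \<ge> 0" "\<xi> \<in> tangent_bundle \<A> \<Longrightarrow> F \<xi> \<ge> 0"
proof -
  have "conic_finsler_metric \<A> A Z" using Z unfolding conic_zermelo_metric_def by (elim conjE)
  then have "\<forall>\<xi>\<in>A. Z \<xi> \<ge> 0" unfolding conic_finsler_metric_def by (elim conjE)
  then show "\<xi> \<in> A \<Longrightarrow> Z \<xi> \<ge> 0" by (rule bspec)
  have "\<forall>\<xi>\<in>tangent_bundle \<A>. F \<xi> \<ge> 0"
    using F unfolding finsler_metric_def conic_finsler_metric_def by (elim conjE)
  then show "\<xi> \<in> tangent_bundle \<A> \<Longrightarrow> F \<xi> \<ge> 0" by (rule bspec)
qed

section \<open>Transfer of isoparametric functions\<close>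

lemma isoparametric_transfer:
  assumes adm: "admissible \<A> A Z U f"
    and W': "projectable_vf \<A> R f W" and divW: "projectable_fun R f (divergence \<A> \<nu> W)"
  shows "isoparametric \<A> (tangent_bundle \<A>) F \<nu> U f \<longleftrightarrow> isoparametric \<A> A Z \<nu> U f"
proof
  have \<omega>: "projectable_fun R f \<omega>" by (rule projectable_differential[OF open_R smooth_f_R W W'])
  {
    assume iso: "isoparametric \<A> (tangent_bundle \<A>) F \<nu> U f"
    obtain Y where Y: "gradient_field \<A> (tangent_bundle \<A>) F U f Y"
      and pF: "projectable_fun R f (\<lambda>p. F (p, Y p))" and pdiv: "projectable_fun R f (divergence \<A> \<nu> Y)"
      using isoparametricD[OF iso metrics_nonneg(2)] by blast
    obtain X where X: "gradient_field \<A> A Z U f X" using adm unfolding admissible_def by blast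
    have pZ: "projectable_fun R f (\<lambda>p. Z (p, X p))"
      by (rule projectable_fun_pointwise[OF pF \<omega>]) (rule navigation_gradients(1)[OF X Y])
    obtain r e where re: "projectable_fun R f r" "projectable_fun R f e"
      "\<And>p. p \<in> R \<Longrightarrow> divergence \<A> \<nu> X p = r p * divergence \<A> \<nu> Y p + e p + Z (p, X p) * divergence \<A> \<nu> W p"
      using navigation_divergence_projectable[OF X Y \<omega> pF pZ] by blast
    have "projectable_fun R f (divergence \<A> \<nu> X)"
      unfolding projectable_fun_def
    proof (intro ballI impI)
      fix p q assume pq: "p \<in> R" "q \<in> R" "f p = f q"
      show "divergence \<A> \<nu> X p = divergence \<A> \<nu> X q"
        unfolding re(3)[OF pq(1)] re(3)[OF pq(2)] projectable_funD[OF re(1) pq] projectable_funD[OF re(2) pq]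
          projectable_funD[OF pZ pq] projectable_funD[OF divW pq] projectable_funD[OF pdiv pq] ..
    qed
    moreover have "\<not> f constant_on U" using iso unfolding isoparametric_def by blast
    ultimately show "isoparametric \<A> A Z \<nu> U f"
      by (intro isoparametricI[OF \<nu> adm _ X smooth_length(1)[OF X] pZ])
  }
  {
    assume iso: "isoparametric \<A> A Z \<nu> U f"
    obtain X where X: "gradient_field \<A> A Z U f X"
      and pZ: "projectable_fun R f (\<lambda>p. Z (p, X p))" and pdiv: "projectable_fun R f (divergence \<A> \<nu> X)"
      using isoparametricD[OF iso metrics_nonneg(1)] by blast
    obtain Y where Y: "gradient_field \<A> (tangent_bundle \<A>) F U f Y" using navigation_gradient_exists[OF X] by blast
    have admF: "admissible \<A> (tangent_bundle \<A>) F U f" using U f Y unfolding admissible_def by blast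
    have pF: "projectable_fun R f (\<lambda>p. F (p, Y p))"
      by (rule projectable_fun_pointwise[OF pZ \<omega>, where K = "(-)"]) (simp add: navigation_gradients(1)[OF X Y])
    obtain r e where re: "projectable_fun R f r" "projectable_fun R f e" "\<And>p. p \<in> R \<Longrightarrow> r p > 0"
      "\<And>p. p \<in> R \<Longrightarrow> divergence \<A> \<nu> X p = r p * divergence \<A> \<nu> Y p + e p + Z (p, X p) * divergence \<A> \<nu> W p"
      using navigation_divergence_projectable[OF X Y \<omega> pF pZ] by blast
    have "projectable_fun R f (divergence \<A> \<nu> Y)"
      unfolding projectable_fun_def
    proof (intro ballI impI)
      fix p q assume pq: "p \<in> R" "q \<in> R" "f p = f q"
      show "divergence \<A> \<nu> Y p = divergence \<A> \<nu> Y q"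
        using re(4)[OF pq(1)] re(4)[OF pq(2)] re(3)[OF pq(2)] projectable_funD[OF re(1) pq] projectable_funD[OF re(2) pq]
          projectable_funD[OF pZ pq] projectable_funD[OF divW pq] projectable_funD[OF pdiv pq] by simp
    qed
    moreover have "\<not> f constant_on U" using iso unfolding isoparametric_def by blast
    ultimately show "isoparametric \<A> (tangent_bundle \<A>) F \<nu> U f"
      by (intro isoparametricI[OF \<nu> admF _ Y navigation_smooth_length[OF X Y] pF])
  }
qed

lemma projectable_if_both_isoparametric:
  assumes isoF: "isoparametric \<A> (tangent_bundle \<A>) F \<nu> U f" and isoZ: "isoparametric \<A> A Z \<nu> U f"
  shows "projectable_vf \<A> R f W" and "projectable_fun R f (divergence \<A> \<nu> W)"
proof -
  obtain Y where Y: "gradient_field \<A> (tangent_bundle \<A>) F U f Y"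
    and pF: "projectable_fun R f (\<lambda>p. F (p, Y p))" and pdivY: "projectable_fun R f (divergence \<A> \<nu> Y)"
    using isoparametricD[OF isoF metrics_nonneg(2)] by blast
  obtain X where X: "gradient_field \<A> A Z U f X"
    and pZ: "projectable_fun R f (\<lambda>p. Z (p, X p))" and pdivX: "projectable_fun R f (divergence \<A> \<nu> X)"
    using isoparametricD[OF isoZ metrics_nonneg(1)] by blast
  have \<omega>: "projectable_fun R f \<omega>"
    by (rule projectable_fun_pointwise[OF pZ pF, where K = "(-)"]) (simp add: navigation_gradients(1)[OF X Y])
  obtain w where w: "\<And>p. p \<in> R \<Longrightarrow> \<omega> p = w (f p)" using projectable_fun_factor[OF \<omega>] by blast
  have "smooth_on (f ` R) w" by (rule descent_smooth[OF U f smooth_\<omega> w])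
  then show "projectable_vf \<A> R f W"
    by (intro projectable_vf_if_differential[OF open_R smooth_f_R W _ w]) (simp add: smooth_on_def)
  obtain r e where re: "projectable_fun R f r" "projectable_fun R f e" "\<And>p. p \<in> R \<Longrightarrow> Z (p, X p) > 0"
    "\<And>p. p \<in> R \<Longrightarrow> divergence \<A> \<nu> X p = r p * divergence \<A> \<nu> Y p + e p + Z (p, X p) * divergence \<A> \<nu> W p"
    using navigation_divergence_projectable[OF X Y \<omega> pF pZ] by blast
  show "projectable_fun R f (divergence \<A> \<nu> W)"
    unfolding projectable_fun_def
  proof (intro ballI impI)
    fix p q assume pq: "p \<in> R" "q \<in> R" "f p = f q"
    show "divergence \<A> \<nu> W p = divergence \<A> \<nu> W q"
      using re(4)[OF pq(1)] re(4)[OF pq(2)] re(3)[OF pq(2)] projectable_funD[OF re(1) pq] projectable_funD[OF re(2) pq]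
        projectable_funD[OF pZ pq] projectable_funD[OF pdivX pq] projectable_funD[OF pdivY pq] by simp
  qed
qed

end

end

theorem corollary5p2:
  fixes \<A> :: "('m::{t2_space,second_countable_topology}, 'n::finite) chart set"
    and F Z :: "'m \<times> ('m, 'n) tvec \<Rightarrow> real"
    and A :: "('m \<times> ('m, 'n) tvec) set"
    and W :: "'m \<Rightarrow> ('m, 'n) tvec"
    and \<nu> :: "('m, 'n) chart \<Rightarrow> 'm \<Rightarrow> real"
    and U :: "'m set" and f :: "'m \<Rightarrow> real"
  defines "R \<equiv> regular_set \<A> U f"
    and "TM \<equiv> tangent_bundle \<A>"
  assumes "smooth_manifold \<A>" and "connected (UNIV :: 'm set)"
    and "finsler_metric \<A> F" and "smooth_vector_field \<A> UNIV W"
    and "conic_zermelo_metric \<A> F W A Z"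
    and "volume_form \<A> \<nu>"
    and "admissible \<A> A Z U f"
  shows
    "(projectable_vf \<A> R f W \<and> projectable_fun R f (divergence \<A> \<nu> W)
        \<longrightarrow> (isoparametric \<A> TM F \<nu> U f \<longleftrightarrow> isoparametric \<A> A Z \<nu> U f)) \<and>
     (isoparametric \<A> TM F \<nu> U f \<or> isoparametric \<A> A Z \<nu> U f
        \<longrightarrow> (isoparametric \<A> TM F \<nu> U f \<longleftrightarrow> isoparametric \<A> A Z \<nu> U f)
        \<longrightarrow> projectable_vf \<A> R f W \<and> projectable_fun R f (divergence \<A> \<nu> W))"
proof -
  interpret manifold_atlas \<A> by unfold_locales fact
  have U: "open U" and f: "smooth_fun \<A> U f" using assms(9) by (auto simp: admissible_def)
  note data = assms(5-8) U f
  show ?thesis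
    unfolding R_def TM_def
    using isoparametric_transfer[OF data assms(9)] projectable_if_both_isoparametric[OF data] by blast
qed

end
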